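(* Let $p$ be a prime, let $f$ be a positive integer and let $q=p^f$. Let $G=V\rtimes H$ be a primitive subgroup of $\mathrm{A}\Gamma\mathrm{L}_1(q)$, where $V=\mathbb{F}_q$ is the group of translations and $H\le\Gamma\mathrm{L}_1(q)$ is the stabilizer of the zero vector. Then $G$ is non-basic if and only if all of the following hold: (i) $p\equiv 3\pmod 4$; (ii) $f=2$; (iii) $H$ is a dihedral $2$-group and $H$ is $\mathrm{GL}_1(q)$-conjugate to $\langle\sigma,\lambda^{(p-1)e}\rangle$ for some divisor $e$ of $p+1$.
   Context: Notation: $\lambda$ is a generator of the multiplicative group $\mathbb{F}_q^\ast=\mathrm{GL}_1(q)$ (acting on $\mathbb{F}_q$ by multiplication), and $\sigma:x\mapsto x^p$ is the Frobenius automorphism of $\mathbb{F}_q$. Then $\Gamma\mathrm{L}_1(q)=\langle\lambda\rangle\rtimes\langle\sigma\rangle$ and $\mathrm{A}\Gamma\mathrm{L}_1(q)=\mathbb{F}_q\rtimes\Gamma\mathrm{L}_1(q)$, acting on $\mathbb{F}_q$. The group $G=V\rtimes H$ is primitive (in its action on $V$) if and only if $V$ is an irreducible $\mathbb{F}_pH$-module. For a finite group $X$, the normal covering number $\gamma(X)$ is the smallest $k$ such that there are $k$ proper subgroups $H_1,\dots,H_k$ of $X$ with $X=\bigcup_{i=1}^k\bigcup_{x\in X}H_i^x$; if no such $k$ exists then $\gamma(X)\ne 2$. Thus $\gamma(X)=2$ if and only if $X$ is the union of the conjugates of two proper subgroups. A finite group $G$ is called non-basic (of affine type) if $G$ has a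 unique minimal normal subgroup $V$, $V$ is abelian, $\gamma(G/V)\neq 2$, and $\gamma(G)\neq 2$.
   Formalization: The stabilizer H is additionally assumed nontrivial; if H = 1 then f = 1 and G = V is cyclic of order p, which is non-basic under the stated conventions although f ≠ 2, so the claim fails exactly in that case. *)

theory Defs
  imports "HOL-Algebra.Algebra" "HOL-Library.Extended_Nat" "HOL-Library.Cardinality"
    "HOL-Computational_Algebra.Primes"
begin

definition conjugate_subgroup :: "('g, 'm) monoid_scheme \<Rightarrow> 'g set \<Rightarrow> 'g \<Rightarrow> 'g set" where
  "conjugate_subgroup G K x = (inv\<^bsub>G\<^esub> x <#\<^bsub>G\<^esub> K) #>\<^bsub>G\<^esub> x"

definition has_normal_covering :: "('g, 'm) monoid_scheme \<Rightarrow> nat \<Rightarrow> bool" where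
  "has_normal_covering G k \<longleftrightarrow>
     (\<exists>Hs. length Hs = k \<and>
        (\<forall>K\<in>set Hs. subgroup K G \<and> K \<noteq> carrier G) \<and>
        carrier G = (\<Union>K\<in>set Hs. \<Union>x\<in>carrier G. conjugate_subgroup G K x))"

text \<open>The value is \<open>\<infinity>\<close>, the infimum of the empty set, when \<open>G\<close> has no normal covering by
  proper subgroups, which is the case exactly for cyclic \<open>G\<close> (including the trivial group).\<close>

definition normal_covering_number :: "('g, 'm) monoid_scheme \<Rightarrow> enat" where
  "normal_covering_number G = Inf (enat ` {k. has_normal_covering G k})"

definition minimal_normal :: "'g set \<Rightarrow> ('g, 'm) monoid_scheme \<Rightarrow> bool" where
  "minimal_normal N G \<longleftrightarrow>
     N \<lhd> G \<and> N \<noteq> {\<one>\<^bsub>G\<^esub>} \<and>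
     (\<forall>K. K \<lhd> G \<and> K \<subseteq> N \<longrightarrow> K = {\<one>\<^bsub>G\<^esub>} \<or> K = N)"

definition non_basic :: "('g, 'm) monoid_scheme \<Rightarrow> bool" where
  "non_basic G \<longleftrightarrow>
     group G \<and> finite (carrier G) \<and>
     (\<exists>V. minimal_normal V G \<and> (\<forall>N. minimal_normal N G \<longrightarrow> N = V) \<and>
        comm_group (G\<lparr>carrier := V\<rparr>) \<and>
        normal_covering_number (G Mod V) \<noteq> 2 \<and>
        normal_covering_number G \<noteq> 2)"

text \<open>The dihedral group of order \<open>2n\<close> is
  \<open>\<langle>r, s | r\<^sup>n = s\<^sup>2 = 1, s r s\<^sup>-\<^sup>1 = r\<^sup>-\<^sup>1\<rangle>\<close>; a group generated by such \<open>r\<close>, \<open>s\<close> is a quotient of it,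
  and the order condition makes it the whole group. Degenerate dihedral groups are excluded
  except for the Klein four-group.\<close>

definition dihedral :: "('g, 'm) monoid_scheme \<Rightarrow> bool" where
  "dihedral G \<longleftrightarrow>
     group G \<and>
     (\<exists>n r s. 2 \<le> (n::nat) \<and> order G = 2 * n \<and>
        r \<in> carrier G \<and> s \<in> carrier G \<and> generate G {r, s} = carrier G \<and>
        r [^]\<^bsub>G\<^esub> n = \<one>\<^bsub>G\<^esub> \<and> s [^]\<^bsub>G\<^esub> (2::nat) = \<one>\<^bsub>G\<^esub> \<and>
        s \<otimes>\<^bsub>G\<^esub> r \<otimes>\<^bsub>G\<^esub> inv\<^bsub>G\<^esub> s = inv\<^bsub>G\<^esub> r)"

text \<open>The finite field \<open>\<F>\<^sub>q\<close> is a type \<open>'a\<close>; permutation groups on it are subgroups of the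
  symmetric group \<open>Sym\<close>, whose product is composition of functions (acting on the left).\<close>

abbreviation Sym :: "('a \<Rightarrow> 'a) monoid" where
  "Sym \<equiv> BijGroup UNIV"

abbreviation sub :: "('a \<Rightarrow> 'a) set \<Rightarrow> ('a \<Rightarrow> 'a) monoid" where
  "sub K \<equiv> Sym\<lparr>carrier := K\<rparr>"

definition primitive :: "('a \<Rightarrow> 'a) set \<Rightarrow> bool" where
  "primitive G \<longleftrightarrow>
     transitive_action (sub G) UNIV (\<lambda>g. g) \<and>
     (\<forall>B. B \<noteq> {} \<and> (\<forall>g\<in>G. g ` B = B \<or> g ` B \<inter> B = {}) \<longrightarrow> (\<exists>x. B = {x}) \<or> B = UNIV)"

definition translation_group :: "('a::field \<Rightarrow> 'a) set" where
  "translation_group = range (\<lambda>v x. x + v)"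

definition scal :: "'a::field \<Rightarrow> 'a \<Rightarrow> 'a" where
  "scal a = (\<lambda>x. a * x)"

definition GL1 :: "('a::field \<Rightarrow> 'a) set" where
  "GL1 = scal ` (UNIV - {0})"

definition frob :: "nat \<Rightarrow> 'a::field \<Rightarrow> 'a" where
  "frob p = (\<lambda>x. x ^ p)"

definition GammaL1 :: "nat \<Rightarrow> ('a::field \<Rightarrow> 'a) set" where
  "GammaL1 p = GL1 <#>\<^bsub>Sym\<^esub> generate Sym {frob p}"

definition AGammaL1 :: "nat \<Rightarrow> ('a::field \<Rightarrow> 'a) set" where
  "AGammaL1 p = translation_group <#>\<^bsub>Sym\<^esub> GammaL1 p"

end

theory Submission
  imports Defs "HOL-Number_Theory.Residues"
begin

text \<open>
  Let \<open>A\<close> be the group of scalars in \<open>H\<close>, and let \<open>g\<close>, acting on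
  \<open>A\<close> as \<open>x \<mapsto> x ^ Q\<close>, generate \<open>H\<close> modulo
  \<open>A\<close>. An element \<open>v h\<close> of \<open>G\<close> such that \<open>h\<close> has
  no nonzero fixed vector is conjugate to \<open>h\<close>, so if the elements of \<open>H\<close> with
  nonzero fixed vectors lie in a proper subgroup \<open>K\<close>, then \<open>G\<close> is covered by the
  conjugates of \<open>H\<close> and \<open>V K\<close>. Hence these elements generate \<open>H\<close>
  when \<open>G\<close> is non-basic; moreover \<open>\<gamma>(H) \<noteq> 2\<close> forces \<open>Q
  \<equiv> 1\<close> modulo every prime divisor of \<open>|A|\<close>. An element with a nonzero fixed
  vector is conjugate to a field automorphism, so its powers meet \<open>A\<close> trivially, and by
  irreducibility no such element other than \<open>1\<close> is central. Comparing these conditions one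
  prime \<open>r\<close> at a time, through the \<open>r\<close>-adic valuations of the numbers \<open>(x
  ^ m - 1) / (x - 1)\<close>, leaves only \<open>r = 2\<close>, \<open>|H : A| = 2\<close> and
  \<open>A\<close> inverted by \<open>g\<close>; irreducibility then gives \<open>f = 2\<close>.

  Conversely, let \<open>H\<close> be a dihedral 2-group as in the theorem. Any two of the rotation
  \<open>\<alpha>\<close> and the reflections \<open>\<tau>\<close>, \<open>\<alpha> \<tau>\<close>
  generate \<open>H\<close>, even after replacing them by conjugates, so two proper subgroups cannot cover
  \<open>H\<close>. A proper subgroup of \<open>G\<close> that projects onto \<open>H\<close> is a
  complement of \<open>V\<close> and fixes a point; as both reflections have nonzero fixed vectors, some
  elements of \<open>G\<close> above each of them have no fixed point and must be covered by the other
  subgroup, which then projects onto \<open>H\<close> too, so that the translations are not covered.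
\<close>

section \<open>Normal coverings by two subgroups\<close>

text \<open>The clash behind the comparison at a prime r: let r^k and r^\<beta> be the r-parts of
  |A| and |H : A|. Since elements with nonzero fixed vectors have no nontrivial central powers,
  \<beta> < k whenever r divides |H : A|. On the other hand, these elements can generate H only if,
  for some d in A outside A^r, an element d s_0^j fixes a nonzero vector too, where s_0 is a given
  element with a nonzero fixed vector. Its scalar powers are then trivial, and this makes r^k divide
  a geometric sum of r^c terms with c \<le> \<beta>. A geometric sum of r^c terms whose ratio is 1
  modulo r has r-adic valuation exactly c, unless r = 2 and the ratio is 3 modulo 4. The dihedral
  groups live in this exception, and p = 3 modulo 4 is its trace in the theorem. Subgroups of H are
  described by conditions on the pair (u, j) that stands for x \<mapsto> u x^(p^j), so each step
  becomes a congruence between exponents.\<close>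

lemma (in group) mem_conjugate_subgroup_iff:
  assumes "K \<subseteq> carrier G" "x \<in> carrier G" "g \<in> carrier G"
  shows "g \<in> conjugate_subgroup G K x \<longleftrightarrow> x \<otimes> g \<otimes> inv x \<in> K"
proof
  assume "g \<in> conjugate_subgroup G K x"
  then obtain k where k: "k \<in> K" "g = inv x \<otimes> k \<otimes> x"
    unfolding conjugate_subgroup_def l_coset_def r_coset_def by auto
  have "k \<in> carrier G" using k assms by auto
  then have "x \<otimes> g \<otimes> inv x = k" using assms k
    by (simp add: m_assoc) (simp add: m_assoc[symmetric])
  then show "x \<otimes> g \<otimes> inv x \<in> K" using k by simp
next
  assume a: "x \<otimes> g \<otimes> inv x \<in> K"
  have "g = inv x \<otimes> (x \<otimes> g \<otimes> inv x) \<otimes> x"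
    using assms by (simp add: m_assoc) (simp add: m_assoc[symmetric])
  then show "g \<in> conjugate_subgroup G K x"
    unfolding conjugate_subgroup_def l_coset_def r_coset_def using a by auto
qed

text \<open>Hence the conjugates are indexed by the right cosets of \<open>K\<close>, which is what
  the counting below needs.\<close>

lemma (in group) conjugate_subgroup_mult_left:
  assumes "subgroup K G" "k \<in> K" "y \<in> carrier G"
  shows "conjugate_subgroup G K (k \<otimes> y) = conjugate_subgroup G K y"
proof -
  interpret K: subgroup K G by fact
  have kc: "k \<in> carrier G" using assms by auto
  have sub: "K \<subseteq> carrier G" by auto
  have cl: "conjugate_subgroup G K z \<subseteq> carrier G" if "z \<in> carrier G" for z
    using that unfolding conjugate_subgroup_def l_coset_def r_coset_def by auto
  have "g \<in> conjugate_subgroup G K (k \<otimes> y) \<longleftrightarrow> g \<in> conjugate_subgroup G K y"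
    if g: "g \<in> carrier G" for g
  proof -
    let ?z = "y \<otimes> g \<otimes> inv y"
    have zc: "?z \<in> carrier G" using assms g by simp
    have "k \<otimes> y \<otimes> g \<otimes> inv (k \<otimes> y) = k \<otimes> ?z \<otimes> inv k"
      using assms g kc by (simp add: inv_mult_group m_assoc)
    moreover have "k \<otimes> ?z \<otimes> inv k \<in> K \<longleftrightarrow> ?z \<in> K"
    proof
      assume "k \<otimes> ?z \<otimes> inv k \<in> K"
      then have "inv k \<otimes> (k \<otimes> ?z \<otimes> inv k) \<otimes> k \<in> K" using assms(2) by auto
      moreover have "inv k \<otimes> (k \<otimes> ?z \<otimes> inv k) \<otimes> k = ?z"
      proof -
        have "inv k \<otimes> (k \<otimes> ?z \<otimes> inv k) \<otimes> k = (inv k \<otimes> k) \<otimes> ?z \<otimes> (inv k \<otimes> k)"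
          using zc kc by (simp only: m_assoc m_closed inv_closed)
        then show ?thesis using zc kc by simp
      qed
      ultimately show "?z \<in> K" by simp
    qed (use assms in auto)
    ultimately show ?thesis
      using mem_conjugate_subgroup_iff[OF sub _ g] assms kc by simp
  qed
  then show ?thesis using cl assms kc by blast
qed

text \<open>All conjugates of \<open>K\<close> contain \<open>\<one>\<close>, so their union has at most
  \<open>1 + [G : K] (|K| - 1) = 1 + |G| - [G : K]\<close> elements.\<close>

lemma (in group) Union_conjugates_ne_carrier:
  assumes fin: "finite (carrier G)" and K: "subgroup K G" and ne: "K \<noteq> carrier G"
  shows "(\<Union>x\<in>carrier G. conjugate_subgroup G K x) \<noteq> carrier G"
proof
  assume eq: "(\<Union>x\<in>carrier G. conjugate_subgroup G K x) = carrier G"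
  interpret K: subgroup K G by fact
  define R where "R = rcosets K"
  define rep where "rep C = (SOME x. x \<in> carrier G \<and> K #> x = C)" for C
  have rep: "rep C \<in> carrier G" "K #> rep C = C" if "C \<in> R" for C
    using that someI_ex[of "\<lambda>x. x \<in> carrier G \<and> K #> x = C"]
    unfolding R_def RCOSETS_def rep_def by auto
  have finR: "finite R"
    unfolding R_def RCOSETS_def using fin by auto
  have finK: "finite K" using fin K.subset finite_subset by blast
  have cov: "carrier G \<subseteq> insert \<one> (\<Union>C\<in>R. conjugate_subgroup G K (rep C) - {\<one>})"
  proof
    fix g assume "g \<in> carrier G"
    then obtain x where x: "x \<in> carrier G" "g \<in> conjugate_subgroup G K x" using eq by auto
    let ?C = "K #> x"
    have C: "?C \<in> R" unfolding R_def RCOSETS_def using x by auto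
    have "x \<in> K #> rep ?C" using rep[OF C] rcos_self[OF x(1) K] by simp
    then obtain k where k: "k \<in> K" "x = k \<otimes> rep ?C" unfolding r_coset_def by auto
    then have "conjugate_subgroup G K x = conjugate_subgroup G K (rep ?C)"
      using conjugate_subgroup_mult_left[OF K k(1) rep(1)[OF C]] by simp
    then show "g \<in> insert \<one> (\<Union>C\<in>R. conjugate_subgroup G K (rep C) - {\<one>})"
      using x C by blast
  qed
  have card1: "finite (conjugate_subgroup G K y - {\<one>}) \<and> card (conjugate_subgroup G K y - {\<one>}) \<le> card K - 1"
    if y: "y \<in> carrier G" for y
  proof -
    have e: "conjugate_subgroup G K y = (\<lambda>k. inv y \<otimes> k \<otimes> y) ` K"
      unfolding conjugate_subgroup_def l_coset_def r_coset_def by auto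
    have "\<one> = inv y \<otimes> \<one> \<otimes> y" using y by simp
    then have "\<one> \<in> conjugate_subgroup G K y" unfolding e using K.one_closed by blast
    moreover have "card (conjugate_subgroup G K y) \<le> card K" unfolding e
      by (rule card_image_le[OF finK])
    ultimately show ?thesis unfolding e using finK by (simp add: card_Diff_singleton diff_le_mono)
  qed
  let ?U = "\<Union>C\<in>R. conjugate_subgroup G K (rep C) - {\<one>}"
  have finU: "finite ?U" using finR card1 rep by auto
  have "card (carrier G) \<le> card (insert \<one> ?U)"
    by (rule card_mono[OF _ cov]) (use finU in auto)
  also have "\<dots> \<le> Suc (card ?U)" by (metis card_insert_disjoint finU insert_absorb le_SucI order_refl)
  also have "card ?U \<le> (\<Sum>C\<in>R. card (conjugate_subgroup G K (rep C) - {\<one>}))"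
    by (rule card_UN_le[OF finR])
  also have "\<dots> \<le> (\<Sum>C\<in>R. card K - 1)" by (rule sum_mono) (use card1 rep in auto)
  also have "\<dots> = card R * (card K - 1)" by simp
  finally have le: "card (carrier G) \<le> Suc (card R * (card K - 1))" by simp
  have lag: "card R * card K = card (carrier G)"
    using lagrange[OF K] unfolding R_def order_def .
  have Kpos: "card K > 0" using finK K.one_closed card_gt_0_iff by blast
  have "card K < card (carrier G)" using ne K.subset fin by (simp add: psubset_card_mono psubset_eq)
  then have "card R \<noteq> 0" "card R \<noteq> 1" using lag by (metis mult_0 not_less_zero, metis less_irrefl mult_1)
  then have "card R \<ge> 2" by linarith
  moreover have "card R * (card K - 1) + card R = card R * card K"
    using Kpos by (metis Suc_diff_1 add.commute mult_Suc_right)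
  ultimately show False using le lag by linarith
qed

text \<open>A covering of length 0 misses \<open>\<one>\<close>, and one of length 1 is excluded by
  \<open>Union_conjugates_ne_carrier\<close>, so the infimum is 2 as soon as length 2
  occurs.\<close>

lemma (in group) normal_covering_number_eq_2_iff:
  assumes fin: "finite (carrier G)"
  shows "normal_covering_number G = 2 \<longleftrightarrow> has_normal_covering G 2"
proof -
  let ?S = "{k. has_normal_covering G k}"
  have no0: "\<not> has_normal_covering G 0"
    unfolding has_normal_covering_def using one_closed by auto
  have no1: "\<not> has_normal_covering G 1"
  proof
    assume "has_normal_covering G 1"
    then obtain Hs where Hs: "length Hs = 1" "\<forall>K\<in>set Hs. subgroup K G \<and> K \<noteq> carrier G"
      "carrier G = (\<Union>K\<in>set Hs. \<Union>x\<in>carrier G. conjugate_subgroup G K x)"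
      unfolding has_normal_covering_def by blast
    from Hs(1) obtain K where K: "Hs = [K]" by (metis One_nat_def length_0_conv length_Suc_conv)
    have "carrier G = (\<Union>x\<in>carrier G. conjugate_subgroup G K x)"
      using Hs(3) unfolding K by simp
    moreover have "subgroup K G" "K \<noteq> carrier G" using Hs(2) K by simp_all
    ultimately show False using Union_conjugates_ne_carrier[OF fin] by metis
  qed
  show ?thesis
  proof
    assume 2: "normal_covering_number G = 2"
    \<comment> \<open>Otherwise the infimum would be \<infinity>; being nonempty, the set contains
      its infimum.\<close>
    have "?S \<noteq> {}"
    proof
      assume "?S = {}"
      then show False using 2 unfolding normal_covering_number_def Inf_enat_def
        by (simp only: image_empty simp_thms if_True) simp
    qed
    then have "\<exists>x. x \<in> enat ` ?S" by blast
    then have "(LEAST x. x \<in> enat ` ?S) \<in> enat ` ?S" by (rule LeastI_ex)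
    then have "Inf (enat ` ?S) \<in> enat ` ?S" using \<open>?S \<noteq> {}\<close> unfolding Inf_enat_def by simp
    then show "has_normal_covering G 2"
      using 2 unfolding normal_covering_number_def by (auto simp: numeral_eq_enat)
  next
    assume c: "has_normal_covering G 2"
    show "normal_covering_number G = 2" unfolding normal_covering_number_def
    proof (rule antisym)
      show "Inf (enat ` ?S) \<le> 2"
        by (rule Inf_lower) (use c in \<open>auto simp: numeral_eq_enat\<close>)
      show "2 \<le> Inf (enat ` ?S)"
      proof (rule Inf_greatest)
        fix x assume "x \<in> enat ` ?S"
        then obtain k where k: "x = enat k" "has_normal_covering G k" by auto
        then have "k \<noteq> 0" "k \<noteq> 1" using no0 no1 by metis+
        then show "2 \<le> x" using k by (simp add: numeral_eq_enat)
      qed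
    qed
  qed
qed

lemma (in group) has_normal_covering_2_iff:
  "has_normal_covering G 2 \<longleftrightarrow>
    (\<exists>K L. subgroup K G \<and> K \<noteq> carrier G \<and> subgroup L G \<and> L \<noteq> carrier G \<and>
      (\<forall>g\<in>carrier G. \<exists>x\<in>carrier G. x \<otimes> g \<otimes> inv x \<in> K \<union> L))" (is "?L \<longleftrightarrow> ?R")
proof -
  have cl: "conjugate_subgroup G K x \<subseteq> carrier G" if "K \<subseteq> carrier G" "x \<in> carrier G" for K x
    using that unfolding conjugate_subgroup_def l_coset_def r_coset_def by auto
  have *: "carrier G = (\<Union>M\<in>set [K, L]. \<Union>x\<in>carrier G. conjugate_subgroup G M x) \<longleftrightarrow>
     (\<forall>g\<in>carrier G. \<exists>x\<in>carrier G. x \<otimes> g \<otimes> inv x \<in> K \<union> L)"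
    if "subgroup K G" "subgroup L G" for K L
  proof -
    have s: "K \<subseteq> carrier G" "L \<subseteq> carrier G" using that by (auto dest: subgroup.subset)
    have "carrier G = (\<Union>M\<in>set [K, L]. \<Union>x\<in>carrier G. conjugate_subgroup G M x) \<longleftrightarrow>
      (\<forall>g\<in>carrier G. \<exists>x\<in>carrier G. g \<in> conjugate_subgroup G K x \<or> g \<in> conjugate_subgroup G L x)"
      using cl[OF s(1)] cl[OF s(2)] by auto
    also have "\<dots> \<longleftrightarrow> (\<forall>g\<in>carrier G. \<exists>x\<in>carrier G. x \<otimes> g \<otimes> inv x \<in> K \<union> L)"
      using mem_conjugate_subgroup_iff[OF s(1)] mem_conjugate_subgroup_iff[OF s(2)] by auto
    finally show ?thesis .
  qed
  show ?thesis
  proof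
    assume ?L
    then obtain Hs where Hs: "length Hs = 2" "\<forall>K\<in>set Hs. subgroup K G \<and> K \<noteq> carrier G"
      "carrier G = (\<Union>K\<in>set Hs. \<Union>x\<in>carrier G. conjugate_subgroup G K x)"
      unfolding has_normal_covering_def by auto
    then obtain K L where "Hs = [K, L]" by (auto simp: numeral_2_eq_2 length_Suc_conv)
    then show ?R using Hs *[of K L] by auto
  next
    assume ?R
    then obtain K L where KL: "subgroup K G" "K \<noteq> carrier G" "subgroup L G" "L \<noteq> carrier G"
      "\<forall>g\<in>carrier G. \<exists>x\<in>carrier G. x \<otimes> g \<otimes> inv x \<in> K \<union> L" by auto
    then show ?L using *[of K L] unfolding has_normal_covering_def
      by (intro exI[of _ "[K, L]"]) auto
  qed
qed

lemma has_normal_covering_2_iso: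
  assumes G: "group G" and H: "group H" and iso: "\<phi> \<in> iso G H" and cov: "has_normal_covering G 2"
  shows "has_normal_covering H 2"
proof -
  interpret G: group G by fact
  interpret H: group H by fact
  interpret h: group_hom G H \<phi> using iso by unfold_locales (auto simp: iso_def)
  have b: "bij_betw \<phi> (carrier G) (carrier H)" using iso by (auto simp: iso_def)
  obtain K L where KL: "subgroup K G" "K \<noteq> carrier G" "subgroup L G" "L \<noteq> carrier G"
    "\<forall>g\<in>carrier G. \<exists>x\<in>carrier G. x \<otimes>\<^bsub>G\<^esub> g \<otimes>\<^bsub>G\<^esub> inv\<^bsub>G\<^esub> x \<in> K \<union> L"
    using cov G.has_normal_covering_2_iff by auto
  have ne: "\<phi> ` M \<noteq> carrier H" if "subgroup M G" "M \<noteq> carrier G" for M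
    using that b by (metis bij_betw_imp_inj_on bij_betw_imp_surj_on inj_on_image_eq_iff
        order_refl subgroup.subset)
  have "\<exists>x\<in>carrier H. x \<otimes>\<^bsub>H\<^esub> y \<otimes>\<^bsub>H\<^esub> inv\<^bsub>H\<^esub> x \<in> \<phi> ` K \<union> \<phi> ` L" if y: "y \<in> carrier H" for y
  proof -
    obtain g where g: "g \<in> carrier G" "y = \<phi> g" using b y by (auto simp: bij_betw_def)
    then obtain x where x: "x \<in> carrier G" "x \<otimes>\<^bsub>G\<^esub> g \<otimes>\<^bsub>G\<^esub> inv\<^bsub>G\<^esub> x \<in> K \<union> L" using KL by auto
    have "\<phi> x \<otimes>\<^bsub>H\<^esub> y \<otimes>\<^bsub>H\<^esub> inv\<^bsub>H\<^esub> (\<phi> x) = \<phi> (x \<otimes>\<^bsub>G\<^esub> g \<otimes>\<^bsub>G\<^esub> inv\<^bsub>G\<^esub> x)" using g x by simp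
    then show ?thesis using x by (intro bexI[of _ "\<phi> x"]) auto
  qed
  then show ?thesis unfolding H.has_normal_covering_2_iff
    by (intro exI[of _ "\<phi> ` K"] exI[of _ "\<phi> ` L"] conjI ballI) (use ne KL h.subgroup_img_is_subgroup in auto)
qed

section \<open>Permutation groups on a finite type\<close>

text \<open>The notation of HOL-Algebra for inverses hides \<open>inv\<close> for functions.\<close>

abbreviation finv :: "('a \<Rightarrow> 'b) \<Rightarrow> 'b \<Rightarrow> 'a" where
  "finv \<equiv> inv_into UNIV"

text \<open>Inverses are left out on purpose: on a finite type a bijection has finite order, so its
  inverse is one of its powers (\<open>perm_group_inv\<close>).\<close>

definition perm_group :: "('a \<Rightarrow> 'a) set \<Rightarrow> bool" where
  "perm_group K \<longleftrightarrow> id \<in> K \<and> (\<forall>f\<in>K. bij f) \<and> (\<forall>f\<in>K. \<forall>g\<in>K. f \<circ> g \<in> K)"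

text \<open>For a permutation group on a finite type this expresses \<gamma> = 2, in terms of
  composition of functions instead of a monoid record.\<close>

definition two_coverable :: "('a \<Rightarrow> 'a) set \<Rightarrow> bool" where
  "two_coverable G \<longleftrightarrow> (\<exists>K L. perm_group K \<and> K \<subset> G \<and> perm_group L \<and> L \<subset> G \<and>
     (\<forall>g\<in>G. \<exists>x\<in>G. x \<circ> g \<circ> finv x \<in> K \<union> L))"

lemma perm_groupD:
  assumes "perm_group K"
  shows "id \<in> K" "f \<in> K \<Longrightarrow> bij f" "f \<in> K \<Longrightarrow> g \<in> K \<Longrightarrow> f \<circ> g \<in> K"
  using assms unfolding perm_group_def by auto

lemma perm_group_funpow: "perm_group K \<Longrightarrow> f \<in> K \<Longrightarrow> f ^^ n \<in> K"
  by (induction n) (auto simp: perm_group_def)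

lemma bij_funpow_eq_id:
  fixes f :: "'a::finite \<Rightarrow> 'a"
  assumes "bij f"
  obtains n where "n > 0" "f ^^ n = id"
proof -
  have "\<not> inj (\<lambda>n. f ^^ n)" using finite_imageD[of "\<lambda>n. f ^^ n" UNIV] by auto
  then obtain i j where "f ^^ i = f ^^ j" "i \<noteq> j" unfolding inj_def by blast
  then obtain i j where ij: "i < j" "f ^^ i = f ^^ j" by (metis linorder_neqE_nat)
  have "f ^^ i \<circ> f ^^ (j - i) = f ^^ (i + (j - i))" by (rule funpow_add[symmetric])
  also have "\<dots> = f ^^ i" using ij by simp
  finally have "(f ^^ i) ((f ^^ (j - i)) x) = (f ^^ i) x" for x by (metis comp_apply)
  then have "(f ^^ (j - i)) x = x" for x
    using bij_fn[OF assms, of i] by (meson bij_is_inj injD)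
  then have "f ^^ (j - i) = id" by auto
  then show ?thesis using ij that[of "j - i"] by simp
qed

lemma perm_group_inv:
  fixes K :: "('a::finite \<Rightarrow> 'a) set"
  assumes "perm_group K" "f \<in> K"
  shows "finv f \<in> K"
proof -
  have b: "bij f" using assms perm_groupD by blast
  obtain n where n: "n > 0" "f ^^ n = id" using bij_funpow_eq_id[OF b] .
  have "f \<circ> f ^^ (n - 1) = id" using n by (metis Suc_diff_1 funpow.simps(2))
  then have "finv f = f ^^ (n - 1)"
    by (metis b bij_is_inj comp_assoc comp_id id_o inv_o_cancel)
  then show ?thesis using assms perm_group_funpow by simp
qed

section \<open>Passage from group records to composition of functions\<close>

lemma Sym_carrier [simp]: "carrier Sym = {f. bij f}"
  by (simp add: BijGroup_def Bij_def)

lemma Sym_one [simp]: "\<one>\<^bsub>Sym\<^esub> = id"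
  by (auto simp: BijGroup_def)

lemma Sym_mult [simp]: "bij f \<Longrightarrow> bij g \<Longrightarrow> f \<otimes>\<^bsub>Sym\<^esub> g = f \<circ> g"
  by (simp add: BijGroup_def Bij_def compose_def fun_eq_iff)

lemma Sym_inv [simp]: "bij f \<Longrightarrow> inv\<^bsub>Sym\<^esub> f = finv f"
  by (simp add: inv_BijGroup Bij_def fun_eq_iff)

lemma group_Sym: "group Sym"
  by (rule group_BijGroup)

lemma perm_group_iff_subgroup:
  fixes K :: "('a::finite \<Rightarrow> 'a) set"
  shows "perm_group K \<longleftrightarrow> subgroup K Sym"
proof
  assume K: "perm_group K"
  show "subgroup K Sym"
    by (rule subgroup.intro)
      (use K perm_groupD[OF K] perm_group_inv[OF K] in auto)
next
  assume K: "subgroup K Sym"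
  then have b: "f \<in> K \<Longrightarrow> bij f" for f using subgroup.subset by fastforce
  show "perm_group K" unfolding perm_group_def
    using subgroup.one_closed[OF K] subgroup.m_closed[OF K] b by auto
qed

lemma group_sub: 
  fixes K :: "('a::finite \<Rightarrow> 'a) set"
  assumes "perm_group K" shows "group (sub K)"
  using assms subgroup.subgroup_is_group[OF _ group_Sym] perm_group_iff_subgroup by blast

lemma sub_inv:
  fixes K :: "('a::finite \<Rightarrow> 'a) set"
  assumes "perm_group K" "f \<in> K"
  shows "inv\<^bsub>sub K\<^esub> f = finv f"
proof -
  have "inv\<^bsub>sub K\<^esub> f = inv\<^bsub>Sym\<^esub> f"
    by (rule group.m_inv_consistent[OF group_Sym])
      (use assms perm_group_iff_subgroup in auto)
  then show ?thesis using perm_groupD(2)[OF assms] by simp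
qed

lemma subgroup_sub_iff:
  fixes G :: "('a::finite \<Rightarrow> 'a) set"
  assumes G: "perm_group G"
  shows "subgroup K (sub G) \<longleftrightarrow> perm_group K \<and> K \<subseteq> G"
proof
  assume K: "subgroup K (sub G)"
  have "subgroup K Sym"
    using group.incl_subgroup[OF group_Sym _ K] G perm_group_iff_subgroup by blast
  then show "perm_group K \<and> K \<subseteq> G"
    using subgroup.subset[OF K] by (simp add: perm_group_iff_subgroup)
next
  assume "perm_group K \<and> K \<subseteq> G"
  then show "subgroup K (sub G)"
    using group.subgroup_incl[OF group_Sym, of K G] G perm_group_iff_subgroup by blast
qed

lemma sub_nat_pow:
  fixes K :: "('a::finite \<Rightarrow> 'a) set"
  assumes K: "perm_group K" and h: "h \<in> K"
  shows "h [^]\<^bsub>sub K\<^esub> (m::nat) = h ^^ m"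
proof (induction m)
  case (Suc m)
  have "bij h" "bij (h ^^ m)" using perm_groupD(2)[OF K] h perm_group_funpow[OF K h] by auto
  then show ?case using Suc by (simp add: nat_pow_def funpow_Suc_right del: funpow.simps)
qed (simp add: nat_pow_def)

lemma has_normal_covering_sub_iff:
  fixes G :: "('a::finite \<Rightarrow> 'a) set"
  assumes G: "perm_group G"
  shows "has_normal_covering (sub G) 2 \<longleftrightarrow> two_coverable G"
proof -
  have e: "x \<otimes>\<^bsub>sub G\<^esub> g \<otimes>\<^bsub>sub G\<^esub> inv\<^bsub>sub G\<^esub> x = x \<circ> g \<circ> finv x" if "x \<in> G" "g \<in> G" for x g
    using that perm_groupD[OF G] sub_inv[OF G] by (simp add: bij_comp bij_imp_bij_inv)
  then have *: "(\<forall>g\<in>G. \<exists>x\<in>G. x \<otimes>\<^bsub>sub G\<^esub> g \<otimes>\<^bsub>sub G\<^esub> inv\<^bsub>sub G\<^esub> x \<in> K \<union> L) \<longleftrightarrow>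
     (\<forall>g\<in>G. \<exists>x\<in>G. x \<circ> g \<circ> finv x \<in> K \<union> L)" for K L
    by (intro ball_cong bex_cong refl) metis
  have c: "carrier (sub G) = G" by simp
  show ?thesis
    unfolding group.has_normal_covering_2_iff[OF group_sub[OF G]] two_coverable_def c *
      subgroup_sub_iff[OF G] psubset_eq by blast
qed

section \<open>Semilinear maps\<close>

text \<open>Multiplication by \<open>x\<close> permutes \<open>A\<close>, so it does not change the
  product over \<open>A\<close>. This serves both for the nonzero field elements and for the scalars
  in \<open>H\<close>.\<close>

lemma power_card_mult_closed:
  fixes A :: "'a::field set"
  assumes "finite A" "0 \<notin> A" "\<And>x y. x \<in> A \<Longrightarrow> y \<in> A \<Longrightarrow> x * y \<in> A" "x \<in> A"
  shows "x ^ card A = 1"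
proof -
  have x0: "x \<noteq> 0" using assms by auto
  have inj: "inj_on ((*) x) A" using x0 by (auto simp: inj_on_def)
  have "(*) x ` A = A"
    by (rule card_subset_eq) (use assms inj in \<open>auto simp: card_image\<close>)
  then have "(\<Prod>y\<in>A. y) = (\<Prod>y\<in>A. x * y)"
    using prod.reindex[OF inj, of "\<lambda>y. y"] by simp
  then have "(\<Prod>y\<in>A. y) = x ^ card A * (\<Prod>y\<in>A. y)" by (simp add: prod.distrib)
  moreover have "(\<Prod>y\<in>A. y) \<noteq> 0" using assms by simp
  ultimately show ?thesis by simp
qed

lemma power_gcd_eq_1:
  fixes x :: "'a::field"
  assumes "x ^ a = 1" "x ^ b = 1"
  shows "x ^ gcd a b = 1"
proof (cases "a = 0")
  case False
  then obtain u v where "a * u = b * v + gcd a b" using bezout_nat by blast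
  then have "(x ^ a) ^ u = (x ^ b) ^ v * x ^ gcd a b" by (simp flip: power_mult power_add)
  then show ?thesis using assms by simp
qed (use assms in auto)

text \<open>\<open>J\<close> is the preimage of a subgroup of the cyclic group of integers modulo
  \<open>f\<close>; it will be the set of Frobenius exponents that occur in
  \<open>H\<close>.\<close>

lemma sum_closed_mod_generator:
  fixes J :: "nat set" and f :: nat
  assumes add: "\<And>i j. i \<in> J \<Longrightarrow> j \<in> J \<Longrightarrow> i + j \<in> J"
    and cong: "\<And>i j. i \<in> J \<Longrightarrow> [i = j] (mod f) \<Longrightarrow> j \<in> J"
    and f: "f > 0" "f \<in> J"
  obtains s where "s > 0" "s dvd f" "\<And>j. j \<in> J \<longleftrightarrow> s dvd j"
proof -
  have zero: "0 \<in> J" using cong[OF f(2), of 0] by (simp add: cong_def)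
  have mult: "k * j \<in> J" if "j \<in> J" for k j
    by (induction k) (use zero add that in auto)
  have gcd: "gcd i j \<in> J" if i: "i \<in> J" and j: "j \<in> J" and "i > 0" for i j
  proof -
    obtain u v where uv: "i * u = j * v + gcd i j" using bezout_nat \<open>i > 0\<close> by blast
    \<comment> \<open>Among natural numbers, adding \<open>((f - 1) * v) * j\<close> replaces the
      subtraction of \<open>v * j\<close> modulo \<open>f\<close>.\<close>
    have "u * i + ((f - 1) * v) * j \<in> J" using add mult i j by blast
    moreover have "u * i + ((f - 1) * v) * j = gcd i j + f * (v * j)"
    proof -
      have "u * i + ((f - 1) * v) * j = gcd i j + (1 + (f - 1)) * (v * j)"
        using uv by (simp add: algebra_simps)
      then show ?thesis using f by simp
    qed
    ultimately show ?thesis using cong[of _ "gcd i j"] by (simp add: cong_def)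
  qed
  define s where "s = (LEAST j. j > 0 \<and> j \<in> J)"
  have s: "s > 0" "s \<in> J" unfolding s_def using LeastI[of "\<lambda>j. j > 0 \<and> j \<in> J" f] f by auto
  have least: "s \<le> j" if "j > 0" "j \<in> J" for j
    unfolding s_def using that by (intro Least_le) auto
  have dvd: "s dvd j" if "j \<in> J" for j
  proof -
    have "s \<le> gcd s j" using gcd s that by (intro least) auto
    then have "gcd s j = s" using s by (meson dvd_imp_le gcd_dvd1 le_antisym)
    then show ?thesis by (metis gcd_dvd2)
  qed
  show ?thesis
    by (rule that[of s]) (use s dvd f mult in \<open>auto elim!: dvdE simp: mult.commute[of s]\<close>)
qed

locale semilinear =
  fixes p f :: nat and l :: "'a::{field,finite}"
  assumes prime_p: "Factorial_Ring.prime p" and f_pos: "f > 0"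
    and card_field: "CARD('a) = p ^ f"
    and l_nonzero: "l \<noteq> 0" and l_generates: "x \<noteq> 0 \<Longrightarrow> \<exists>i. x = l ^ i"
begin

text \<open>For \<open>u \<noteq> 0\<close> these maps are the elements of \<open>GammaL1 p\<close>:
  \<open>frob p ^^ j\<close> followed by \<open>scal u\<close>. The exponent matters only modulo
  \<open>f\<close>.\<close>

definition sl :: "'a \<Rightarrow> nat \<Rightarrow> 'a \<Rightarrow> 'a" where
  "sl u j = (\<lambda>x. u * x ^ p ^ j)"

lemma p_gt_1: "p > 1"
  using prime_p prime_gt_1_nat by blast

lemma char_field: "CHAR('a) = p"
proof -
  have "CHAR('a) dvd p ^ f" using CHAR_dvd_CARD[where 'a = 'a] card_field by simp
  moreover have "Factorial_Ring.prime CHAR('a)"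
    by (rule prime_CHAR_semidom) (simp add: finite_imp_CHAR_pos)
  ultimately show ?thesis using prime_p by (meson prime_dvd_power primes_dvd_imp_eq)
qed

lemma frobenius_add: "(x + y :: 'a) ^ p ^ j = x ^ p ^ j + y ^ p ^ j"
  using freshmans_dream'[of "p ^ j" j x y] prime_p char_field by simp

lemma sl_add: "sl u j (x + y) = sl u j x + sl u j y"
  by (simp add: sl_def frobenius_add algebra_simps)

lemma sl_0 [simp]: "sl u j 0 = 0"
  using p_gt_1 by (simp add: sl_def)

lemma sl_diff: "sl u j (x - y) = sl u j x - sl u j y"
  using sl_add[of u j "x - y" y] by simp

lemma sl_bij: "u \<noteq> 0 \<Longrightarrow> bij (sl u j)"
proof -
  assume u: "u \<noteq> 0"
  have "inj (sl u j)"
  proof (rule injI)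
    fix x y assume "sl u j x = sl u j y"
    then have "sl u j (x - y) = 0" by (simp add: sl_diff)
    then show "x = y" using u by (simp add: sl_def)
  qed
  then show ?thesis by (simp add: bij_def finite_UNIV_inj_surj)
qed

lemma power_q_minus_1: "x \<noteq> 0 \<Longrightarrow> x ^ (p ^ f - 1) = (1::'a)"
  using power_card_mult_closed[of "UNIV - {0::'a}" x] card_field
  by (simp add: card_Diff_singleton)

lemma q_gt_1: "p ^ f > 1"
  using p_gt_1 f_pos by (metis one_less_power)

lemma power_q: "(x::'a) ^ p ^ f = x"
proof (cases "x = 0")
  case False
  have "p ^ f = Suc (p ^ f - 1)" using q_gt_1 by simp
  then have "x ^ p ^ f = x * x ^ (p ^ f - 1)" by (metis power_Suc)
  then show ?thesis using power_q_minus_1[OF False] by simp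
qed (use p_gt_1 in auto)

lemma power_q_mult: "(x::'a) ^ p ^ (f * i) = x"
  by (induction i) (simp_all add: power_add power_mult power_q)

lemma power_p_cong: "[i = j] (mod f) \<Longrightarrow> (x::'a) ^ p ^ i = x ^ p ^ j"
proof -
  have *: "x ^ p ^ i = x ^ p ^ (i mod f)" for i
  proof -
    have "x ^ p ^ i = x ^ (p ^ (f * (i div f)) * p ^ (i mod f))" by (simp flip: power_add)
    then show ?thesis by (simp only: power_mult[of x] power_q_mult)
  qed
  assume "[i = j] (mod f)"
  then show ?thesis using *[of i] *[of j] by (simp add: cong_def)
qed

text \<open>The powers of \<open>l\<close> with exponent below \<open>p ^ f - 1\<close> exhaust the
  \<open>p ^ f - 1\<close> nonzero elements, so they are distinct.\<close>

lemma l_power_eq_iff: "l ^ i = l ^ j \<longleftrightarrow> [i = j] (mod (p ^ f - 1))"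
proof -
  let ?m = "p ^ f - 1"
  have red: "l ^ i = l ^ (i mod ?m)" for i
  proof -
    have "l ^ i = l ^ (?m * (i div ?m) + i mod ?m)" by simp
    then show ?thesis using power_q_minus_1[OF l_nonzero] by (simp only: power_add power_mult) simp
  qed
  have "(\<lambda>i. l ^ i) ` {..<?m} = UNIV - {0}"
  proof
    show "UNIV - {0} \<subseteq> (\<lambda>i. l ^ i) ` {..<?m}"
    proof
      fix x :: 'a assume "x \<in> UNIV - {0}"
      then obtain i where "x = l ^ i" using l_generates by auto
      then show "x \<in> (\<lambda>i. l ^ i) ` {..<?m}" using red[of i] q_gt_1 by auto
    qed
  qed (use l_nonzero in auto)
  then have "card ((\<lambda>i. l ^ i) ` {..<?m}) = card {..<?m}"
    using card_field by (simp add: card_Diff_singleton)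
  then have inj: "inj_on (\<lambda>i. l ^ i) {..<?m}" by (intro eq_card_imp_inj_on) auto
  have "l ^ i = l ^ j \<longleftrightarrow> l ^ (i mod ?m) = l ^ (j mod ?m)" using red by metis
  also have "\<dots> \<longleftrightarrow> i mod ?m = j mod ?m"
    using inj q_gt_1 by (intro inj_on_eq_iff[OF inj]) auto
  finally show ?thesis by (simp add: cong_def)
qed

lemma l_power_eq_1_iff: "l ^ i = 1 \<longleftrightarrow> (p ^ f - 1) dvd i"
  using l_power_eq_iff[of i 0] by (simp add: cong_0_iff)

text \<open>Two of the numbers \<open>p ^ i\<close> with \<open>i < f\<close> differ by less than
  \<open>p ^ f - 1\<close>, so they are distinct modulo the order of \<open>l\<close>. Thus the
  Frobenius automorphism has order exactly \<open>f\<close>.\<close>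

lemma power_p_eq_imp_cong:
  assumes "l ^ p ^ i = l ^ p ^ j"
  shows "[i = j] (mod f)"
proof -
  let ?i = "i mod f" and ?j = "j mod f"
  have "l ^ p ^ ?i = l ^ p ^ ?j"
    using assms power_p_cong[of i ?i l] power_p_cong[of j ?j l] by (simp add: cong_def)
  then have "[p ^ ?i = p ^ ?j] (mod (p ^ f - 1))" using l_power_eq_iff by simp
  then have *: "(p ^ f - 1) dvd (p ^ a - p ^ b)" if "(a = ?i \<and> b = ?j) \<or> (a = ?j \<and> b = ?i)" for a b
    using that by (metis cong_altdef_nat cong_sym diff_is_0_eq' dvd_0_right linorder_le_cases)
  have **: "a \<le> b" if "(a = ?i \<and> b = ?j) \<or> (a = ?j \<and> b = ?i)" for a b
  proof (rule ccontr)
    assume "\<not> a \<le> b"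
    then have "p ^ b < p ^ a" using p_gt_1 by simp
    then have "p ^ f - 1 \<le> p ^ a - p ^ b" using *[OF that] by (intro dvd_imp_le) auto
    moreover have "a < f" using that f_pos by auto
    then have "p ^ a < p ^ f" using p_gt_1 by simp
    moreover have "p ^ b \<ge> 1" using p_gt_1 by simp
    ultimately show False using \<open>p ^ b < p ^ a\<close> by linarith
  qed
  have "?i = ?j" using **[of ?i ?j] **[of ?j ?i] by simp
  then show ?thesis by (simp add: cong_def)
qed

lemma sl_comp: "sl u i \<circ> sl v j = sl (u * v ^ p ^ i) (i + j)"
  by (auto simp: sl_def power_add power_mult_distrib mult.commute mult.left_commute simp flip: power_mult)

lemma sl_eq_iff: "u \<noteq> 0 \<Longrightarrow> sl u i = sl v j \<longleftrightarrow> u = v \<and> [i = j] (mod f)"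
proof
  assume u: "u \<noteq> 0" and e: "sl u i = sl v j"
  have "sl u i 1 = sl v j 1" using e by simp
  then have uv: "u = v" by (simp add: sl_def)
  have "sl u i l = sl v j l" using e by simp
  then have "l ^ p ^ i = l ^ p ^ j" using u uv by (simp add: sl_def)
  then show "u = v \<and> [i = j] (mod f)" using uv power_p_eq_imp_cong by simp
next
  assume "u = v \<and> [i = j] (mod f)"
  then show "sl u i = sl v j" using power_p_cong[of i j] by (auto simp: sl_def)
qed

lemma sl_1_0: "sl 1 0 = id"
  by (auto simp: sl_def)

lemma sl_eq_id_iff: "u \<noteq> 0 \<Longrightarrow> sl u j = id \<longleftrightarrow> u = 1 \<and> f dvd j"
  using sl_eq_iff[of u j 1 0] sl_1_0 by (auto simp: cong_0_iff)

text \<open>Here the geometric sums enter: taking a power multiplies the coefficient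
  \<open>u\<close> with its successive images under \<open>x \<mapsto> x ^ p ^ j\<close>.\<close>

lemma sl_funpow: "sl u j ^^ m = sl (u ^ (\<Sum>i<m. (p ^ j) ^ i)) (j * m)"
proof (induction m)
  case (Suc m)
  have "sl u j ^^ Suc m = sl (u * (u ^ (\<Sum>i<m. (p ^ j) ^ i)) ^ p ^ j) (j + j * m)"
    by (simp add: Suc sl_comp)
  also have "u * (u ^ (\<Sum>i<m. (p ^ j) ^ i)) ^ p ^ j = u ^ (1 + p ^ j * (\<Sum>i<m. (p ^ j) ^ i))"
    by (simp add: power_add mult.commute flip: power_mult)
  also have "1 + p ^ j * (\<Sum>i<m. (p ^ j) ^ i) = (\<Sum>i<Suc m. (p ^ j) ^ i)"
    by (subst sum.lessThan_Suc_shift) (simp add: sum_distrib_left)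
  finally show ?case by simp
qed (simp add: sl_1_0)

lemma sl_funpow_scalar: "sl u 0 ^^ m = sl (u ^ m) 0"
  by (simp add: sl_funpow)

end

section \<open>The scalars of \<open>H\<close> as roots of unity\<close>

locale semilinear_group = semilinear p f l for p f :: nat and l :: "'a::{field,finite}" +
  fixes H :: "('a \<Rightarrow> 'a) set"
  assumes H_group: "perm_group H"
    and H_semilinear: "h \<in> H \<Longrightarrow> \<exists>u j. u \<noteq> 0 \<and> h = sl u j"
begin

text \<open>The scalar subgroup is held as a set of field elements, so that it can be identified
  with a group of roots of unity (\<open>A_eq\<close>).\<close>

definition A :: "'a set" where "A = {u. u \<noteq> 0 \<and> sl u 0 \<in> H}"

definition n :: nat where "n = card A"

lemma H_semilinearE:
  assumes "h \<in> H" obtains u j where "u \<noteq> 0" "h = sl u j"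
  using H_semilinear[OF assms] by blast

lemma one_in_A: "1 \<in> A"
  using perm_groupD(1)[OF H_group] by (simp add: A_def sl_1_0)

lemma mult_in_A: "u \<in> A \<Longrightarrow> v \<in> A \<Longrightarrow> u * v \<in> A"
  using perm_groupD(3)[OF H_group, of "sl u 0" "sl v 0"] by (simp add: A_def sl_comp)

lemma A_nonzero: "u \<in> A \<Longrightarrow> u \<noteq> 0"
  by (simp add: A_def)

lemma power_in_A: "u \<in> A \<Longrightarrow> u ^ k \<in> A"
  by (induction k) (simp_all add: one_in_A mult_in_A)

lemma n_pos: "n > 0"
  using one_in_A by (auto simp: n_def card_gt_0_iff)

lemma power_n: "u \<in> A \<Longrightarrow> u ^ n = 1"
  unfolding n_def by (rule power_card_mult_closed) (auto simp: mult_in_A dest: A_nonzero)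

text \<open>The bound by the gcd, sharper than \<open>m\<close>, is the point: for
  \<open>m = n\<close> it yields both that \<open>n\<close> divides \<open>p ^ f - 1\<close> and
  that \<open>A\<close> contains all \<open>n\<close>-th roots of unity.\<close>

lemma card_roots_of_unity_le:
  assumes "m > 0"
  shows "card {x::'a. x ^ m = 1} \<le> gcd m (p ^ f - 1)"
proof -
  let ?N = "p ^ f - 1" and ?g = "gcd m (p ^ f - 1)"
  have Npos: "?N > 0" using q_gt_1 by simp
  have gpos: "?g > 0" using assms by simp
  obtain d where d: "?N = ?g * d" by (metis dvd_def gcd_dvd2)
  have dpos: "d > 0" using d Npos by (metis gr0I mult_0_right)
  have "{x::'a. x ^ m = 1} \<subseteq> (\<lambda>k. l ^ (d * k)) ` {..<?g}"
  proof
    fix x :: 'a assume "x \<in> {x. x ^ m = 1}"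
    then have xm: "x ^ m = 1" by simp
    then have x0: "x \<noteq> 0" using assms by (metis power_0_left not_gr_zero zero_neq_one)
    obtain i where i: "x = l ^ i" using l_generates[OF x0] by blast
    have "x ^ ?g = 1" using power_gcd_eq_1[OF xm power_q_minus_1[OF x0]] .
    then have "?N dvd i * ?g" using i by (simp add: l_power_eq_1_iff flip: power_mult)
    then have "d dvd i" using d gpos by (metis mult.commute nat_mult_dvd_cancel1)
    then obtain k where k: "i = d * k" by (auto simp: dvd_def)
    have "d * k mod (d * ?g) = d * (k mod ?g)" by (rule mult_mod_right[symmetric])
    then have "d * k mod ?N = d * (k mod ?g) mod ?N" using d by (metis mod_mod_trivial mult.commute)
    then have "[i = d * (k mod ?g)] (mod ?N)" unfolding k cong_def .
    then have "x = l ^ (d * (k mod ?g))" using i l_power_eq_iff by simp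
    then show "x \<in> (\<lambda>k. l ^ (d * k)) ` {..<?g}" using gpos by auto
  qed
  then have "card {x::'a. x ^ m = 1} \<le> card ((\<lambda>k. l ^ (d * k)) ` {..<?g})"
    by (intro card_mono) auto
  also have "\<dots> \<le> ?g" using card_image_le[of "{..<?g}" "\<lambda>k. l ^ (d * k)"] by simp
  finally show ?thesis .
qed

lemma A_subset: "A \<subseteq> {x. x ^ n = 1}"
  using power_n by blast

lemma n_dvd: "n dvd p ^ f - 1"
proof -
  have "n \<le> card {x::'a. x ^ n = 1}"
    using card_mono[OF _ A_subset] by (simp add: n_def)
  also have "\<dots> \<le> gcd n (p ^ f - 1)" using card_roots_of_unity_le[OF n_pos] .
  finally have "gcd n (p ^ f - 1) = n" using n_pos by (meson dvd_imp_le gcd_dvd1 le_antisym)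
  then show ?thesis by (metis gcd_dvd2)
qed

lemma A_eq: "A = {x. x ^ n = 1}"
proof (rule card_subset_eq[OF _ A_subset])
  have "card {x::'a. x ^ n = 1} \<le> gcd n (p ^ f - 1)" using card_roots_of_unity_le[OF n_pos] .
  also have "\<dots> \<le> n" using n_pos by (meson dvd_imp_le gcd_dvd1)
  finally show "card A = card {x::'a. x ^ n = 1}"
    using card_mono[OF _ A_subset] by (simp add: n_def)
qed simp

text \<open>A primitive \<open>n\<close>-th root of unity, hence a generator of
  \<open>A\<close>.\<close>

definition a :: 'a where "a = l ^ ((p ^ f - 1) div n)"

lemma a_power_eq_1_iff: "a ^ k = 1 \<longleftrightarrow> n dvd k"
proof -
  have "a ^ k = 1 \<longleftrightarrow> (p ^ f - 1) dvd ((p ^ f - 1) div n) * k"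
    by (simp add: a_def l_power_eq_1_iff flip: power_mult)
  also have "\<dots> \<longleftrightarrow> ((p ^ f - 1) div n) * n dvd ((p ^ f - 1) div n) * k"
    using n_dvd by simp
  also have "\<dots> \<longleftrightarrow> n dvd k"
  proof (rule nat_mult_dvd_cancel1)
    have "(p ^ f - 1) div n * n = p ^ f - 1" using n_dvd by simp
    then show "0 < (p ^ f - 1) div n" using q_gt_1 by (metis mult_is_0 gr0I zero_less_diff less_irrefl)
  qed
  finally show ?thesis .
qed

lemma a_in_A: "a \<in> A"
  using a_power_eq_1_iff[of n] by (simp add: A_eq)

lemma sl_div:
  assumes "sl u i \<in> H" "sl v j \<in> H" "u \<noteq> 0" "v \<noteq> 0" "[i = j] (mod f)"
  shows "u / v \<in> A"
proof -
  have "sl u i = sl (u / v) 0 \<circ> sl v j"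
    using assms sl_eq_iff[of u i u j] by (simp add: sl_comp)
  then have "sl (u / v) 0 = sl u i \<circ> finv (sl v j)"
    using sl_bij[OF assms(4), of j] by (simp add: comp_assoc bij_is_surj surj_iff[THEN iffD1])
  then show ?thesis
    using assms perm_groupD(3)[OF H_group assms(1) perm_group_inv[OF H_group assms(2)]]
    by (simp add: A_def)
qed

lemma A_sl: "c \<in> A \<Longrightarrow> sl u j \<in> H \<Longrightarrow> sl (c * u) j \<in> H"
  using perm_groupD(3)[OF H_group, of "sl c 0" "sl u j"] by (simp add: A_def sl_comp)

end

text \<open>\<open>sl w s\<close> generates \<open>H\<close> modulo its scalars, and \<open>b\<close> is the order of the quotient.\<close>

locale semilinear_group_gen = semilinear_group p f l H
  for p f :: nat and l :: "'a::{field,finite}" and H :: "('a \<Rightarrow> 'a) set" +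
  fixes s b :: nat and w :: 'a
  assumes f_eq: "f = s * b" and w_nonzero: "w \<noteq> 0" and g_in_H: "sl w s \<in> H"
    and exponent_dvd: "u \<noteq> 0 \<Longrightarrow> sl u j \<in> H \<Longrightarrow> s dvd j"

text \<open>The exponents of the elements of \<open>H\<close> form a subgroup modulo
  \<open>f\<close>, generated by a divisor \<open>s\<close> of \<open>f\<close>; any element with
  exponent \<open>s\<close> will do.\<close>

lemma (in semilinear_group) ex_generator:
  obtains s b w where "semilinear_group_gen p f l H s b w"
proof -
  let ?J = "{j. \<exists>u. u \<noteq> 0 \<and> sl u j \<in> H}"
  have add: "i + j \<in> ?J" if i: "i \<in> ?J" and j: "j \<in> ?J" for i j
  proof -
    obtain u v where uv: "u \<noteq> 0" "v \<noteq> 0" "sl u i \<in> H" "sl v j \<in> H" using i j by blast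
    then have "sl (u * v ^ p ^ i) (i + j) \<in> H"
      using perm_groupD(3)[OF H_group uv(3,4)] by (simp add: sl_comp)
    moreover have "u * v ^ p ^ i \<noteq> 0" using uv by simp
    ultimately show ?thesis by blast
  qed
  have cong: "j \<in> ?J" if i: "i \<in> ?J" and ij: "[i = j] (mod f)" for i j
  proof -
    obtain u where u: "u \<noteq> 0" "sl u i \<in> H" using i by blast
    then have "sl u j \<in> H" using sl_eq_iff[of u i u j] ij by simp
    then show ?thesis using u by blast
  qed
  \<comment> \<open>The identity, written with exponent \<open>f\<close> because
    \<open>sum_closed_mod_generator\<close> asks for \<open>f\<close> itself in the set.\<close>
  have "sl 1 f \<in> H" using perm_groupD(1)[OF H_group] sl_eq_id_iff[of 1 f] by simp
  moreover have "(1::'a) \<noteq> 0" by simp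
  ultimately have "f \<in> ?J" by blast
  then obtain s where s: "s > 0" "s dvd f" "\<And>j. j \<in> ?J \<longleftrightarrow> s dvd j"
    using sum_closed_mod_generator[of ?J f] add cong f_pos by blast
  then obtain b where "f = s * b" by blast
  moreover obtain w where "w \<noteq> 0" "sl w s \<in> H" using s(3)[of s] by auto
  moreover have "s dvd j" if "u \<noteq> 0" "sl u j \<in> H" for u j
    using s(3)[of j] that by blast
  ultimately have "semilinear_group_gen p f l H s b w"
    using semilinear_group_axioms
    by (simp add: semilinear_group_gen_def semilinear_group_gen_axioms_def)
  then show ?thesis by (rule that)
qed

context semilinear_group_gen
begin

definition Q :: nat where "Q = p ^ s"

lemma s_pos: "s > 0" and b_pos: "b > 0"
  using f_eq f_pos by auto

lemma sl_in_H_E: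
  assumes "h \<in> H"
  obtains u i where "u \<noteq> 0" "h = sl u (s * i)"
proof -
  obtain u j where uj: "u \<noteq> 0" "h = sl u j" using H_semilinearE[OF assms] .
  then obtain i where "j = s * i" using exponent_dvd assms by (auto simp: dvd_def)
  then show ?thesis using that uj by blast
qed

lemma p_power: "p ^ (s * i) = Q ^ i"
  by (simp add: Q_def power_mult)

lemma Q_power_b: "Q ^ b = p ^ f"
  by (simp add: f_eq p_power)

lemma g_power:
  obtains w' where "w' \<noteq> 0" "sl w s ^^ i = sl w' (s * i)" "sl w' (s * i) \<in> H"
proof -
  have "sl w s ^^ i \<in> H" using perm_group_funpow[OF H_group g_in_H] .
  then show ?thesis using that[of "w ^ (\<Sum>k<i. (p ^ s) ^ k)"] w_nonzero by (simp add: sl_funpow)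
qed

lemma decompose:
  assumes "u \<noteq> 0" "sl u (s * i) \<in> H"
  obtains c where "c \<in> A" "sl u (s * i) = sl c 0 \<circ> sl w s ^^ i"
proof -
  obtain w' where w': "w' \<noteq> 0" "sl w s ^^ i = sl w' (s * i)" "sl w' (s * i) \<in> H"
    by (rule g_power)
  have "u / w' \<in> A" using sl_div[OF assms(2) w'(3) assms(1) w'(1)] by simp
  moreover have "sl u (s * i) = sl (u / w') 0 \<circ> sl w s ^^ i"
    using w' by (simp add: sl_comp)
  ultimately show ?thesis using that by blast
qed

lemma exponent_zero_iff: "f dvd s * i \<longleftrightarrow> b dvd i"
  using s_pos by (simp add: f_eq)

end

lemma conj_eqI:
  assumes "bij x" "x \<circ> h = k \<circ> x"
  shows "x \<circ> h \<circ> finv x = k"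
  using assms by (simp add: comp_assoc bij_is_surj surj_iff[THEN iffD1])

section \<open>The action on the scalars and its effect modulo a prime\<close>

context semilinear_group_gen
begin

lemma sl_scalar: "sl u j \<circ> sl v 0 = sl (v ^ p ^ j) 0 \<circ> sl u j"
  by (simp add: sl_comp mult.commute)

lemma g_power_scalar: "sl w s ^^ i \<circ> sl v 0 = sl (v ^ Q ^ i) 0 \<circ> sl w s ^^ i"
proof -
  obtain w' where "sl w s ^^ i = sl w' (s * i)" using g_power[of i] by blast
  then show ?thesis by (simp add: sl_scalar p_power)
qed

lemma exponent_cong: "[s * i = s * j] (mod f) \<Longrightarrow> [i = j] (mod b)"
  using s_pos by (simp add: f_eq cong_def flip: mult_mod_right)

lemma Q_power_b_cong: "[Q ^ b = 1] (mod n)"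
  using n_dvd q_gt_1 by (simp add: Q_power_b cong_altdef_nat)

lemma A_power_cong: "u \<in> A \<Longrightarrow> [i = j] (mod n) \<Longrightarrow> u ^ i = u ^ j"
proof -
  assume u: "u \<in> A" and c: "[i = j] (mod n)"
  have *: "u ^ i = u ^ (i mod n)" for i
  proof -
    have "u ^ i = u ^ (n * (i div n) + i mod n)" by simp
    then show ?thesis using power_n[OF u] by (simp only: power_add power_mult) simp
  qed
  show ?thesis using *[of i] *[of j] c by (simp add: cong_def)
qed

lemma Q_power_cong:
  assumes "[i = j] (mod b)"
  shows "[Q ^ i = Q ^ j] (mod n)"
proof -
  have *: "[Q ^ i = Q ^ (i mod b)] (mod n)" for i
  proof -
    have "Q ^ i = (Q ^ b) ^ (i div b) * Q ^ (i mod b)" by (simp flip: power_mult power_add)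
    moreover have "[(Q ^ b) ^ (i div b) * Q ^ (i mod b) = 1 ^ (i div b) * Q ^ (i mod b)] (mod n)"
      by (intro cong_mult cong_pow Q_power_b_cong cong_refl)
    ultimately show ?thesis by simp
  qed
  show ?thesis using *[of i] *[of j] assms by (metis cong_def)
qed

text \<open>The divisibility makes the power a scalar; as it still fixes
  \<open>v \<noteq> 0\<close>, this scalar is 1.\<close>

lemma fixed_power_eq_id:
  assumes "u \<noteq> 0" "sl u (s * i) v = v" "v \<noteq> 0" "b dvd i * t"
  shows "sl u (s * i) ^^ t = id"
proof -
  let ?y = "u ^ (\<Sum>k<t. (p ^ (s * i)) ^ k)"
  have e: "sl u (s * i) ^^ t = sl ?y (s * (i * t))" by (simp add: sl_funpow mult.assoc)
  have "[s * (i * t) = 0] (mod f)" using assms(4) exponent_zero_iff by (simp add: cong_0_iff)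
  then have e': "sl u (s * i) ^^ t = sl ?y 0" using e sl_eq_iff[of ?y "s * (i * t)" ?y 0] assms(1) by simp
  have "(sl u (s * i) ^^ t) v = v" by (induction t) (simp_all add: assms)
  then have "?y = 1" using e' assms(3) by (simp add: sl_def)
  then show ?thesis using e' sl_1_0 by simp
qed

text \<open>An element of \<open>A\<close> lies in \<open>A^r\<close> when its
  \<open>n div r\<close>-th power is 1, and in the quotient \<open>A / A^r\<close> exponents count
  modulo \<open>r\<close>.\<close>

lemma A_power_cong_div:
  assumes "u \<in> A" "r dvd n" "[i = j] (mod r)"
  shows "(u ^ i) ^ (n div r) = (u ^ j) ^ (n div r)"
proof -
  have "[i * (n div r) = j * (n div r)] (mod r * (n div r))"
    using assms(3) by (simp add: cong_def mult_mod_left[symmetric])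
  then have "[i * (n div r) = j * (n div r)] (mod n)" using assms(2) by simp
  then show ?thesis using A_power_cong[OF assms(1)] by (simp flip: power_mult)
qed

lemma root_div_in_A: "r dvd n \<Longrightarrow> u ^ (n div r) = 1 \<Longrightarrow> u \<in> A"
proof -
  assume "r dvd n" "u ^ (n div r) = 1"
  then have "(u ^ (n div r)) ^ r = 1" "(n div r) * r = n" by simp_all
  then show ?thesis by (simp add: A_eq flip: power_mult)
qed

text \<open>Raising to a power prime to \<open>r\<close> is injective on
  \<open>A / A^r\<close>.\<close>

lemma gcd_div_prime:
  assumes "Factorial_Ring.prime r" "r dvd n" "\<not> r dvd k" "c \<in> A" "(c ^ k) ^ (n div r) = 1"
  shows "c ^ (n div r) = 1"
proof -
  have "coprime k r" using assms(1,3) by (metis coprime_commute prime_imp_coprime)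
  then have "gcd (k * (n div r)) (r * (n div r)) = n div r"
    using gcd_mult_distrib_nat[of "n div r" k r] by (simp add: mult.commute)
  moreover have "c ^ (k * (n div r)) = 1" using assms(5) by (simp add: power_mult)
  moreover have "c ^ (r * (n div r)) = 1" using power_n[OF assms(4)] assms(2) by simp
  ultimately show ?thesis by (metis power_gcd_eq_1)
qed

text \<open>If \<open>Q\<close> is not \<open>1\<close> modulo \<open>r\<close>, then \<open>H\<close> acts nontrivially on \<open>A / A^r\<close>: the
  elements acting trivially lie in the kernel \<open>L\<close>, and the others are conjugate into \<open>A^r\<langle>g\<rangle>\<close>.\<close>

lemma Q_cong_1:
  assumes ncov: "\<not> two_coverable H" and r: "Factorial_Ring.prime r" and rn: "r dvd n"
  shows "[Q = 1] (mod r)"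
proof (rule ccontr)
  assume neq: "\<not> [Q = 1] (mod r)"
  let ?m = "n div r"
  let ?g = "sl w s"
  define K where "K = {sl v 0 \<circ> ?g ^^ i | v i. v ^ ?m = 1}"
  define L where "L = {sl u (s * i) | u i. u \<noteq> 0 \<and> sl u (s * i) \<in> H \<and> [Q ^ i = 1] (mod r)}"
  have Ln: "[Q ^ i = Q ^ j] (mod r)" if "[i = j] (mod b)" for i j
    using cong_dvd_modulus_nat[OF Q_power_cong[OF that] rn] .
  have Lsub: "L \<subseteq> H" by (auto simp: L_def)
  have Lid: "id \<in> L"
    using perm_groupD(1)[OF H_group] sl_1_0 unfolding L_def
    by (intro CollectI exI[of _ 1] exI[of _ 0]) simp
  have Lg: "perm_group L" unfolding perm_group_def
  proof (intro conjI ballI Lid)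
    fix h assume "h \<in> L" then show "bij h" using Lsub perm_groupD(2)[OF H_group] by auto
  next
    fix h k assume "h \<in> L" "k \<in> L"
    then obtain u i v j where hk: "u \<noteq> 0" "v \<noteq> 0" "h = sl u (s * i)" "k = sl v (s * j)"
      "[Q ^ i = 1] (mod r)" "[Q ^ j = 1] (mod r)" "h \<in> H" "k \<in> H" by (auto simp: L_def)
    have "h \<circ> k = sl (u * v ^ p ^ (s * i)) (s * (i + j))" using hk by (simp add: sl_comp algebra_simps)
    moreover have "[Q ^ (i + j) = 1] (mod r)" using cong_mult[OF hk(5,6)] by (simp add: power_add)
    moreover have "h \<circ> k \<in> H" using hk perm_groupD(3)[OF H_group] by simp
    ultimately show "h \<circ> k \<in> L" using hk(1,2) unfolding L_def
      by (intro CollectI exI[of _ "u * v ^ p ^ (s * i)"] exI[of _ "i + j"]) simp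
  qed
  have "?g \<notin> L"
  proof
    assume "?g \<in> L"
    then obtain u i where ui: "?g = sl u (s * i)" "[Q ^ i = 1] (mod r)" by (auto simp: L_def)
    then have "[s * 1 = s * i] (mod f)" using sl_eq_iff[OF w_nonzero] by simp
    then have "[Q ^ 1 = Q ^ i] (mod r)" by (intro Ln exponent_cong)
    then show False using ui(2) neq cong_trans by fastforce
  qed
  then have L: "L \<subset> H" using Lsub g_in_H by blast
  have Ksub: "K \<subseteq> H"
  proof
    fix h assume "h \<in> K"
    then obtain v i where "h = sl v 0 \<circ> ?g ^^ i" "v ^ ?m = 1" by (auto simp: K_def)
    then show "h \<in> H" using root_div_in_A[OF rn] perm_groupD(3)[OF H_group]
        perm_group_funpow[OF H_group g_in_H] by (simp add: A_def)
  qed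
  have Kg: "perm_group K" unfolding perm_group_def
  proof (intro conjI ballI)
    show "id \<in> K" using sl_1_0 unfolding K_def
      by (intro CollectI exI[of _ 1] exI[of _ 0]) simp
  next
    fix h assume "h \<in> K" then show "bij h" using Ksub perm_groupD(2)[OF H_group] by auto
  next
    fix h k assume "h \<in> K" "k \<in> K"
    then obtain v i v' j where hk: "h = sl v 0 \<circ> ?g ^^ i" "k = sl v' 0 \<circ> ?g ^^ j" "v ^ ?m = 1" "v' ^ ?m = 1"
      by (auto simp: K_def)
    have "h \<circ> k = sl v 0 \<circ> (?g ^^ i \<circ> sl v' 0) \<circ> ?g ^^ j" using hk by (simp add: comp_assoc)
    also have "\<dots> = sl v 0 \<circ> sl (v' ^ Q ^ i) 0 \<circ> (?g ^^ i \<circ> ?g ^^ j)"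
      by (simp add: g_power_scalar comp_assoc)
    also have "\<dots> = sl (v * v' ^ Q ^ i) 0 \<circ> ?g ^^ (i + j)" by (simp add: sl_comp funpow_add)
    finally have "h \<circ> k = sl (v * v' ^ Q ^ i) 0 \<circ> ?g ^^ (i + j)" .
    moreover have "(v * v' ^ Q ^ i) ^ ?m = 1"
      using hk by (simp add: power_mult_distrib power_commuting_commutes flip: power_mult)
        (metis mult.commute power_mult power_one)
    ultimately show "h \<circ> k \<in> K" unfolding K_def by blast
  qed
  have "sl a 0 \<notin> K"
  proof
    assume "sl a 0 \<in> K"
    then obtain v i where vi: "sl a 0 = sl v 0 \<circ> ?g ^^ i" "v ^ ?m = 1" by (auto simp: K_def)
    have vA: "v \<in> A" using root_div_in_A[OF rn vi(2)] .
    obtain w' where w': "w' \<noteq> 0" "?g ^^ i = sl w' (s * i)" using g_power[of i] by blast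
    have a0: "a \<noteq> 0" using A_nonzero a_in_A by blast
    have "sl a 0 = sl (v * w') (s * i)" using vi w' by (simp add: sl_comp)
    then have aw: "a = v * w'" "[0 = s * i] (mod f)" using sl_eq_iff[OF a0] by auto
    then have gi: "?g ^^ i = sl w' 0" using w' sl_eq_iff[of w' 0 w' "s * i"] by simp
    have w'A: "w' \<in> A" using gi perm_group_funpow[OF H_group g_in_H, of i] w' by (simp add: A_def)
    \<comment> \<open>A scalar power of \<open>?g\<close> commutes with \<open>?g\<close>, so it is
      fixed by \<open>x \<mapsto> x ^ Q\<close>. As \<open>r\<close> does not divide
      \<open>Q - 1\<close>, it lies in \<open>A^r\<close>, and then so would the generator
      \<open>a\<close>.\<close>
    have "?g \<circ> sl w' 0 = sl w' 0 \<circ> ?g" using gi funpow_swap1 by (metis funpow.simps(2) funpow_Suc_right)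
    then have "sl (w * w' ^ p ^ s) s = sl (w' * w) s" by (simp add: sl_comp)
    then have "w * w' ^ p ^ s = w' * w" using w' w_nonzero sl_eq_iff[of "w * w' ^ p ^ s" s] by simp
    then have "w' ^ Q = w'" using w_nonzero by (simp add: Q_def)
    then have "w' * w' ^ (Q - 1) = w' * 1"
      using p_gt_1 by (simp add: Q_def flip: power_Suc)
    then have "w' ^ (Q - 1) = 1" using w' by simp
    moreover have "\<not> r dvd Q - 1" using neq p_gt_1 by (simp add: Q_def cong_altdef_nat)
    ultimately have "w' ^ ?m = 1" using gcd_div_prime[OF r rn _ w'A, of "Q - 1"] by simp
    then have "a ^ ?m = 1" using aw vi by (simp add: power_mult_distrib)
    then have "n dvd n div r" by (simp add: a_power_eq_1_iff)
    then have "n \<le> n div r" using rn n_pos by (intro dvd_imp_le) (auto elim: dvdE)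
    then show False using n_pos prime_gt_1_nat[OF r] by (metis div_less_dividend not_le)
  qed
  moreover have "sl a 0 \<in> H" using a_in_A by (simp add: A_def)
  ultimately have K: "K \<subset> H" using Ksub by blast
  have "\<exists>x\<in>H. x \<circ> h \<circ> finv x \<in> K \<union> L" if h: "h \<in> H" for h
  proof -
    obtain u i where ui: "u \<noteq> 0" "h = sl u (s * i)" using sl_in_H_E[OF h] .
    show ?thesis
    proof (cases "[Q ^ i = 1] (mod r)")
      case True
      then have "id \<circ> h \<circ> finv id \<in> L" using ui h by (auto simp: L_def)
      then show ?thesis using perm_groupD(1)[OF H_group] by blast
    next
      case False
      obtain c where c: "c \<in> A" "h = sl c 0 \<circ> ?g ^^ i" using decompose[of u i] ui h by blast
      have Qi: "Q ^ i \<ge> 1" using p_gt_1 by (simp add: Q_def)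
      have "\<not> r dvd Q ^ i - 1" using False Qi by (simp add: cong_altdef_nat)
      then have "coprime (Q ^ i - 1) r" using r by (metis coprime_commute prime_imp_coprime)
      \<comment> \<open>Conjugation by the scalar \<open>c ^ k\<close> changes the coefficient
        \<open>c\<close> of \<open>h\<close> into c^(1 - k (Q^i - 1)), which lies in
        \<open>A^r\<close> for \<open>k\<close> inverse to \<open>Q ^ i - 1\<close> modulo
        \<open>r\<close>.\<close>
      then obtain k where k: "[(Q ^ i - 1) * k = 1] (mod r)" using cong_solve_coprime_nat[of "Q ^ i - 1" r] by auto
      have "Q ^ i * k = (Q ^ i - 1) * k + k" using Qi by (simp add: diff_mult_distrib)
      then have k': "[Q ^ i * k = Suc k] (mod r)" using cong_add[OF k cong_refl, of k] by simp
      let ?y = "c ^ k"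
      have yA: "?y \<in> A" using power_in_A c by simp
      have y0: "?y \<noteq> 0" using A_nonzero yA by blast
      let ?z = "c * ?y / ?y ^ Q ^ i"
      have "sl ?z 0 \<circ> ?g ^^ i \<circ> sl ?y 0 = sl ?z 0 \<circ> sl (?y ^ Q ^ i) 0 \<circ> ?g ^^ i"
        by (simp add: comp_assoc g_power_scalar)
      also have "\<dots> = sl ?y 0 \<circ> h" using y0 c by (simp add: sl_comp mult.commute flip: comp_assoc)
      finally have "sl ?y 0 \<circ> h \<circ> finv (sl ?y 0) = sl ?z 0 \<circ> ?g ^^ i"
        by (intro conj_eqI sl_bij y0) simp
      moreover have "?z ^ ?m = 1"
      proof -
        have "(c ^ (Q ^ i * k)) ^ ?m = (c ^ Suc k) ^ ?m" using A_power_cong_div[OF c(1) rn k'] .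
        moreover have "c ^ Suc k \<noteq> 0" using A_nonzero[OF c(1)] by simp
        moreover have "c ^ (Q ^ i * k) = ?y ^ Q ^ i" by (simp add: mult.commute flip: power_mult)
        ultimately show ?thesis by (simp add: power_divide)
      qed
      ultimately have "sl ?y 0 \<circ> h \<circ> finv (sl ?y 0) \<in> K" unfolding K_def by auto
      moreover have "sl ?y 0 \<in> H" using yA by (simp add: A_def)
      ultimately show ?thesis by blast
    qed
  qed
  then have "two_coverable H" unfolding two_coverable_def using Kg Lg K L by blast
  then show False using ncov by simp
qed

end

section \<open>Congruences for geometric sums\<close>

lemma prime_power_decompose:
  fixes r m :: nat
  assumes "Factorial_Ring.prime r" "m > 0"
  obtains k m' where "m = r ^ k * m'" "\<not> r dvd m'"
proof -
  have "m \<noteq> 0" "\<not> is_unit r" using assms not_prime_unit by auto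
  then show ?thesis using that by (rule multiplicity_decompose')
qed

lemma two_power_if_prime_factors:
  fixes m :: nat
  assumes "m > 0" "\<And>r. Factorial_Ring.prime r \<Longrightarrow> r dvd m \<Longrightarrow> r = 2"
  obtains k where "m = 2 ^ k"
proof -
  obtain k m' where m: "m = 2 ^ k * m'" "\<not> 2 dvd m'"
    using prime_power_decompose[OF two_is_prime_nat assms(1)] .
  have "m' = 1"
  proof (rule ccontr)
    assume "m' \<noteq> 1"
    then obtain q where q: "Factorial_Ring.prime q" "q dvd m'" using prime_factor_nat by blast
    then show False using assms(2)[of q] m by auto
  qed
  then show ?thesis using that m by simp
qed

text \<open>In Y^r - 1 = (Y - 1) S the sum S is congruent to \<open>r\<close> modulo each prime
  divisor of \<open>m\<close>, hence prime to \<open>m\<close>.\<close>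

lemma cong_1_of_power_cong_1:
  fixes Y r m :: nat
  assumes r: "Factorial_Ring.prime r" and m: "\<not> r dvd m"
    and pow: "[Y ^ r = 1] (mod m)"
    and primes: "\<And>q. Factorial_Ring.prime q \<Longrightarrow> q dvd m \<Longrightarrow> [Y = 1] (mod q)"
  shows "[Y = 1] (mod m)"
proof -
  let ?S = "\<Sum>i<r. Y ^ i"
  have "coprime m ?S"
  proof (rule ccontr)
    assume "\<not> coprime m ?S"
    then obtain q where q: "Factorial_Ring.prime q" "q dvd m" "q dvd ?S"
      by (metis coprime_iff_gcd_eq_1 gcd_greatest_iff prime_factor_nat)
    have "[?S = (\<Sum>i<r. 1 ^ i)] (mod q)" by (intro cong_sum cong_pow primes q)
    then have "q dvd r" using q by (simp add: cong_dvd_iff)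
    then show False using r q m primes_dvd_imp_eq by metis
  qed
  then have cop: "coprime (int m) (int ?S)" by (simp only: coprime_int_iff)
  have "int Y ^ r - 1 = (int Y - 1) * (\<Sum>i<r. int Y ^ i)" by (rule power_diff_1_eq)
  also have "(\<Sum>i<r. int Y ^ i) = int ?S" by simp
  finally have "int Y ^ r - 1 = (int Y - 1) * int ?S" .
  moreover have "int m dvd int Y ^ r - 1"
    using pow by (simp add: cong_iff_dvd_diff flip: cong_int_iff)
  ultimately have "int m dvd int Y - 1" using cop by (metis coprime_dvd_mult_left_iff)
  then show ?thesis by (simp add: cong_iff_dvd_diff flip: cong_int_iff)
qed

text \<open>Each further \<open>r\<close>-th power gains a factor \<open>r\<close>: the
  complementary factor in Y^r - 1 is a sum of \<open>r\<close> terms that are 1 modulo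
  \<open>r\<close>.\<close>

lemma cong_1_power_prime_power:
  fixes U r :: nat
  assumes "[U = 1] (mod r)"
  shows "[U ^ r ^ j = 1] (mod (r ^ Suc j))"
proof (induction j)
  case (Suc j)
  let ?Y = "U ^ r ^ j"
  have dvd: "int (r ^ Suc j) dvd int ?Y - 1"
    using Suc by (simp only: cong_iff_dvd_diff flip: cong_int_iff) simp
  have Yr: "[?Y = 1] (mod r)" using cong_pow[OF assms, of "r ^ j"] by simp
  have "[(\<Sum>i<r. ?Y ^ i) = (\<Sum>i<r. 1 ^ i)] (mod r)" by (intro cong_sum cong_pow Yr)
  then have "r dvd (\<Sum>i<r. ?Y ^ i)" by (simp add: cong_dvd_iff)
  then have "int r dvd int (\<Sum>i<r. ?Y ^ i)" by (simp only: int_dvd_int_iff)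
  then have "int r dvd (\<Sum>i<r. int ?Y ^ i)" by (simp only: of_nat_sum of_nat_power)
  then have "int (r ^ Suc j) * int r dvd (int ?Y - 1) * (\<Sum>i<r. int ?Y ^ i)"
    by (intro mult_dvd_mono dvd)
  also have "(int ?Y - 1) * (\<Sum>i<r. int ?Y ^ i) = int ?Y ^ r - 1" by (rule power_diff_1_eq[symmetric])
  also have "int ?Y ^ r - 1 = int (U ^ r ^ Suc j) - 1"
    by (simp add: mult.commute flip: power_mult)
  finally have "int (r ^ Suc (Suc j)) dvd int (U ^ r ^ Suc j) - 1" by (simp add: mult.commute)
  then show ?case by (simp only: cong_iff_dvd_diff flip: cong_int_iff) simp
qed (use assms in simp)

text \<open>Both sides are (U^(c d) - 1) / (U - 1), factored through U^c - 1; the form with sums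
  makes sense for \<open>U = 1\<close> as well.\<close>

lemma geometric_sum_mult:
  fixes U :: nat
  shows "(\<Sum>i<c * d. U ^ i) = (\<Sum>i<c. U ^ i) * (\<Sum>i<d. (U ^ c) ^ i)"
proof (induction d)
  case (Suc d)
  have "(\<Sum>i<k + m. U ^ i) = (\<Sum>i<k. U ^ i) + U ^ k * (\<Sum>i<m. U ^ i)" for k m
    by (induction m) (simp_all add: power_add algebra_simps)
  from this[of "c * d" c]
  have "(\<Sum>i<c * Suc d. U ^ i) = (\<Sum>i<c * d. U ^ i) + U ^ (c * d) * (\<Sum>i<c. U ^ i)"
    by (simp add: add.commute)
  also have "\<dots> = (\<Sum>i<c. U ^ i) * (\<Sum>i<Suc d. (U ^ c) ^ i)"
    by (simp add: Suc power_mult algebra_simps)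
  finally show ?case .
qed simp

text \<open>The case of the lifting-the-exponent lemma in which the valuation of the quotient
  \<open>(U ^ r ^ c - 1) / (U - 1)\<close> is exactly \<open>c\<close>.\<close>

lemma not_prime_power_dvd_geometric_sum:
  fixes U r :: nat
  assumes r: "Factorial_Ring.prime r" and U: "[U = 1] (mod r)"
    and "odd r \<or> [U = 1] (mod 4)"
  shows "\<not> r ^ Suc c dvd (\<Sum>i<r ^ c. U ^ i)"
proof (induction c)
  case 0
  then show ?case using prime_gt_1_nat[OF r] by simp
next
  case (Suc c)
  let ?Y = "U ^ r ^ c"
  let ?S = "\<Sum>i<r. ?Y ^ i"
  have "\<not> r * r dvd ?S"
  proof (cases "odd r")
    case True
    have "[?Y = 1] (mod r)" using cong_pow[OF U, of "r ^ c"] by simp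
    then have "int r dvd int ?Y - 1" by (simp add: cong_iff_dvd_diff flip: cong_int_iff)
    then obtain z where z: "int ?Y = 1 + int r * z" by (metis add_diff_cancel_left' diff_add_cancel dvdE add.commute)
    \<comment> \<open>Modulo r^2 the powers of 1 + r z are linear in the exponent. For odd
      \<open>r\<close> the linear terms add up to r z times r (r - 1) / 2, a multiple of r^2, and
      only \<open>r\<close> remains.\<close>
    have pw: "[int ?Y ^ i = 1 + int i * (int r * z)] (mod (int r * int r))" for i
    proof (induction i)
      case (Suc i)
      have "[int ?Y ^ Suc i = (1 + int r * z) * (1 + int i * (int r * z))] (mod (int r * int r))"
        unfolding power_Suc z[symmetric] by (intro cong_mult cong_refl Suc)
      also have "(1 + int r * z) * (1 + int i * (int r * z)) =
          1 + int (Suc i) * (int r * z) + (int r * int r) * (int i * z * z)"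
        by (simp add: algebra_simps)
      also have "[\<dots> = 1 + int (Suc i) * (int r * z)] (mod (int r * int r))"
        by (simp add: cong_def)
      finally show ?case .
    qed simp
    have "[int ?S = (\<Sum>i<r. 1 + int i * (int r * z))] (mod (int r * int r))"
      unfolding of_nat_sum of_nat_power[of ?Y] by (intro cong_sum pw)
    also have "(\<Sum>i<r. 1 + int i * (int r * z)) = int r + (\<Sum>i<r. int i) * (int r * z)"
      by (simp add: sum.distrib sum_distrib_right)
    also have "(\<Sum>i<r. int i) = int r * ((int r - 1) div 2)"
    proof -
      have "2 * (\<Sum>i<m. int i) = int m * (int m - 1)" for m
        by (induction m) (simp_all add: algebra_simps)
      moreover have "2 * ((int r - 1) div 2) = int r - 1" using True by simp
      ultimately have "2 * (\<Sum>i<r. int i) = 2 * (int r * ((int r - 1) div 2))"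
        by (simp add: mult.left_commute)
      then show ?thesis by simp
    qed
    also have "int r + int r * ((int r - 1) div 2) * (int r * z) =
        int r + (int r * int r) * (((int r - 1) div 2) * z)" by (simp add: algebra_simps)
    also have "[\<dots> = int r] (mod (int r * int r))" by (simp add: cong_def)
    finally have "[int ?S = int r] (mod (int r * int r))" .
    then have "[?S = r] (mod (r * r))" by (simp only: flip: of_nat_mult cong_int_iff)
    then have "r * r dvd ?S \<longleftrightarrow> r * r dvd r" using cong_dvd_iff by blast
    then show ?thesis using prime_gt_1_nat[OF r] by (auto dest: dvd_imp_le)
  next
    case False
    then have r2: "r = 2" using r by (metis prime_odd_nat linorder_neqE_nat not_less_iff_gr_or_eq prime_ge_2_nat less_le)
    \<comment> \<open>For \<open>U\<close> congruent to 3 modulo 4 the first factor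
      \<open>1 + U\<close> would already be divisible by 4.\<close>
    have "[U = 1] (mod 4)" using assms(3) False by simp
    then have "[?Y = 1] (mod 4)" using cong_pow[of U 1 4 "r ^ c"] by simp
    then have "[?S = 2] (mod 4)" using cong_add[of 1 1 4 ?Y 1] r2
      by (simp add: numeral_2_eq_2 lessThan_Suc)
    then have "4 dvd ?S \<longleftrightarrow> 4 dvd (2::nat)" using cong_dvd_iff by blast
    then show ?thesis using r2 by simp
  qed
  then have nd: "\<not> r * r dvd ?S" .
  have e: "(\<Sum>i<r ^ Suc c. U ^ i) = (\<Sum>i<r ^ c. U ^ i) * ?S"
    using geometric_sum_mult[of U "r ^ c" r] by (simp add: mult.commute)
  show ?case
  proof
    assume "r ^ Suc (Suc c) dvd (\<Sum>i<r ^ Suc c. U ^ i)"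
    then have d: "r ^ Suc c * r dvd (\<Sum>i<r ^ c. U ^ i) * ?S" unfolding e by (simp add: mult.commute)
    obtain j m' where j: "?S = r ^ j * m'" "\<not> r dvd m'"
    proof (rule prime_power_decompose[OF r, of ?S])
      show "?S > 0" using nd by (metis dvd_0_right gr0I)
    qed blast
    have "j \<le> 1"
    proof (rule ccontr)
      assume "\<not> j \<le> 1"
      then have "r ^ 2 dvd r ^ j" by (intro le_imp_power_dvd) simp
      then show False using nd j by (simp add: power2_eq_square)
    qed
    then have "r ^ j dvd r" by (cases j) auto
    then have "(\<Sum>i<r ^ c. U ^ i) * (r ^ j * m') dvd (\<Sum>i<r ^ c. U ^ i) * (r * m')"
      by (intro mult_dvd_mono dvd_refl)
    then have "r ^ Suc c * r dvd ((\<Sum>i<r ^ c. U ^ i) * r) * m'"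
      using dvd_trans[OF d] unfolding j(1) mult.assoc by blast
    moreover have "coprime (r ^ Suc c * r) m'"
      using prime_imp_coprime[OF r j(2)] by simp
    ultimately have "r ^ Suc c * r dvd (\<Sum>i<r ^ c. U ^ i) * r"
      using coprime_dvd_mult_left_iff by blast
    then have "r ^ Suc c dvd (\<Sum>i<r ^ c. U ^ i)" using prime_gt_0_nat[OF r] nat_mult_dvd_cancel1[of r] by (simp add: mult.commute)
    then show False using Suc by simp
  qed
qed

text \<open>The cofactor of \<open>g\<close> in \<open>m\<close> must absorb a factor
  \<open>r\<close>. With \<open>m = n\<close> this shows that an element of \<open>A\<close> whose
  order lacks the full \<open>r\<close>-part of \<open>n\<close> lies in \<open>A^r\<close>.\<close>

lemma dvd_div_prime:
  fixes m r g :: nat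
  assumes r: "Factorial_Ring.prime r" and m: "m = r ^ k * m'" "g dvd m" "\<not> r ^ k dvd g"
  shows "g dvd m div r"
proof -
  obtain c where c: "m = g * c" using m by (auto simp: dvd_def)
  have "r dvd c"
  proof (rule ccontr)
    assume "\<not> r dvd c"
    then have "coprime (r ^ k) c" using r by (simp add: prime_imp_coprime)
    moreover have "r ^ k dvd g * c" using c m(1) by (metis dvd_triv_left)
    ultimately show False using m(3) coprime_dvd_mult_left_iff by blast
  qed
  then obtain c' where "c = r * c'" by (auto simp: dvd_def)
  then have "m div r = g * c'" using c prime_gt_0_nat[OF r] by (simp add: mult.left_commute)
  then show ?thesis by simp
qed

text \<open>The sum is the half sum times \<open>1 + U ^ M\<close>. As \<open>M\<close> is even,
  \<open>U ^ M\<close> is 1 modulo 4, so the second factor takes just one factor 2; multiplying the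
  half sum by the even number U - 1 regains it and gives U^M - 1.\<close>

lemma two_power_dvd_of_geometric_sum:
  fixes U :: nat
  assumes "odd U" "even M" "2 ^ k dvd (\<Sum>i<2 * M. U ^ i)"
  shows "[U ^ M = 1] (mod (2 ^ k))"
proof (cases k)
  case (Suc k')
  let ?S = "\<Sum>i<M. U ^ i"
  have e: "(\<Sum>i<2 * M. U ^ i) = ?S * (1 + U ^ M)"
    using geometric_sum_mult[of U M 2] by (simp add: mult.commute numeral_2_eq_2 lessThan_Suc add.commute)
  obtain M' where M': "M = 2 * M'" using assms(2) by blast
  have "U mod 4 = 1 \<or> U mod 4 = 3" using assms(1) by presburger
  then have "[U ^ 2 = 1] (mod 4)"
  proof
    assume "U mod 4 = 1"
    then have "[U = 1] (mod 4)" by (simp add: cong_def)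
    from cong_pow[OF this, of 2] show ?thesis by simp
  next
    assume "U mod 4 = 3"
    then have "[U = 3] (mod 4)" by (simp add: cong_def)
    from cong_pow[OF this, of 2] show ?thesis by (simp add: cong_def)
  qed
  then have "[U ^ M = 1] (mod 4)" using cong_pow[of "U ^ 2" 1 4 M'] M' by (simp flip: power_mult)
  then have "(1 + U ^ M) mod 4 = 2" by (simp add: cong_def mod_Suc)
  then have "1 + U ^ M = 2 * (2 * ((1 + U ^ M) div 4) + 1)"
    by presburger
  moreover have "odd (2 * ((1 + U ^ M) div 4) + 1)" by simp
  ultimately obtain c where c: "1 + U ^ M = 2 * c" "odd c" by blast
  have "2 * 2 ^ k' dvd 2 * (?S * c)" using assms(3) unfolding e c(1) Suc by (simp only: power_Suc mult.left_commute)
  then have "2 ^ k' dvd ?S * c" by simp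
  moreover have "coprime (2 ^ k') c" using c by simp
  ultimately have "2 ^ k' dvd ?S" using coprime_dvd_mult_left_iff by blast
  then have "int (2 ^ k') dvd int ?S" by (simp only: int_dvd_int_iff)
  moreover have "2 dvd int U - 1" using assms(1) by simp
  ultimately have "2 * int (2 ^ k') dvd (int U - 1) * int ?S" by (intro mult_dvd_mono)
  also have "(int U - 1) * int ?S = int U ^ M - 1" by (simp add: power_diff_1_eq)
  finally have "int (2 ^ k) dvd int (U ^ M) - 1" by (simp add: Suc)
  then show ?thesis by (simp only: cong_iff_dvd_diff flip: cong_int_iff) simp
qed simp

text \<open>The cofactor of \<open>p + 1\<close> in \<open>p ^ s + 1\<close> is an alternating sum
  of an odd number of odd terms, hence odd.\<close>

lemma two_power_dvd_Suc_base:
  fixes p :: nat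
  assumes "odd p" "odd s" "2 ^ k dvd p ^ s + 1"
  shows "2 ^ k dvd p + 1"
proof -
  let ?S = "\<Sum>i<s. (- int p) ^ i"
  have "(- int p) ^ s - 1 = (- int p - 1) * ?S" by (rule power_diff_1_eq)
  then have e: "int (p ^ s + 1) = int (p + 1) * ?S" using assms(2) by (simp add: algebra_simps)
  have "[?S = (\<Sum>i<s. 1 ^ i)] (mod 2)"
    using assms(1) by (intro cong_sum cong_pow) (simp add: cong_iff_dvd_diff)
  then have "[?S = int s] (mod 2)" by simp
  then have "odd ?S" using assms(2) cong_dvd_iff by fastforce
  then have "coprime (2 ^ k) ?S" by simp
  moreover have "int (2 ^ k) dvd int (p ^ s + 1)" using assms(3) by (simp only: int_dvd_int_iff)
  ultimately have "2 ^ k dvd int (p + 1)" unfolding e by (simp add: coprime_dvd_mult_left_iff)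
  then have "int (2 ^ k) dvd int (p + 1)" by simp
  then show ?thesis by (simp only: int_dvd_int_iff)
qed

section \<open>Stabilizers of non-basic groups\<close>

context semilinear_group_gen
begin

text \<open>Equality modulo \<open>A^r\<close>, the subgroup of \<open>(n / r)\<close>-th roots of unity.\<close>

definition cong_roots :: "nat \<Rightarrow> ('a \<Rightarrow> 'a) \<Rightarrow> ('a \<Rightarrow> 'a) \<Rightarrow> bool" where
  "cong_roots r h k \<longleftrightarrow> (\<exists>y. y ^ (n div r) = 1 \<and> h = sl y 0 \<circ> k)"

lemma cong_roots_refl: "cong_roots r h h"
  unfolding cong_roots_def by (intro exI[of _ 1]) (simp add: sl_1_0)

lemma cong_roots_trans: "cong_roots r h k \<Longrightarrow> cong_roots r k m \<Longrightarrow> cong_roots r h m"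
proof -
  assume "cong_roots r h k" "cong_roots r k m"
  then obtain y z where "y ^ (n div r) = 1" "h = sl y 0 \<circ> k" "z ^ (n div r) = 1" "k = sl z 0 \<circ> m"
    unfolding cong_roots_def by blast
  then have "(y * z) ^ (n div r) = 1" "h = sl (y * z) 0 \<circ> m"
    by (simp_all add: power_mult_distrib sl_comp flip: comp_assoc)
  then show ?thesis unfolding cong_roots_def by blast
qed

lemma cong_roots_comp:
  assumes "cong_roots r h h'" "cong_roots r k k'" "h' \<in> H"
  shows "cong_roots r (h \<circ> k) (h' \<circ> k')"
proof -
  obtain y z where yz: "y ^ (n div r) = 1" "h = sl y 0 \<circ> h'" "z ^ (n div r) = 1" "k = sl z 0 \<circ> k'"
    using assms unfolding cong_roots_def by blast
  obtain u j where h': "h' = sl u j" using H_semilinearE[OF assms(3)] by blast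
  have "h \<circ> k = sl y 0 \<circ> (sl u j \<circ> sl z 0) \<circ> k'" using yz h' by (simp add: comp_assoc)
  also have "\<dots> = sl y 0 \<circ> sl (z ^ p ^ j) 0 \<circ> (h' \<circ> k')"
    by (simp only: sl_scalar[of u j z] h' comp_assoc)
  finally have "h \<circ> k = sl (y * z ^ p ^ j) 0 \<circ> (h' \<circ> k')" by (simp add: sl_comp)
  moreover have "(y * z ^ p ^ j) ^ (n div r) = 1"
  proof -
    have "(z ^ p ^ j) ^ (n div r) = (z ^ (n div r)) ^ p ^ j" by (simp add: mult.commute flip: power_mult)
    then show ?thesis using yz by (simp add: power_mult_distrib)
  qed
  ultimately show ?thesis unfolding cong_roots_def by blast
qed

text \<open>For \<open>Q\<close> congruent to 1 modulo \<open>r\<close> the generator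
  \<open>sl w s\<close> centralizes \<open>A / A^r\<close>. So \<open>H / A^r\<close> is generated
  by a central subgroup and one further element, and it is abelian.\<close>

lemma cong_roots_commute:
  assumes rn: "r dvd n" and Q: "[Q = 1] (mod r)" and h: "h \<in> H" and k: "k \<in> H"
  shows "cong_roots r (h \<circ> k) (k \<circ> h)"
proof -
  let ?g = "sl w s"
  obtain u i where "u \<noteq> 0" "h = sl u (s * i)" using sl_in_H_E[OF h] .
  then obtain c where c: "c \<in> A" "h = sl c 0 \<circ> ?g ^^ i" using decompose[of u i] h by blast
  obtain v j where "v \<noteq> 0" "k = sl v (s * j)" using sl_in_H_E[OF k] .
  then obtain d where d: "d \<in> A" "k = sl d 0 \<circ> ?g ^^ j" using decompose[of v j] k by blast
  have *: "sl c 0 \<circ> ?g ^^ i \<circ> (sl d 0 \<circ> ?g ^^ j) = sl (c * d ^ Q ^ i) 0 \<circ> ?g ^^ (i + j)" for c d i j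
  proof -
    have "sl c 0 \<circ> ?g ^^ i \<circ> (sl d 0 \<circ> ?g ^^ j) = sl c 0 \<circ> (?g ^^ i \<circ> sl d 0) \<circ> ?g ^^ j"
      by (simp add: comp_assoc)
    also have "\<dots> = sl c 0 \<circ> sl (d ^ Q ^ i) 0 \<circ> (?g ^^ i \<circ> ?g ^^ j)"
      by (simp only: g_power_scalar comp_assoc)
    finally show ?thesis by (simp add: sl_comp funpow_add)
  qed
  have c0: "c \<noteq> 0" and d0: "d \<noteq> 0" using A_nonzero c d by blast+
  let ?y = "(c * d ^ Q ^ i) / (d * c ^ Q ^ j)"
  have "h \<circ> k = sl (?y * (d * c ^ Q ^ j)) 0 \<circ> ?g ^^ (i + j)"
    using c0 d0 unfolding c(2) d(2) * by simp
  also have "\<dots> = sl ?y 0 \<circ> (k \<circ> h)"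
    unfolding c(2) d(2) * by (simp add: sl_comp add.commute flip: comp_assoc)
  finally have "h \<circ> k = sl ?y 0 \<circ> (k \<circ> h)" .
  moreover have "?y ^ (n div r) = 1"
  proof -
    have "(x ^ Q ^ i) ^ (n div r) = (x ^ 1) ^ (n div r)" if "x \<in> A" for x i
      using A_power_cong_div[OF that rn] cong_pow[OF Q, of i] by simp
    then show ?thesis using c(1) d(1) c0 d0 by (simp add: power_divide power_mult_distrib)
  qed
  ultimately show ?thesis unfolding cong_roots_def by blast
qed

text \<open>Modulo \<open>A^r\<close> the \<open>t\<close>-th power is thus a homomorphism, so
  conditions on \<open>h ^^ t\<close> modulo \<open>A^r\<close> cut out subgroups.\<close>

lemma cong_roots_funpow_comp:
  assumes rn: "r dvd n" and Q: "[Q = 1] (mod r)" and h: "h \<in> H" and k: "k \<in> H"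
  shows "cong_roots r ((h \<circ> k) ^^ t) (h ^^ t \<circ> k ^^ t)"
proof (induction t)
  case 0
  then show ?case by (simp add: cong_roots_refl)
next
  case (Suc t)
  have ht: "h ^^ t \<in> H" and hk: "h \<circ> k \<in> H"
    using perm_group_funpow[OF H_group h] perm_groupD(3)[OF H_group h k] by auto
  have "cong_roots r ((h \<circ> k) \<circ> (h \<circ> k) ^^ t) ((h \<circ> k) \<circ> (h ^^ t \<circ> k ^^ t))"
    by (intro cong_roots_comp cong_roots_refl Suc hk)
  moreover have "cong_roots r (h \<circ> (k \<circ> h ^^ t) \<circ> k ^^ t) (h \<circ> (h ^^ t \<circ> k) \<circ> k ^^ t)"
    by (intro cong_roots_comp cong_roots_refl cong_roots_commute rn Q h k ht perm_groupD(3)[OF H_group])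
  ultimately have "cong_roots r ((h \<circ> k) \<circ> (h \<circ> k) ^^ t) (h \<circ> (h ^^ t \<circ> k) \<circ> k ^^ t)"
    using cong_roots_trans by (simp add: comp_assoc)
  then show ?case by (simp only: funpow.simps comp_assoc)
qed

lemma a_not_root: "Factorial_Ring.prime r \<Longrightarrow> r dvd n \<Longrightarrow> a ^ (n div r) \<noteq> 1"
proof
  assume r: "Factorial_Ring.prime r" "r dvd n" and "a ^ (n div r) = 1"
  then have "n dvd n div r" by (simp add: a_power_eq_1_iff)
  then have "n \<le> n div r" using r n_pos by (intro dvd_imp_le) (auto elim: dvdE)
  then show False using n_pos prime_gt_1_nat[OF r(1)] by (metis div_less_dividend not_le)
qed

lemma scalar_in_H: "c \<in> A \<Longrightarrow> sl c 0 \<in> H"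
  by (simp add: A_def)

lemma scalar_comp_funpow:
  "(sl d 0 \<circ> sl u j) ^^ m = sl (d ^ (\<Sum>i<m. (p ^ j) ^ i)) 0 \<circ> sl u j ^^ m"
  by (simp add: sl_comp sl_funpow power_mult_distrib)

end

text \<open>\<open>fixed_outside\<close> is the form in which \<gamma>(G) \<noteq> 2 is used: no
  proper subgroup contains every element with a nonzero fixed vector (see
  \<open>two_coverable_affineI\<close>). \<open>nontrivial\<close> excludes G cyclic of prime order,
  which has no normal covering at all.\<close>

locale nonbasic_semilinear = semilinear_group_gen +
  assumes irreducible: "0 \<in> W \<Longrightarrow> (\<And>x y. x \<in> W \<Longrightarrow> y \<in> W \<Longrightarrow> x + y \<in> W) \<Longrightarrow>
      (\<And>h x. h \<in> H \<Longrightarrow> x \<in> W \<Longrightarrow> h x \<in> W) \<Longrightarrow> W = {0} \<or> W = UNIV"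
    and not_coverable: "\<not> two_coverable H"
    and fixed_outside: "perm_group K \<Longrightarrow> K \<subset> H \<Longrightarrow> \<exists>h v. h \<in> H \<and> h \<notin> K \<and> v \<noteq> 0 \<and> h v = v"
    and nontrivial: "H \<noteq> {id}"
begin

text \<open>Elements with a nonzero fixed vector have trivial \<open>b\<close>-th power, so they all
  lie in the subgroup defined by h^b in \<open>A^r\<close>; if \<open>r\<close> did not divide
  \<open>b\<close>, it would miss \<open>a\<close>.\<close>

lemma prime_dvd_n_imp_dvd_b:
  assumes r: "Factorial_Ring.prime r" and rn: "r dvd n"
  shows "r dvd b"
proof (rule ccontr)
  assume rb: "\<not> r dvd b"
  have Q: "[Q = 1] (mod r)" using Q_cong_1[OF not_coverable r rn] .
  define N where "N = {h \<in> H. cong_roots r (h ^^ b) id}"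
  have "perm_group N" unfolding perm_group_def
  proof (intro conjI ballI)
    show "id \<in> N" using perm_groupD(1)[OF H_group] cong_roots_refl by (simp add: N_def)
  next
    fix h assume "h \<in> N" then show "bij h" using perm_groupD(2)[OF H_group] by (auto simp: N_def)
  next
    fix h k assume hk: "h \<in> N" "k \<in> N"
    then have H: "h \<in> H" "k \<in> H" by (auto simp: N_def)
    have "cong_roots r (h ^^ b \<circ> k ^^ b) (id \<circ> id)"
      using hk perm_groupD(1)[OF H_group] by (intro cong_roots_comp) (auto simp: N_def)
    then have "cong_roots r ((h \<circ> k) ^^ b) id"
      using cong_roots_trans[OF cong_roots_funpow_comp[OF rn Q H]] by simp
    then show "h \<circ> k \<in> N" using H perm_groupD(3)[OF H_group] by (simp add: N_def)
  qed
  moreover have "sl a 0 \<notin> N"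
  proof
    assume "sl a 0 \<in> N"
    then obtain y where y: "y ^ (n div r) = 1" "sl (a ^ b) 0 = sl y 0"
      by (auto simp: N_def cong_roots_def sl_funpow_scalar)
    have "a ^ b \<noteq> 0" using A_nonzero a_in_A by simp
    then have "(a ^ b) ^ (n div r) = 1" using y sl_eq_iff by simp
    then show False using gcd_div_prime[OF r rn rb a_in_A] a_not_root[OF r rn] by simp
  qed
  then have "N \<subset> H" using scalar_in_H[OF a_in_A] by (auto simp: N_def)
  ultimately obtain h v where h: "h \<in> H" "h \<notin> N" "v \<noteq> 0" "h v = v" using fixed_outside by blast
  obtain u i where "u \<noteq> 0" "h = sl u (s * i)" using sl_in_H_E[OF h(1)] .
  then have "h ^^ b = id" using h fixed_power_eq_id[of u i v b] by simp
  then show False using h cong_roots_refl by (simp add: N_def)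
qed

text \<open>When \<open>r\<close> divides \<open>b\<close>, the elements with exponent index
  divisible by \<open>r\<close> form a proper subgroup, which misses \<open>sl w s\<close>.\<close>

lemma ex_fixed_exponent:
  assumes r: "Factorial_Ring.prime r" and rb: "r dvd b"
  obtains u i v where "u \<noteq> 0" "sl u (s * i) \<in> H" "v \<noteq> 0" "sl u (s * i) v = v" "\<not> r dvd i"
proof -
  define K where "K = {sl u (s * i) | u i. u \<noteq> 0 \<and> sl u (s * i) \<in> H \<and> r dvd i}"
  have Ksub: "K \<subseteq> H" by (auto simp: K_def)
  have "perm_group K" unfolding perm_group_def
  proof (intro conjI ballI)
    show "id \<in> K"
      using perm_groupD(1)[OF H_group] sl_1_0 unfolding K_def
      by (intro CollectI exI[of _ 1] exI[of _ 0]) simp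
  next
    fix h assume "h \<in> K" then show "bij h" using Ksub perm_groupD(2)[OF H_group] by auto
  next
    fix h k assume "h \<in> K" "k \<in> K"
    then obtain u i v j where hk: "u \<noteq> 0" "v \<noteq> 0" "h = sl u (s * i)" "k = sl v (s * j)"
      "r dvd i" "r dvd j" "h \<in> H" "k \<in> H" by (auto simp: K_def)
    have "h \<circ> k = sl (u * v ^ p ^ (s * i)) (s * (i + j))" using hk by (simp add: sl_comp algebra_simps)
    moreover have "h \<circ> k \<in> H" using hk perm_groupD(3)[OF H_group] by simp
    ultimately show "h \<circ> k \<in> K" using hk unfolding K_def
      by (intro CollectI exI[of _ "u * v ^ p ^ (s * i)"] exI[of _ "i + j"]) simp
  qed
  moreover have "sl w s \<notin> K"
  proof
    assume "sl w s \<in> K"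
    then obtain u i where ui: "sl w s = sl u (s * i)" "r dvd i" by (auto simp: K_def)
    then have "[s * 1 = s * i] (mod f)" using sl_eq_iff[OF w_nonzero] by simp
    then have "[1 = i] (mod r)" using exponent_cong cong_dvd_modulus_nat rb by blast
    then have "r dvd 1" using ui(2) cong_dvd_iff by blast
    then show False using r by simp
  qed
  then have "K \<subset> H" using Ksub g_in_H by blast
  ultimately obtain h v where h: "h \<in> H" "h \<notin> K" "v \<noteq> 0" "h v = v" using fixed_outside by blast
  obtain u i where ui: "u \<noteq> 0" "h = sl u (s * i)" using sl_in_H_E[OF h(1)] .
  then have "\<not> r dvd i" using h by (auto simp: K_def)
  then show ?thesis using that[of u i v] ui h by simp
qed

text \<open>Otherwise \<open>\<theta> = (c g ^ i) ^ (b div r)\<close>, of order \<open>r\<close> modulo \<open>A\<close>, would be central in \<open>H\<close>: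
  its commutator with the generator \<open>g\<close> is a central \<open>r\<close>-th root of unity \<open>z\<close>, and
  \<open>z ^ i = 1\<close> because \<open>\<theta>\<close> is a power of \<open>c g ^ i\<close>. The fixed space of \<open>\<theta>\<close>
  would then be a proper nonzero submodule.\<close>

lemma power_not_cong_1:
  assumes r: "Factorial_Ring.prime r" and rb: "r dvd b"
    and s0: "u \<noteq> 0" "sl u (s * i) \<in> H" "v \<noteq> 0" "sl u (s * i) v = v" "\<not> r dvd i"
  shows "\<not> [Q ^ (i * (b div r)) = 1] (mod n)"
proof
  assume Q1: "[Q ^ (i * (b div r)) = 1] (mod n)"
  let ?g = "sl w s" and ?s0 = "sl u (s * i)"
  define \<theta> where "\<theta> = ?s0 ^^ (b div r)"
  have \<theta>H: "\<theta> \<in> H" unfolding \<theta>_def using perm_group_funpow[OF H_group s0(2)] .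
  obtain t where t: "t \<noteq> 0" "\<theta> = sl t (s * (i * (b div r)))"
  proof (rule that)
    show "u ^ (\<Sum>k<b div r. (p ^ (s * i)) ^ k) \<noteq> 0" using s0(1) by simp
  qed (simp add: \<theta>_def sl_funpow mult.assoc)
  have "(?s0 ^^ k) v = v" for k
    by (induction k) (simp_all add: s0)
  then have \<theta>v: "\<theta> v = v" unfolding \<theta>_def .
  have "b dvd i * (b div r) * r" using rb by (simp add: mult.assoc)
  then have \<theta>r: "\<theta> ^^ r = id"
    using fixed_power_eq_id[OF t(1), of "i * (b div r)" v r] \<theta>v s0(3) t(2) by simp
  \<comment> \<open>\<open>\<theta>\<close> acts on \<open>A\<close> by the power
    \<open>Q ^ (i * (b div r))\<close>, so the assumption \<open>Q1\<close> says that it centralizes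
    \<open>A\<close>.\<close>
  have \<theta>A: "\<theta> \<circ> sl y 0 = sl y 0 \<circ> \<theta>" if "y \<in> A" for y
    using A_power_cong[OF that Q1] unfolding t(2) sl_scalar p_power by simp
  have \<theta>kA: "\<theta> ^^ k \<circ> sl y 0 = sl y 0 \<circ> \<theta> ^^ k" if "y \<in> A" for y k
  proof (induction k)
    case (Suc k)
    have "\<theta> ^^ Suc k \<circ> sl y 0 = \<theta> \<circ> (\<theta> ^^ k \<circ> sl y 0)" by (simp add: comp_assoc)
    also have "\<dots> = (\<theta> \<circ> sl y 0) \<circ> \<theta> ^^ k" by (simp only: Suc comp_assoc)
    also have "\<dots> = sl y 0 \<circ> \<theta> ^^ Suc k" by (simp only: \<theta>A[OF that] comp_assoc funpow.simps)
    finally show ?case .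
  qed simp
  obtain z where z: "z \<in> A" "?g \<circ> \<theta> = sl z 0 \<circ> \<theta> \<circ> ?g"
  proof -
    let ?e = "s + s * (i * (b div r))"
    have e1: "?g \<circ> \<theta> = sl (w * t ^ p ^ s) ?e" unfolding t(2) by (simp add: sl_comp)
    have e2: "\<theta> \<circ> ?g = sl (t * w ^ p ^ (s * (i * (b div r)))) ?e" unfolding t(2) by (simp add: sl_comp add.commute)
    have "?g \<circ> \<theta> \<in> H" "\<theta> \<circ> ?g \<in> H" using perm_groupD(3)[OF H_group] g_in_H \<theta>H by auto
    then have "(w * t ^ p ^ s) / (t * w ^ p ^ (s * (i * (b div r)))) \<in> A" (is "?z \<in> A")
      unfolding e1 e2 using w_nonzero t(1) by (intro sl_div) auto
    moreover have "?g \<circ> \<theta> = sl ?z 0 \<circ> \<theta> \<circ> ?g"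
      unfolding comp_assoc e1 e2 using w_nonzero t(1) by (simp add: sl_comp)
    ultimately show ?thesis by (rule that)
  qed
  have z0: "z \<noteq> 0" using A_nonzero z by blast
  have g\<theta>: "?g \<circ> \<theta> ^^ k = sl (z ^ k) 0 \<circ> \<theta> ^^ k \<circ> ?g" for k
  proof (induction k)
    case (Suc k)
    have "?g \<circ> \<theta> ^^ Suc k = (?g \<circ> \<theta> ^^ k) \<circ> \<theta>" by (simp add: comp_assoc funpow_Suc_right del: funpow.simps)
    also have "\<dots> = sl (z ^ k) 0 \<circ> \<theta> ^^ k \<circ> (?g \<circ> \<theta>)" by (simp only: Suc comp_assoc)
    also have "\<dots> = sl (z ^ k) 0 \<circ> (\<theta> ^^ k \<circ> sl z 0) \<circ> \<theta> \<circ> ?g" by (simp only: z(2) comp_assoc)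
    also have "\<dots> = (sl (z ^ k) 0 \<circ> sl z 0) \<circ> (\<theta> ^^ k \<circ> \<theta>) \<circ> ?g" by (simp only: \<theta>kA[OF z(1)] comp_assoc)
    also have "\<dots> = sl (z ^ Suc k) 0 \<circ> \<theta> ^^ Suc k \<circ> ?g"
      by (simp add: sl_comp mult.commute funpow_Suc_right del: funpow.simps)
    finally show ?case .
  qed (simp add: sl_1_0)
  have zr: "z ^ r = 1"
  proof -
    have "?g = sl (z ^ r) 0 \<circ> ?g" using g\<theta>[of r] \<theta>r by simp
    then have "w = z ^ r * w" using sl_eq_iff[OF w_nonzero, of s "z ^ r * w" s] by (simp add: sl_comp)
    then show ?thesis using w_nonzero by simp
  qed
  \<comment> \<open>An \<open>r\<close>-th root of unity is fixed by
    \<open>x \<mapsto> x ^ Q\<close> if \<open>Q\<close> is 1 modulo \<open>r\<close>; if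
    \<open>r\<close> does not divide \<open>n\<close>, then \<open>A\<close> contains only the
    trivial one.\<close>
  have zQ: "z ^ Q = z"
  proof (cases "r dvd n")
    case True
    have "[Q = 1] (mod r)" using Q_cong_1[OF not_coverable r True] .
    moreover have "Q \<ge> 1" using p_gt_1 by (simp add: Q_def)
    ultimately obtain k where "Q = 1 + r * k" by (metis cong_altdef_nat dvdE le_add_diff_inverse)
    then show ?thesis using zr by (simp add: power_add power_mult)
  next
    case False
    then have "gcd r n = 1" using r by (simp add: prime_imp_coprime)
    then have "z = 1" using power_gcd_eq_1[OF zr power_n[OF z(1)]] by simp
    then show ?thesis by simp
  qed
  have gk\<theta>: "?g ^^ k \<circ> \<theta> = sl (z ^ k) 0 \<circ> \<theta> \<circ> ?g ^^ k" for k
  proof (induction k)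
    case (Suc k)
    have "?g ^^ Suc k \<circ> \<theta> = ?g \<circ> (?g ^^ k \<circ> \<theta>)" by (simp add: comp_assoc)
    also have "\<dots> = (?g \<circ> sl (z ^ k) 0) \<circ> \<theta> \<circ> ?g ^^ k" by (simp only: Suc comp_assoc)
    also have "?g \<circ> sl (z ^ k) 0 = sl (z ^ k) 0 \<circ> ?g"
    proof -
      have "(z ^ k) ^ Q = (z ^ Q) ^ k" by (simp add: mult.commute flip: power_mult)
      then show ?thesis using zQ by (simp add: sl_scalar Q_def)
    qed
    also have "sl (z ^ k) 0 \<circ> ?g \<circ> \<theta> \<circ> ?g ^^ k = sl (z ^ k) 0 \<circ> (?g \<circ> \<theta>) \<circ> ?g ^^ k"
      by (simp only: comp_assoc)
    also have "\<dots> = (sl (z ^ k) 0 \<circ> sl z 0) \<circ> \<theta> \<circ> (?g \<circ> ?g ^^ k)" by (simp only: z(2) comp_assoc)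
    also have "\<dots> = sl (z ^ Suc k) 0 \<circ> \<theta> \<circ> ?g ^^ Suc k" by (simp add: sl_comp mult.commute)
    finally show ?case .
  qed (simp add: sl_1_0)
  have z1: "z = 1"
  proof -
    obtain c where c: "c \<in> A" "?s0 = sl c 0 \<circ> ?g ^^ i" using decompose[OF s0(1,2)] .
    have "?s0 \<circ> \<theta> = sl c 0 \<circ> (?g ^^ i \<circ> \<theta>)" using c by (simp only: comp_assoc)
    also have "\<dots> = (sl c 0 \<circ> sl (z ^ i) 0) \<circ> \<theta> \<circ> ?g ^^ i" by (simp only: gk\<theta> comp_assoc)
    also have "\<dots> = sl (z ^ i) 0 \<circ> (sl c 0 \<circ> \<theta>) \<circ> ?g ^^ i" by (simp add: sl_comp mult.commute flip: comp_assoc)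
    also have "\<dots> = sl (z ^ i) 0 \<circ> (\<theta> \<circ> ?s0)" by (simp only: \<theta>A[OF c(1), symmetric] c(2) comp_assoc)
    also have "\<theta> \<circ> ?s0 = ?s0 \<circ> \<theta>" unfolding \<theta>_def by (metis funpow.simps(2) funpow_Suc_right)
    finally have e: "?s0 \<circ> \<theta> = sl (z ^ i) 0 \<circ> (?s0 \<circ> \<theta>)" .
    have "(?s0 \<circ> \<theta>) v = v" using \<theta>v s0 by simp
    then have "v = z ^ i * v" using fun_cong[OF e, of v] by (simp add: sl_def)
    then have "z ^ i = 1" using s0(3) by simp
    moreover have "gcd i r = 1" using s0(5) r by (metis coprime_commute coprime_imp_gcd_eq_1 prime_imp_coprime)
    ultimately show ?thesis using power_gcd_eq_1[of z i r] zr by simp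
  qed
  have \<theta>H_comm: "h \<circ> \<theta> = \<theta> \<circ> h" if h: "h \<in> H" for h
  proof -
    obtain u i where "u \<noteq> 0" "h = sl u (s * i)" using sl_in_H_E[OF h] .
    then obtain c where c: "c \<in> A" "h = sl c 0 \<circ> ?g ^^ i" using decompose[of u i] h by blast
    have "h \<circ> \<theta> = sl c 0 \<circ> (?g ^^ i \<circ> \<theta>)" using c by (simp only: comp_assoc)
    also have "\<dots> = (sl c 0 \<circ> \<theta>) \<circ> ?g ^^ i" using gk\<theta>[of i] z1 by (simp add: sl_1_0 comp_assoc)
    also have "\<dots> = \<theta> \<circ> h" by (simp only: \<theta>A[OF c(1), symmetric] c(2) comp_assoc)
    finally show ?thesis .
  qed
  let ?W = "{x. \<theta> x = x}"
  have "?W = {0} \<or> ?W = UNIV"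
  proof (rule irreducible)
    show "0 \<in> ?W" using t(2) by simp
    show "x + y \<in> ?W" if "x \<in> ?W" "y \<in> ?W" for x y using that t(2) by (simp add: sl_add)
    show "h x \<in> ?W" if "h \<in> H" "x \<in> ?W" for h x
      using fun_cong[OF \<theta>H_comm[OF that(1)], of x] that(2) by simp
  qed
  then have "?W = UNIV" using \<theta>v s0(3) by blast
  then have "\<theta> = id" by (simp add: fun_eq_iff set_eq_iff)
  then have "f dvd s * (i * (b div r))" using t sl_eq_id_iff by simp
  then have "b dvd i * (b div r)" using exponent_zero_iff by simp
  moreover have "b = r * (b div r)" "b div r > 0" using rb b_pos by (auto elim: dvdE)
  ultimately have "r * (b div r) dvd i * (b div r)" by simp
  then have "r dvd i" using \<open>b div r > 0\<close> by simp
  then show False using s0(5) by simp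
qed

end

section \<open>Comparison of the \<open>r\<close>-parts of \<open>n\<close> and
  \<open>b\<close>\<close>

context nonbasic_semilinear
begin

text \<open>Otherwise the number refuted by \<open>power_not_cong_1\<close> would be 1 modulo
  \<open>n\<close>: modulo \<open>n'\<close> because its \<open>r\<close>-th power is, and modulo
  \<open>r ^ k\<close> because it is a power of \<open>Q\<close> whose exponent contains r^(\<beta>
  - 1). In particular primes dividing \<open>b\<close> divide \<open>n\<close>.\<close>

lemma multiplicity_b_less_n:
  assumes r: "Factorial_Ring.prime r" and rb: "r dvd b"
    and b: "b = r ^ \<beta> * b'" "\<not> r dvd b'" and n: "n = r ^ k * n'" "\<not> r dvd n'"
  shows "\<beta> < k"
proof (rule ccontr)
  assume "\<not> \<beta> < k"
  then have k\<beta>: "k \<le> \<beta>" by simp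
  obtain u i v where s0: "u \<noteq> 0" "sl u (s * i) \<in> H" "v \<noteq> 0" "sl u (s * i) v = v" "\<not> r dvd i"
    using ex_fixed_exponent[OF r rb] .
  obtain \<beta>' where \<beta>': "\<beta> = Suc \<beta>'" using rb b by (cases \<beta>) auto
  have bdiv: "b div r = r ^ \<beta>' * b'" using b \<beta>' prime_gt_0_nat[OF r] by (simp add: mult.assoc)
  let ?Y = "Q ^ (i * (b div r))"
  have bd: "b div r * r = b" using rb by simp
  have "[(Q ^ b) ^ i = 1 ^ i] (mod n)" by (intro cong_pow Q_power_b_cong)
  moreover have "?Y ^ r = (Q ^ b) ^ i"
  proof -
    have "i * (b div r) * r = b * i" using bd by (simp add: mult.assoc)
    then show ?thesis by (simp only: flip: power_mult)
  qed
  ultimately have Yr: "[?Y ^ r = 1] (mod n)" by simp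
  have Q1: "[Q ^ m = 1] (mod q)" if "Factorial_Ring.prime q" "q dvd n" for q m
    using cong_pow[OF Q_cong_1[OF not_coverable that], of m] by simp
  have n': "[?Y = 1] (mod n')"
  proof (rule cong_1_of_power_cong_1[OF r n(2)])
    show "[?Y ^ r = 1] (mod n')" using cong_dvd_modulus_nat[OF Yr] n(1) by simp
    show "[?Y = 1] (mod q)" if "Factorial_Ring.prime q" "q dvd n'" for q
      using that n(1) by (intro Q1) auto
  qed
  have "[?Y = 1] (mod (r ^ k))"
  proof (cases k)
    case (Suc k')
    have "r dvd n" using n Suc by simp
    then have "[(Q ^ (i * b')) ^ r ^ \<beta>' = 1] (mod (r ^ Suc \<beta>'))"
      using r by (intro cong_1_power_prime_power Q1)
    moreover have "(Q ^ (i * b')) ^ r ^ \<beta>' = ?Y"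
      by (simp add: bdiv mult.assoc mult.commute[of b'] flip: power_mult)
    ultimately have "[?Y = 1] (mod (r ^ \<beta>))" using \<beta>' by simp
    then show ?thesis using k\<beta> le_imp_power_dvd cong_dvd_modulus_nat by blast
  qed simp
  moreover have "coprime (r ^ k) n'" using prime_imp_coprime[OF r n(2)] by simp
  ultimately have "[?Y = 1] (mod (r ^ k * n'))" using n' coprime_cong_mult_nat by blast
  then have "[?Y = 1] (mod n)" using n(1) by simp
  then show False using power_not_cong_1[OF r rb s0] by simp
qed

text \<open>The elements \<open>h\<close> whose \<open>b'\<close>-th power lies in \<open>A^r\<langle>s\<^sub>0\<rangle>\<close> form a proper
  subgroup, so some element with a nonzero fixed vector lies outside it. Its \<open>b'\<close>-th power is
  \<open>d s\<^sub>0 ^ (b' j)\<close> with \<open>d \<in> A - A^r\<close>; a power of this that is scalar must be trivial, which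
  is a divisibility condition on a geometric sum.\<close>

lemma ex_geometric_sum_dvd:
  assumes r: "Factorial_Ring.prime r" and rb: "r dvd b"
    and b: "b = r ^ \<beta> * b'" "\<not> r dvd b'" and n: "n = r ^ k * n'" "\<not> r dvd n'"
    and s0: "u \<noteq> 0" "sl u (s * i) \<in> H" "v \<noteq> 0" "sl u (s * i) v = v" "\<not> r dvd i"
  obtains t j where "t \<le> \<beta>" "\<not> r dvd j"
    "r ^ k dvd (\<Sum>m<r ^ (\<beta> - t). (Q ^ (i * b' * (r ^ t * j))) ^ m)"
proof -
  let ?s0 = "sl u (s * i)"
  have "k > 0" using multiplicity_b_less_n[OF r rb b n] by simp
  then have rn: "r dvd n" using n by simp
  have Q: "[Q = 1] (mod r)" using Q_cong_1[OF not_coverable r rn] .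
  have s0H: "?s0 ^^ m \<in> H" for m using perm_group_funpow[OF H_group s0(2)] .
  define N where "N = {h \<in> H. \<exists>j. cong_roots r (h ^^ b') (?s0 ^^ (b' * j))}"
  have "perm_group N" unfolding perm_group_def
  proof (intro conjI ballI)
    show "id \<in> N" using perm_groupD(1)[OF H_group] cong_roots_refl
      unfolding N_def by (intro CollectI conjI exI[of _ 0]) simp_all
  next
    fix h assume "h \<in> N" then show "bij h" using perm_groupD(2)[OF H_group] by (auto simp: N_def)
  next
    fix h k assume hk: "h \<in> N" "k \<in> N"
    then have H: "h \<in> H" "k \<in> H" by (auto simp: N_def)
    obtain j j' where j: "cong_roots r (h ^^ b') (?s0 ^^ (b' * j))" "cong_roots r (k ^^ b') (?s0 ^^ (b' * j'))"
      using hk by (auto simp: N_def)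
    have "cong_roots r (h ^^ b' \<circ> k ^^ b') (?s0 ^^ (b' * j) \<circ> ?s0 ^^ (b' * j'))"
      by (intro cong_roots_comp j s0H)
    then have "cong_roots r ((h \<circ> k) ^^ b') (?s0 ^^ (b' * (j + j')))"
      using cong_roots_trans[OF cong_roots_funpow_comp[OF rn Q H]] by (simp add: funpow_add distrib_left)
    then show "h \<circ> k \<in> N" using H perm_groupD(3)[OF H_group] by (auto simp: N_def)
  qed
  moreover have "sl a 0 \<notin> N"
  proof
    assume "sl a 0 \<in> N"
    then obtain y j where y: "y ^ (n div r) = 1" "sl (a ^ b') 0 = sl y 0 \<circ> ?s0 ^^ (b' * j)"
      by (auto simp: N_def cong_roots_def sl_funpow_scalar)
    have ab: "a ^ b' \<noteq> 0" using A_nonzero a_in_A by simp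
    have "sl (a ^ b') 0 = sl (y * u ^ (\<Sum>m<b' * j. (p ^ (s * i)) ^ m)) (s * (i * (b' * j)))"
      using y(2) by (simp add: sl_funpow sl_comp mult.assoc)
    then have "[0 = s * (i * (b' * j))] (mod f)" using sl_eq_iff[OF ab] by blast
    then have "f dvd s * (i * (b' * j))" using cong_0_iff cong_sym by blast
    then have "b dvd i * (b' * j)" using exponent_zero_iff by blast
    then have "?s0 ^^ (b' * j) = id" using fixed_power_eq_id[OF s0(1,4,3)] by simp
    then have "(a ^ b') ^ (n div r) = 1" using y sl_eq_iff[OF ab] by simp
    then show False using gcd_div_prime[OF r rn b(2) a_in_A] a_not_root[OF r rn] by simp
  qed
  then have "N \<subset> H" using scalar_in_H[OF a_in_A] by (auto simp: N_def)
  ultimately obtain h x where h: "h \<in> H" "h \<notin> N" "x \<noteq> 0" "h x = x" using fixed_outside by blast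
  obtain u1 i1 where u1: "u1 \<noteq> 0" "h = sl u1 (s * i1)" using sl_in_H_E[OF h(1)] .
  have cop: "coprime i (r ^ \<beta>)" using prime_imp_coprime[OF r s0(5)] by (simp add: coprime_commute)
  \<comment> \<open>With \<open>j = i' * i1\<close> the product \<open>i * j\<close> is
    \<open>i1\<close> modulo \<open>r ^ \<beta>\<close>. So \<open>h ^^ b'\<close> and
    \<open>?s0 ^^ (b' * j)\<close> have the same exponent modulo \<open>f\<close> and differ by a
    scalar \<open>d\<close>.\<close>
  then obtain i' where "[i * i' = 1] (mod (r ^ \<beta>))" using cong_solve_coprime_nat[OF cop] by auto
  then have "[i * i' * i1 = 1 * i1] (mod (r ^ \<beta>))" by (intro cong_mult cong_refl)
  then have "[b' * (i * (i' * i1)) = b' * i1] (mod (b' * r ^ \<beta>))"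
    by (simp add: cong_def mult.assoc flip: mult_mod_right)
  moreover have "b' * r ^ \<beta> = b" using b(1) by simp
  moreover define j where "j = i' * i1"
  ultimately have j: "[b' * (i * j) = b' * i1] (mod b)" by simp
  have "[s * (b' * (i * j)) = s * (b' * i1)] (mod (s * b))"
    using j by (simp add: cong_def flip: mult_mod_right)
  then have exps: "[s * i1 * b' = s * i * (b' * j)] (mod f)"
    unfolding f_eq by (simp add: cong_sym_eq mult.assoc mult.commute mult.left_commute)
  define x1 where "x1 = u1 ^ (\<Sum>m<b'. (p ^ (s * i1)) ^ m)"
  define x0 where "x0 = u ^ (\<Sum>m<b' * j. (p ^ (s * i)) ^ m)"
  have x1: "x1 \<noteq> 0" "h ^^ b' = sl x1 (s * i1 * b')" using u1 by (simp_all add: x1_def sl_funpow)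
  have x0: "x0 \<noteq> 0" "?s0 ^^ (b' * j) = sl x0 (s * i * (b' * j))" using s0 by (simp_all add: x0_def sl_funpow)
  define d where "d = x1 / x0"
  have dA: "d \<in> A" unfolding d_def
    using x1 x0 s0H[of "b' * j"] perm_group_funpow[OF H_group h(1), of b'] exps
    by (intro sl_div[of _ "s * i1 * b'" _ "s * i * (b' * j)"]) auto
  have hd: "h ^^ b' = sl d 0 \<circ> ?s0 ^^ (b' * j)"
    using x1 x0 exps sl_eq_iff[of x1 "s * i1 * b'" x1 "s * i * (b' * j)"] by (simp add: d_def sl_comp)
  have d1: "d ^ (n div r) \<noteq> 1"
  proof
    assume "d ^ (n div r) = 1"
    then have "cong_roots r (h ^^ b') (?s0 ^^ (b' * j))" unfolding cong_roots_def using hd by blast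
    then show False using h by (auto simp: N_def)
  qed
  have hx: "((h ^^ b') ^^ m) x = x" for m
  proof -
    have 1: "(h ^^ b') x = x" by (induction b') (simp_all add: h(4))
    then show ?thesis by (induction m) simp_all
  qed
  have scalar_fix: "y = 1" if "sl y 0 x = x" for y using that h(3) by (simp add: sl_def)
  \<comment> \<open>Only \<open>j\<close> modulo \<open>r ^ \<beta>\<close> matters; if it vanishes
    there, \<open>r ^ \<beta>\<close> itself serves as representative, which keeps
    \<open>t \<le> \<beta>\<close>.\<close>
  obtain t j' where tj: "t \<le> \<beta>" "\<not> r dvd j'" "[r ^ t * j' = j] (mod (r ^ \<beta>))"
  proof (cases "r ^ \<beta> dvd j")
    case True
    then have "[r ^ \<beta> * 1 = j] (mod (r ^ \<beta>))" by (simp add: cong_def mod_eq_0_iff_dvd)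
    moreover have "\<not> r dvd 1" using prime_gt_1_nat[OF r] by simp
    ultimately show ?thesis using that[of \<beta> 1] by blast
  next
    case False
    then have "j > 0" by (metis dvd_0_right gr0I)
    then obtain t j' where tj: "j = r ^ t * j'" "\<not> r dvd j'" using prime_power_decompose[OF r] by blast
    have "t \<le> \<beta>" using False tj by (metis dvd_mult2 le_imp_power_dvd nat_le_linear)
    then show ?thesis using that[of t j'] tj by simp
  qed
  define j1 where "j1 = r ^ t * j'"
  have "[b' * (i * j1) = b' * (i * j)] (mod b)"
  proof -
    have "[b' * j1 = b' * j] (mod (b' * r ^ \<beta>))"
      using tj(3) unfolding j1_def by (simp add: cong_def flip: mult_mod_right)
    then have "[b' * j1 * i = b' * j * i] (mod (b' * r ^ \<beta>))" by (rule cong_scalar_right)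
    then have "[b' * j1 * i = b' * j * i] (mod b)" using b(1) by (simp add: mult.commute)
    then show ?thesis by (simp add: mult.assoc mult.commute[of i])
  qed
  then have Qj: "[Q ^ (i * b' * j1) = Q ^ (i * b' * j)] (mod n)"
    by (intro Q_power_cong) (simp add: mult.assoc mult.left_commute)
  \<comment> \<open>At this power \<open>?s0 ^^ (b' * j)\<close> becomes trivial. Hence
    \<open>(h ^^ b') ^^ ?m\<close> is a scalar that fixes \<open>x \<noteq> 0\<close>, and its value
    \<open>d ^ ?S\<close> is 1.\<close>
  let ?m = "r ^ (\<beta> - t)"
  have "b dvd i * ((b' * j) * ?m)"
  proof -
    have "r ^ \<beta> dvd j1 * ?m" using tj(1) unfolding j1_def
      by (metis dvd_triv_left le_add_diff_inverse mult.assoc mult.commute power_add)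
    moreover have "[j1 * ?m = j * ?m] (mod (r ^ \<beta>))" using tj(3) unfolding j1_def
      by (intro cong_mult cong_refl)
    ultimately have "r ^ \<beta> dvd j * ?m" using cong_dvd_iff by blast
    then have "r ^ \<beta> * b' dvd (j * ?m) * b'" by (intro mult_dvd_mono dvd_refl)
    then have "b dvd (j * ?m) * b'" using b(1) by simp
    then have "b dvd i * ((j * ?m) * b')" by (rule dvd_mult)
    then show ?thesis by (simp add: mult.assoc mult.left_commute mult.commute)
  qed
  then have s0m: "?s0 ^^ ((b' * j) * ?m) = id" using fixed_power_eq_id[OF s0(1,4,3)] by simp
  let ?S = "\<Sum>m<?m. (p ^ (s * i * (b' * j))) ^ m"
  have "(h ^^ b') ^^ ?m = sl (d ^ ?S) 0 \<circ> (?s0 ^^ (b' * j)) ^^ ?m"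
    unfolding hd x0(2) by (rule scalar_comp_funpow)
  also have "(?s0 ^^ (b' * j)) ^^ ?m = id" using s0m by (simp add: funpow_mult mult.commute)
  finally have "sl (d ^ ?S) 0 x = x" using hx[of ?m] by simp
  then have dS: "d ^ ?S = 1" by (rule scalar_fix)
  have "p ^ (s * i * (b' * j)) = Q ^ (i * b' * j)" by (simp add: Q_def mult.assoc flip: power_mult)
  then have "[?S = (\<Sum>m<?m. (Q ^ (i * b' * j1)) ^ m)] (mod n)"
    using Qj by (intro cong_sum cong_pow) (simp add: cong_sym_eq)
  then have dS1: "d ^ (\<Sum>m<?m. (Q ^ (i * b' * j1)) ^ m) = 1" (is "d ^ ?S1 = 1")
    using A_power_cong[OF dA] dS by metis
  have "r ^ k dvd ?S1"
  proof (rule ccontr)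
    assume nd: "\<not> r ^ k dvd ?S1"
    \<comment> \<open>Without the full factor \<open>r ^ k\<close> in the sum, \<open>d\<close>
      would have order dividing \<open>n div r\<close> and lie in \<open>A^r\<close>.\<close>
    have "gcd n ?S1 dvd n div r"
      by (rule dvd_div_prime[OF r n(1)]) (use nd in \<open>auto dest: dvd_trans\<close>)
    moreover have "d ^ gcd n ?S1 = 1" using power_gcd_eq_1[OF power_n[OF dA] dS1] .
    ultimately have "d ^ (n div r) = 1" by (auto elim!: dvdE simp: power_mult)
    then show False using d1 by simp
  qed
  then show ?thesis using that[OF tj(1,2)] unfolding j1_def by simp
qed

text \<open>A sum of \<open>r ^ (\<beta> - t)\<close> terms is divisible by \<open>r ^ k\<close>
  with \<open>k > \<beta>\<close>, so the lifting lemma fails: \<open>r = 2\<close> and the ratio is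
  not 1 modulo 4. For \<open>t > 0\<close> the ratio would be the square of an odd number, so
  \<open>t = 0\<close>.\<close>

lemma odd_exponent_sum_dvd:
  assumes r: "Factorial_Ring.prime r" and rb: "r dvd b"
    and b: "b = r ^ \<beta> * b'" "\<not> r dvd b'" and n: "n = r ^ k * n'" "\<not> r dvd n'"
    and s0: "u \<noteq> 0" "sl u (s * i) \<in> H" "v \<noteq> 0" "sl u (s * i) v = v" "\<not> r dvd i"
  obtains j where "r = 2" "odd j" "2 ^ k dvd (\<Sum>m<2 ^ \<beta>. (Q ^ (i * b' * j)) ^ m)"
proof -
  obtain t j where tj: "t \<le> \<beta>" "\<not> r dvd j"
    "r ^ k dvd (\<Sum>m<r ^ (\<beta> - t). (Q ^ (i * b' * (r ^ t * j))) ^ m)"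
    using ex_geometric_sum_dvd[OF assms] .
  let ?U = "Q ^ (i * b' * (r ^ t * j))"
  have \<beta>k: "\<beta> < k" using multiplicity_b_less_n[OF r rb b n] .
  then have rn: "r dvd n" using n by simp
  have U1: "[?U = 1] (mod r)"
    using cong_pow[OF Q_cong_1[OF not_coverable r rn], of "i * b' * (r ^ t * j)"] by simp
  have "r ^ Suc (\<beta> - t) dvd r ^ k" using \<beta>k by (intro le_imp_power_dvd) simp
  then have "r ^ Suc (\<beta> - t) dvd (\<Sum>m<r ^ (\<beta> - t). ?U ^ m)" using tj(3) dvd_trans by blast
  then have bad: "\<not> (odd r \<or> [?U = 1] (mod 4))"
    using not_prime_power_dvd_geometric_sum[OF r U1] by blast
  then have r2: "r = 2" using r prime_odd_nat prime_ge_2_nat by (metis le_neq_implies_less)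
  have "t = 0"
  proof (rule ccontr)
    assume "t \<noteq> 0"
    then obtain t' where t: "t = Suc t'" by (cases t) auto
    let ?V = "Q ^ (i * b' * (r ^ t' * j))"
    have UV: "?U = ?V ^ 2"
      by (simp add: t r2 mult.assoc mult.left_commute mult.commute flip: power_mult)
    have "odd ?U" using U1 r2 by (simp only: cong_def odd_iff_mod_2_eq_one) simp
    then have "odd ?V" unfolding UV by simp
    then obtain c where "?V = 2 * c + 1" by (rule oddE)
    then have "?U = 1 + 4 * (c * c + c)" unfolding UV by (simp add: power2_eq_square algebra_simps)
    then have "?U mod 4 = 1" by simp
    then show False using bad by (simp add: cong_def)
  qed
  then show ?thesis using that[of j] r2 tj by simp
qed

end

section \<open>The shape of \<open>H\<close> and of the field\<close>

context nonbasic_semilinear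
begin

text \<open>For \<open>b = 1\<close> all elements of \<open>H\<close> are scalars, and the proper
  subgroup \<open>{id}\<close> contains all of them that fix a nonzero vector.\<close>

lemma b_gt_1: "b > 1"
proof (rule ccontr)
  assume "\<not> b > 1"
  then have b: "b = 1" using b_pos by simp
  have "perm_group {id}" by (simp add: perm_group_def)
  moreover have "{id} \<subset> H" using nontrivial perm_groupD(1)[OF H_group] by blast
  ultimately obtain h v where h: "h \<in> H" "h \<noteq> id" "v \<noteq> 0" "h v = v" using fixed_outside by blast
  obtain u i where "u \<noteq> 0" "h = sl u (s * i)" using sl_in_H_E[OF h(1)] .
  then have "h ^^ 1 = id" using h fixed_power_eq_id[of u i v 1] b by simp
  then show False using h by simp
qed

lemma prime_dvd_b_eq_2:
  assumes r: "Factorial_Ring.prime r" and rb: "r dvd b"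
  shows "r = 2"
proof -
  obtain \<beta> b' where b: "b = r ^ \<beta> * b'" "\<not> r dvd b'" using prime_power_decompose[OF r b_pos] .
  obtain k n' where n: "n = r ^ k * n'" "\<not> r dvd n'" using prime_power_decompose[OF r n_pos] .
  obtain u i v where s0: "u \<noteq> 0" "sl u (s * i) \<in> H" "v \<noteq> 0" "sl u (s * i) v = v" "\<not> r dvd i"
    using ex_fixed_exponent[OF r rb] .
  show ?thesis using odd_exponent_sum_dvd[OF r rb b n s0] by blast
qed

theorem stabilizer_structure:
  obtains k u v where "f = 2" "p mod 4 = 3" "s = 1" "b = 2" "n = 2 ^ k" "k \<ge> 2" "n dvd p + 1"
    "u \<noteq> 0" "sl u 1 \<in> H" "v \<noteq> 0" "sl u 1 v = v"
proof -
  obtain \<beta> where b: "b = 2 ^ \<beta>"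
    using two_power_if_prime_factors[OF b_pos] prime_dvd_b_eq_2 by blast
  obtain k where n: "n = 2 ^ k"
    using two_power_if_prime_factors[OF n_pos] prime_dvd_b_eq_2 prime_dvd_n_imp_dvd_b by metis
  have b2: "2 dvd b" using b b_gt_1 by (cases \<beta>) auto
  have bb: "b = 2 ^ \<beta> * 1" "\<not> 2 dvd (1::nat)" and nn: "n = 2 ^ k * 1" using b n by auto
  have \<beta>k: "\<beta> < k" using multiplicity_b_less_n[OF two_is_prime_nat b2 bb nn] by simp
  obtain u i v where s0: "u \<noteq> 0" "sl u (s * i) \<in> H" "v \<noteq> 0" "sl u (s * i) v = v" "\<not> 2 dvd i"
    using ex_fixed_exponent[OF two_is_prime_nat b2] .
  obtain j where j: "odd j" "2 ^ k dvd (\<Sum>m<2 ^ \<beta>. (Q ^ (i * 1 * j)) ^ m)"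
    using odd_exponent_sum_dvd[OF two_is_prime_nat b2 bb nn bb(2) s0] by blast
  let ?U = "Q ^ (i * j)"
  have sum: "2 ^ k dvd (\<Sum>m<2 ^ \<beta>. ?U ^ m)" using j(2) by simp
  have "k > 0" using \<beta>k by simp
  then have n2: "2 dvd n" using n by simp
  have Qodd: "odd Q"
    using Q_cong_1[OF not_coverable two_is_prime_nat n2] by (simp only: cong_def odd_iff_mod_2_eq_one) simp
  \<comment> \<open>For \<open>\<beta> \<ge> 2\<close> the number \<open>?M = b div 2\<close> is
    even, and the divisibility of the sum gives \<open>?U ^ ?M\<close> = 1 modulo \<open>n\<close>.
    This is the odd power \<open>?Y ^ j\<close> of a number with square 1, so \<open>?Y\<close> is 1
    itself, against \<open>power_not_cong_1\<close>.\<close>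
  have "\<beta> = 1"
  proof (rule ccontr)
    assume "\<beta> \<noteq> 1"
    moreover have "\<beta> \<noteq> 0" using b b_gt_1 by (metis less_irrefl power_0)
    ultimately obtain \<beta>' where \<beta>: "\<beta> = Suc (Suc \<beta>')" by (metis One_nat_def not0_implies_Suc)
    let ?M = "2 ^ Suc \<beta>'"
    have bM: "b = 2 * ?M" "b div 2 = ?M" using b \<beta> by simp_all
    have "2 ^ k dvd (\<Sum>m<2 * ?M. ?U ^ m)" using sum \<beta> by simp
    then have UM: "[?U ^ ?M = 1] (mod n)"
      unfolding n by (intro two_power_dvd_of_geometric_sum) (use Qodd in auto)
    let ?Y = "Q ^ (i * ?M)"
    have "[(Q ^ b) ^ i = 1 ^ i] (mod n)" by (intro cong_pow Q_power_b_cong)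
    then have Y2: "[?Y ^ 2 = 1] (mod n)" using bM(1) by (simp add: mult.commute mult.left_commute flip: power_mult)
    obtain c where c: "j = 2 * c + 1" using j(1) by (rule oddE)
    have "?U ^ ?M = ?Y ^ j" by (simp add: ac_simps flip: power_mult)
    also have "\<dots> = (?Y ^ 2) ^ c * ?Y" unfolding c by (simp only: power_add power_mult power_one_right)
    finally have "[?U ^ ?M = 1 ^ c * ?Y] (mod n)" using cong_mult[OF cong_pow[OF Y2, of c] cong_refl[of ?Y]] by simp
    then have "[?Y = 1] (mod n)" using UM by (metis cong_sym cong_trans mult_1 power_one)
    then show False using power_not_cong_1[OF two_is_prime_nat b2 s0] bM(2) by simp
  qed
  then have b: "b = 2" using b by simp
  have k2: "k \<ge> 2" using \<beta>k \<open>\<beta> = 1\<close> by simp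
  \<comment> \<open>The sum now has two terms. Since \<open>i * j\<close> is odd and
    \<open>b = 2\<close>, \<open>?U\<close> is \<open>Q\<close> modulo \<open>n\<close>, so
    \<open>n\<close> divides \<open>Q + 1\<close>: the generator inverts \<open>A\<close>.\<close>
  have "n dvd 1 + ?U" using sum \<open>\<beta> = 1\<close> n by (simp add: numeral_2_eq_2 lessThan_Suc)
  moreover have "odd (i * j)" using j(1) s0(5) by simp
  then have "[i * j = 1] (mod b)" unfolding b cong_def odd_iff_mod_2_eq_one by simp
  then have "[?U = Q ^ 1] (mod n)" by (rule Q_power_cong)
  then have "[1 + ?U = 1 + Q] (mod n)" by (intro cong_add) simp_all
  ultimately have nQ: "n dvd p ^ s + 1" using cong_dvd_iff[of "1 + ?U" "1 + Q" n] by (simp add: Q_def)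
  have k4: "2 ^ 2 dvd (2::nat) ^ k" using k2 by (intro le_imp_power_dvd)
  then have four: "4 dvd p ^ s + 1" using dvd_trans[OF k4 nQ[unfolded n]] by simp
  have podd: "odd p"
    using Qodd s_pos by (simp add: Q_def)
  \<comment> \<open>For even \<open>s\<close>, \<open>p ^ s\<close> is an odd square and
    \<open>p ^ s + 1\<close> is 2 modulo 4.\<close>
  have sodd: "odd s"
  proof
    assume "even s"
    then obtain c where "s = 2 * c" by blast
    then have e: "p ^ s = (p ^ c) ^ 2" by (simp add: mult.commute flip: power_mult)
    have "odd (p ^ c)" using podd by simp
    then obtain d where "p ^ c = 2 * d + 1" by (rule oddE)
    then have "p ^ s + 1 = 4 * (d * d + d) + 2" unfolding e by (simp add: power2_eq_square algebra_simps)
    then show False using four by presburger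
  qed
  have np: "n dvd p + 1"
    using two_power_dvd_Suc_base[OF podd sodd] nQ n by simp
  have "4 dvd p + 1" using dvd_trans[OF k4 np[unfolded n]] by simp
  then have p3: "p mod 4 = 3" by presburger
  have "sl u (s * i) = sl u s"
  proof -
    have "[i = 1] (mod 2)" using s0(5) unfolding cong_def odd_iff_mod_2_eq_one by simp
    then have "[s * i = s * 1] (mod (s * 2))" by (simp add: cong_def flip: mult_mod_right)
    then show ?thesis using sl_eq_iff[OF s0(1)] f_eq b by simp
  qed
  then have t: "sl u s \<in> H" "sl u s v = v" using s0 by simp_all
  \<comment> \<open>The subfield fixed by \<open>x \<mapsto> x ^ p ^ 2\<close> contains
    \<open>A\<close> because \<open>n\<close> divides \<open>p + 1\<close>. Its multiples of the
    fixed vector \<open>v\<close> form an \<open>H\<close>-submodule, so they fill the field;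
    applied to \<open>l * v\<close> this gives that \<open>f\<close> divides 2.\<close>
  let ?F = "{x::'a. x ^ p ^ 2 = x}"
  let ?W = "{x * v | x. x \<in> ?F}"
  have cF: "c \<in> ?F" if "c \<in> A" for c
  proof -
    have "int (p ^ 2) - 1 = int (p + 1) * (int p - 1)" by (simp add: power2_eq_square algebra_simps)
    moreover have "int n dvd int (p + 1)" using np by (simp only: int_dvd_int_iff)
    ultimately have "int n dvd int (p ^ 2) - int 1" by simp
    then have "[p ^ 2 = 1] (mod n)" by (simp only: cong_iff_dvd_diff flip: cong_int_iff)
    from A_power_cong[OF that this] show ?thesis by simp
  qed
  have "?W = {0} \<or> ?W = UNIV"
  proof (rule irreducible)
    show "0 \<in> ?W" using p_gt_1 by (intro CollectI exI[of _ 0]) simp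
  next
    fix x y assume "x \<in> ?W" "y \<in> ?W"
    then obtain x' y' where "x' \<in> ?F" "y' \<in> ?F" "x = x' * v" "y = y' * v" by blast
    then show "x + y \<in> ?W"
      by (intro CollectI exI[of _ "x' + y'"]) (simp add: frobenius_add algebra_simps)
  next
    fix h x assume h: "h \<in> H" and "x \<in> ?W"
    then obtain x' where x': "x' \<in> ?F" "x = x' * v" by blast
    have F_mult: "y * z \<in> ?F" if "y \<in> ?F" "z \<in> ?F" for y z using that by (simp add: power_mult_distrib)
    obtain y j where yj: "y \<noteq> 0" "h = sl y (s * j)" using sl_in_H_E[OF h] .
    \<comment> \<open>Compare \<open>h\<close> with the power of \<open>sl u s\<close> that has the
      same exponent: this power fixes \<open>v\<close>, and the quotient is a scalar in
      \<open>A\<close>.\<close>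
    have "\<exists>z \<in> ?F. h v = z * v"
    proof -
      define u' where "u' = u ^ (\<Sum>m<j. (p ^ s) ^ m)"
      have e: "sl u s ^^ j = sl u' (s * j)" unfolding u'_def by (rule sl_funpow)
      have "(sl u s ^^ j) v = v" by (induction j) (simp_all add: t)
      then have u': "u' \<noteq> 0" "sl u' (s * j) \<in> H" "sl u' (s * j) v = v"
        using perm_group_funpow[OF H_group t(1), of j] s0(1) unfolding e by (simp_all add: u'_def)
      have "h v = (y / u') * sl u' (s * j) v" using yj u'(1) by (simp add: sl_def)
      then have "y / u' \<in> A" "h v = (y / u') * v"
        using sl_div[of y "s * j" u' "s * j"] h yj u' by auto
      then show ?thesis using cF by blast
    qed
    then obtain z where z: "z \<in> ?F" "h v = z * v" by blast
    have "h x = x' ^ p ^ (s * j) * h v" using yj x' by (simp add: sl_def power_mult_distrib)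
    moreover have "x' ^ p ^ (s * j) \<in> ?F"
    proof -
      have "(x' ^ p ^ (s * j)) ^ p ^ 2 = (x' ^ p ^ 2) ^ p ^ (s * j)" by (simp only: mult.commute flip: power_mult)
      then show ?thesis using x' by simp
    qed
    ultimately have "h x = (x' ^ p ^ (s * j) * z) * v" "x' ^ p ^ (s * j) * z \<in> ?F"
      using z F_mult by (simp_all add: mult.assoc)
    then show "h x \<in> ?W" by blast
  qed
  moreover have "v \<in> ?W" by (intro CollectI exI[of _ 1]) simp
  ultimately have "?W = UNIV" using s0(3) by blast
  then have "l * v \<in> ?W" by blast
  then have "l ^ p ^ 2 = l ^ p ^ 0" using s0(3) by auto
  then have "[2 = 0] (mod f)" by (rule power_p_eq_imp_cong)
  then have "f dvd 2" by (simp add: cong_0_iff)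
  then have "f \<le> 2" by (intro dvd_imp_le) simp_all
  then have "s = 1" using f_eq b s_pos by simp
  then show ?thesis using that[of k u v] f_eq b n k2 np p3 s0 t by simp
qed

end

section \<open>Affine groups\<close>

lemma normal_sub_iff:
  fixes G :: "('a::finite \<Rightarrow> 'a) set"
  assumes G: "perm_group G"
  shows "N \<lhd> sub G \<longleftrightarrow> perm_group N \<and> N \<subseteq> G \<and> (\<forall>x\<in>G. \<forall>h\<in>N. x \<circ> h \<circ> finv x \<in> N)"
proof -
  have e: "x \<otimes>\<^bsub>sub G\<^esub> h \<otimes>\<^bsub>sub G\<^esub> inv\<^bsub>sub G\<^esub> x = x \<circ> h \<circ> finv x" if "x \<in> G" "h \<in> G" for x h
    using that perm_groupD[OF G] sub_inv[OF G] by (simp add: bij_comp bij_imp_bij_inv)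
  have "(\<forall>x\<in>G. \<forall>h\<in>N. x \<otimes>\<^bsub>sub G\<^esub> h \<otimes>\<^bsub>sub G\<^esub> inv\<^bsub>sub G\<^esub> x \<in> N) \<longleftrightarrow> (\<forall>x\<in>G. \<forall>h\<in>N. x \<circ> h \<circ> finv x \<in> N)"
    if "N \<subseteq> G"
    by (intro ball_cong refl) (use e that in \<open>metis subsetD\<close>)
  then show ?thesis
    unfolding group.normal_inv_iff[OF group_sub[OF G]] subgroup_sub_iff[OF G] by auto
qed

lemma iso_two_coverable:
  fixes G :: "('b, 'c) monoid_scheme" and K :: "('a::finite \<Rightarrow> 'a) set"
  assumes G: "group G" and K: "perm_group K" and iso: "G \<cong> sub K"
  shows "has_normal_covering G 2 \<longleftrightarrow> two_coverable K"
proof -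
  have K': "group (sub K)" using group_sub[OF K] .
  obtain \<phi> where \<phi>: "\<phi> \<in> iso G (sub K)" using iso by (auto simp: is_iso_def)
  obtain \<psi> where \<psi>: "\<psi> \<in> iso (sub K) G" using group.iso_sym[OF G iso] by (auto simp: is_iso_def)
  show ?thesis
    using has_normal_covering_2_iso[OF G K' \<phi>] has_normal_covering_2_iso[OF K' G \<psi>]
      has_normal_covering_sub_iff[OF K] by blast
qed

section \<open>The group G = V H and its normal subgroups\<close>

context semilinear_group
begin

definition affine_group :: "('a \<Rightarrow> 'a) set" where
  "affine_group = {\<lambda>x. h x + v | h v. h \<in> H}"

lemma H_0: "h \<in> H \<Longrightarrow> h 0 = 0"
  using H_semilinear sl_0 by metis

lemma H_add: "h \<in> H \<Longrightarrow> h (x + y) = h x + h y"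
  using H_semilinear sl_add by metis

lemma H_diff: "h \<in> H \<Longrightarrow> h (x - y) = h x - h y"
  using H_semilinear sl_diff by metis

lemma affine_groupI: "h \<in> H \<Longrightarrow> (\<lambda>x. h x + v) \<in> affine_group"
  unfolding affine_group_def by blast

lemma H_subset_affine: "H \<subseteq> affine_group"
  using affine_groupI[of _ 0] by auto

lemma translation_in_affine: "(\<lambda>x. x + v) \<in> affine_group"
  using affine_groupI[OF perm_groupD(1)[OF H_group], of v] by simp

lemma affine_groupE:
  assumes "g \<in> affine_group"
  obtains h v where "h \<in> H" "g = (\<lambda>x. h x + v)"
  using assms unfolding affine_group_def by blast

lemma affine_perm_group_sub:
  assumes K: "perm_group K" "K \<subseteq> H"
  shows "perm_group {\<lambda>x. h x + v | h v. h \<in> K}"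
  unfolding perm_group_def
proof (intro conjI ballI)
  show "id \<in> {\<lambda>x. h x + v | h v. h \<in> K}"
    using perm_groupD(1)[OF K(1)] by (intro CollectI exI[of _ id] exI[of _ 0]) auto
next
  fix g assume "g \<in> {\<lambda>x. h x + v | h v. h \<in> K}"
  then obtain h v where g: "h \<in> K" "g = (\<lambda>x. h x + v)" by blast
  have "inj h" using perm_groupD(2)[OF K(1) g(1)] by (simp add: bij_is_inj)
  then have "inj g" unfolding g(2) by (simp add: inj_def)
  then show "bij g" by (simp add: bij_def finite_UNIV_inj_surj)
next
  fix g g' assume "g \<in> {\<lambda>x. h x + v | h v. h \<in> K}" "g' \<in> {\<lambda>x. h x + v | h v. h \<in> K}"
  then obtain h v h' v' where g: "h \<in> K" "g = (\<lambda>x. h x + v)" "h' \<in> K" "g' = (\<lambda>x. h' x + v')" by blast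
  have "h \<in> H" using g K by auto
  then have "g \<circ> g' = (\<lambda>x. (h \<circ> h') x + (h v' + v))" using g by (auto simp: H_add add.assoc)
  then show "g \<circ> g' \<in> {\<lambda>x. h x + v | h v. h \<in> K}" using perm_groupD(3)[OF K(1) g(1,3)] by blast
qed

lemma affine_perm_group: "perm_group affine_group"
  unfolding affine_group_def by (rule affine_perm_group_sub[OF H_group order_refl])

lemma two_coverable_affineI:
  assumes K: "perm_group K" "K \<subset> H"
    and fixed: "\<And>h v. h \<in> H \<Longrightarrow> v \<noteq> 0 \<Longrightarrow> h v = v \<Longrightarrow> h \<in> K"
  shows "two_coverable affine_group"
proof -
  let ?L = "{\<lambda>x. h x + v | h v. h \<in> K}"
  have KH: "K \<subseteq> H" using K by auto
  have L: "?L \<subset> affine_group"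
  proof
    show "?L \<subseteq> affine_group" using KH affine_groupI by blast
    obtain h where h: "h \<in> H" "h \<notin> K" using K by blast
    have "h \<notin> ?L"
    proof
      assume "h \<in> ?L"
      then obtain k v where kv: "k \<in> K" "h = (\<lambda>x. k x + v)" by blast
      then have "v = 0" using H_0[OF h(1)] H_0[of k] KH by auto
      then show False using kv h by simp
    qed
    then show "?L \<noteq> affine_group" using h H_subset_affine by blast
  qed
  have "(\<lambda>x. x + 1) \<notin> H" using H_0[of "\<lambda>x. x + 1"] by auto
  then have H: "H \<subset> affine_group" using H_subset_affine translation_in_affine[of 1] by blast
  have "\<exists>x\<in>affine_group. x \<circ> g \<circ> finv x \<in> H \<union> ?L" if g: "g \<in> affine_group" for g
  proof -
    obtain h v where hv: "h \<in> H" "g = (\<lambda>x. h x + v)" using affine_groupE[OF g] .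
    show ?thesis
    proof (cases "h \<in> K")
      case True
      then have "id \<circ> g \<circ> finv id \<in> ?L" using hv by auto
      then show ?thesis using perm_groupD(1)[OF affine_perm_group] by blast
    next
      case False
      have "inj (\<lambda>x. x - h x)"
      proof (rule injI)
        fix x y assume e: "x - h x = y - h y"
        have "x - y = (x - h x) - (y - h y) + (h x - h y)" by simp
        then have "h x - h y = x - y" unfolding e by simp
        then have "h (x - y) = x - y" using H_diff[OF hv(1)] by simp
        then show "x = y" using fixed[OF hv(1), of "x - y"] False by auto
      qed
      then have "surj (\<lambda>x. x - h x)" by (simp add: finite_UNIV_inj_surj)
      \<comment> \<open>\<open>x0\<close> is a fixed point of \<open>g\<close>; the translation that
        moves it to 0 conjugates \<open>g\<close> to \<open>h\<close>.\<close>
      then obtain x0 where x0: "v = x0 - h x0" by (rule surjE)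
      let ?t = "\<lambda>x. x + (- x0)"
      have t: "?t \<in> affine_group" by (rule translation_in_affine)
      have "?t \<circ> g = h \<circ> ?t" using hv x0 H_diff[OF hv(1)] by (auto simp: fun_eq_iff)
      then have "?t \<circ> g \<circ> finv ?t = h"
        using perm_groupD(2)[OF affine_perm_group t] by (intro conj_eqI)
      then show ?thesis using t hv(1) by (intro bexI[of _ ?t]) auto
    qed
  qed
  then show ?thesis unfolding two_coverable_def
    using H_group H affine_perm_group_sub[OF K(1) KH] L by blast
qed

text \<open>In characteristic \<open>p\<close> the negative is a \<open>(p - 1)\<close>-fold sum, so
  closure under addition suffices in the definition of a submodule.\<close>

lemma uminus_closed:
  assumes "0 \<in> W" "\<And>x y. x \<in> W \<Longrightarrow> y \<in> W \<Longrightarrow> x + y \<in> W" "x \<in> W"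
  shows "- x \<in> (W :: 'a set)"
proof -
  have "of_nat k * x \<in> W" for k
    by (induction k) (use assms in \<open>auto simp: distrib_right\<close>)
  then have "of_nat (p - 1) * x \<in> W" .
  moreover have "of_nat p = (0::'a)" using of_nat_CHAR[where 'a = 'a] char_field by simp
  then have "of_nat (p - 1) = (- 1 :: 'a)" using p_gt_1 by (simp add: of_nat_diff)
  ultimately show ?thesis by simp
qed

text \<open>G permutes the additive cosets of an \<open>H\<close>-submodule, which makes the
  submodule a block.\<close>

lemma irreducible_if_primitive:
  assumes prim: "primitive affine_group"
    and W: "0 \<in> W" "\<And>x y. x \<in> W \<Longrightarrow> y \<in> W \<Longrightarrow> x + y \<in> W" "\<And>h x. h \<in> H \<Longrightarrow> x \<in> W \<Longrightarrow> h x \<in> W"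
  shows "W = {0} \<or> W = UNIV"
proof -
  have "g ` W = W \<or> g ` W \<inter> W = {}" if g: "g \<in> affine_group" for g
  proof -
    obtain h v where hv: "h \<in> H" "g = (\<lambda>x. h x + v)" using affine_groupE[OF g] .
    show ?thesis
    proof (cases "v \<in> W")
      case True
      then have "g ` W \<subseteq> W" using hv W by auto
      moreover have "inj_on g W"
        using perm_groupD(2)[OF affine_perm_group g] by (meson bij_is_inj inj_on_subset subset_UNIV)
      ultimately have "g ` W = W" by (intro endo_inj_surj) auto
      then show ?thesis ..
    next
      case False
      have "h x + v \<notin> W" if "x \<in> W" for x
      proof
        assume "h x + v \<in> W"
        moreover have "- h x \<in> W" using uminus_closed[OF W(1,2)] W(3)[OF hv(1) that] by blast
        ultimately have "h x + v + - h x \<in> W" by (rule W(2))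
        then show False using False by simp
      qed
      then show ?thesis using hv by auto
    qed
  qed
  then have "W \<noteq> {} \<and> (\<forall>g\<in>affine_group. g ` W = W \<or> g ` W \<inter> W = {})" using W(1) by auto
  then have "(\<exists>x. W = {x}) \<or> W = UNIV" using prim unfolding primitive_def by metis
  then show ?thesis using W(1) by auto
qed

lemma translation_conj:
  assumes "g \<in> affine_group"
  obtains h where "h \<in> H" "\<And>v. g \<circ> (\<lambda>x. x + v) \<circ> finv g = (\<lambda>x. x + h v)" "g = (\<lambda>x. h x + g 0)"
proof -
  obtain h w where hw: "h \<in> H" "g = (\<lambda>x. h x + w)" using affine_groupE[OF assms] .
  have "g \<circ> (\<lambda>x. x + v) \<circ> finv g = (\<lambda>x. x + h v)" for v
  proof (rule conj_eqI)
    show "bij g" using perm_groupD(2)[OF affine_perm_group assms] .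
    show "g \<circ> (\<lambda>x. x + v) = (\<lambda>x. x + h v) \<circ> g"
      unfolding hw(2) by (auto simp: H_add[OF hw(1)] algebra_simps)
  qed
  then show ?thesis using that[of h] hw H_0[OF hw(1)] by simp
qed

lemma perm_group_translation: "perm_group (translation_group :: ('a \<Rightarrow> 'a) set)"
  unfolding perm_group_def translation_group_def
proof (intro conjI ballI)
  show "id \<in> range (\<lambda>v x. x + v :: 'a)" by (intro range_eqI[of _ _ 0]) auto
next
  fix g assume "g \<in> range (\<lambda>v x. x + v :: 'a)"
  then show "bij g" using translation_in_affine perm_groupD(2)[OF affine_perm_group] by auto
next
  fix g g' assume "g \<in> range (\<lambda>v x. x + v :: 'a)" "g' \<in> range (\<lambda>v x. x + v :: 'a)"
  then obtain v v' where "g = (\<lambda>x. x + v)" "g' = (\<lambda>x. x + v')" by blast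
  then show "g \<circ> g' \<in> range (\<lambda>v x. x + v :: 'a)" by (intro range_eqI[of _ _ "v' + v"]) (auto simp: add.assoc)
qed

lemma translation_subset: "translation_group \<subseteq> affine_group"
  using translation_in_affine by (auto simp: translation_group_def)

lemma translation_normal: "translation_group \<lhd> sub affine_group"
  unfolding normal_sub_iff[OF affine_perm_group]
proof (intro conjI ballI perm_group_translation translation_subset)
  fix g t assume g: "g \<in> affine_group" and "t \<in> (translation_group :: ('a \<Rightarrow> 'a) set)"
  then obtain v where "t = (\<lambda>x. x + v)" by (auto simp: translation_group_def)
  moreover obtain h where "\<And>v. g \<circ> (\<lambda>x. x + v) \<circ> finv g = (\<lambda>x. x + h v)"
    using translation_conj[OF g] by blast
  ultimately show "g \<circ> t \<circ> finv g \<in> translation_group" by (auto simp: translation_group_def)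
qed

text \<open>A normal subgroup of G inside V is the same as an \<open>H\<close>-submodule.\<close>

lemma translation_minimal_normal:
  assumes prim: "primitive affine_group"
  shows "minimal_normal translation_group (sub affine_group)"
proof -
  have one: "\<one>\<^bsub>sub affine_group\<^esub> = id" by simp
  have "(\<lambda>x. x + 1 :: 'a) \<noteq> id" by (auto simp: fun_eq_iff)
  then have ne: "translation_group \<noteq> {id :: 'a \<Rightarrow> 'a}" by (auto simp: translation_group_def)
  have "K = {id} \<or> K = translation_group" if K: "K \<lhd> sub affine_group" "K \<subseteq> translation_group" for K
  proof -
    have Kg: "perm_group K" "\<And>x h. x \<in> affine_group \<Longrightarrow> h \<in> K \<Longrightarrow> x \<circ> h \<circ> finv x \<in> K"
      using K(1) normal_sub_iff[OF affine_perm_group] by auto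
    let ?W = "{v. (\<lambda>x. x + v) \<in> K}"
    have "?W = {0} \<or> ?W = UNIV"
    proof (rule irreducible_if_primitive[OF prim])
      show "0 \<in> ?W" using perm_groupD(1)[OF Kg(1)] by (simp add: id_def)
    next
      fix v w assume "v \<in> ?W" "w \<in> ?W"
      then have "(\<lambda>x. x + w) \<circ> (\<lambda>x. x + v) \<in> K" using perm_groupD(3)[OF Kg(1)] by simp
      then show "v + w \<in> ?W" by (simp add: comp_def add.assoc)
    next
      fix h v assume h: "h \<in> H" and "v \<in> ?W"
      then have *: "h \<circ> (\<lambda>x. x + v) \<circ> finv h \<in> K" using Kg(2) H_subset_affine by blast
      have "h \<circ> (\<lambda>x. x + v) \<circ> finv h = (\<lambda>x. x + h v)"
        by (rule conj_eqI) (use perm_groupD(2)[OF H_group h] H_add[OF h] in auto)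
      then show "h v \<in> ?W" using * by simp
    qed
    moreover have "K = (\<lambda>v x. x + v) ` ?W" using K(2) by (auto simp: translation_group_def)
    ultimately show ?thesis by (auto simp: translation_group_def id_def)
  qed
  then show ?thesis unfolding minimal_normal_def one using translation_normal ne by blast
qed

text \<open>If N meets V trivially, commutators of N and V lie in both and vanish, so N centralizes
  V. An affine map that commutes with all translations is a translation; hence N \<subseteq> V in
  any case.\<close>

lemma minimal_normal_unique:
  assumes prim: "primitive affine_group" and N: "minimal_normal N (sub affine_group)"
  shows "N = translation_group"
proof -
  let ?V = "translation_group :: ('a \<Rightarrow> 'a) set"
  have one: "\<one>\<^bsub>sub affine_group\<^esub> = id" by simp
  have NN: "N \<lhd> sub affine_group" "N \<noteq> {id}"
    "\<And>K. K \<lhd> sub affine_group \<Longrightarrow> K \<subseteq> N \<Longrightarrow> K = {id} \<or> K = N"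
    using N unfolding minimal_normal_def one by auto
  have VV: "\<And>K. K \<lhd> sub affine_group \<Longrightarrow> K \<subseteq> ?V \<Longrightarrow> K = {id} \<or> K = ?V"
    using translation_minimal_normal[OF prim] unfolding minimal_normal_def one by auto
  have Ng: "perm_group N" "N \<subseteq> affine_group" "\<And>x h. x \<in> affine_group \<Longrightarrow> h \<in> N \<Longrightarrow> x \<circ> h \<circ> finv x \<in> N"
    using NN(1) normal_sub_iff[OF affine_perm_group] by auto
  have NV: "N \<inter> ?V \<lhd> sub affine_group"
    using group.normal_subgroup_intersect[OF group_sub[OF affine_perm_group] NN(1) translation_normal] .
  have "N \<subseteq> ?V"
  proof (cases "N \<inter> ?V = {id}")
    case True
    show ?thesis
    proof
      fix g assume g: "g \<in> N"
      obtain h where h: "h \<in> H" "\<And>v. g \<circ> (\<lambda>x. x + v) \<circ> finv g = (\<lambda>x. x + h v)" "g = (\<lambda>x. h x + g 0)"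
        using translation_conj[of g] g Ng(2) by blast
      have "h v = v" for v
      proof -
        let ?t = "\<lambda>x. x + v :: 'a"
        have t: "?t \<in> affine_group" by (rule translation_in_affine)
        have ti: "finv ?t = (\<lambda>x. x + (- v))" by (rule inv_equality) auto
        have "g \<circ> (?t \<circ> finv g \<circ> finv ?t) \<in> N"
          using Ng(3)[OF t perm_group_inv[OF Ng(1) g]] perm_groupD(3)[OF Ng(1) g] by blast
        moreover have "g \<circ> (?t \<circ> finv g \<circ> finv ?t) = (g \<circ> ?t \<circ> finv g) \<circ> finv ?t" by (simp only: comp_assoc)
        moreover have "\<dots> = (\<lambda>x. x + (h v - v))" unfolding h(2) ti by (auto simp: fun_eq_iff algebra_simps)
        ultimately have "(\<lambda>x. x + (h v - v)) \<in> N \<inter> ?V" by (auto simp: translation_group_def)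
        then have "(\<lambda>x. x + (h v - v)) = id" using True by blast
        then show ?thesis by (metis add_0 eq_iff_diff_eq_0 id_apply)
      qed
      then have "g = (\<lambda>x. x + g 0)" using h(3) by simp
      then show "g \<in> ?V" unfolding translation_group_def by blast
    qed
  next
    case False
    then have "N \<inter> ?V = N" using NN(3)[OF NV] by blast
    then show ?thesis by blast
  qed
  then show ?thesis using VV[OF NN(1)] NN(2) by blast
qed

text \<open>The projection of G onto \<open>H\<close> with kernel V, written without a choice of
  decomposition.\<close>

definition linear_part :: "('a \<Rightarrow> 'a) \<Rightarrow> 'a \<Rightarrow> 'a" where
  "linear_part g = (\<lambda>x. g x - g 0)"

lemma linear_part_affine: "h \<in> H \<Longrightarrow> linear_part (\<lambda>x. h x + v) = h"
  using H_0 by (auto simp: linear_part_def)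

lemma linear_part_in_H: "g \<in> affine_group \<Longrightarrow> linear_part g \<in> H"
  using linear_part_affine by (auto simp: affine_group_def)

lemma linear_part_image: "linear_part ` affine_group = H"
proof
  show "linear_part ` affine_group \<subseteq> H" using linear_part_in_H by blast
  show "H \<subseteq> linear_part ` affine_group"
  proof
    fix h assume h: "h \<in> H"
    have "h = linear_part (\<lambda>x. h x + 0)" using linear_part_affine[OF h, of 0] by simp
    then show "h \<in> linear_part ` affine_group" using affine_groupI[OF h] by blast
  qed
qed

lemma linear_part_comp:
  assumes g: "g \<in> affine_group"
  shows "linear_part (g \<circ> g') = linear_part g \<circ> linear_part g'"
proof -
  obtain h v where hv: "h \<in> H" "g = (\<lambda>x. h x + v)" using affine_groupE[OF g] .
  show ?thesis unfolding hv(2) linear_part_affine[OF hv(1)] using H_diff[OF hv(1)]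
    by (simp add: linear_part_def fun_eq_iff)
qed

lemma quotient_iso: "(sub affine_group Mod translation_group) \<cong> sub H"
proof -
  let ?\<pi> = linear_part
  have bij: "g \<in> affine_group \<Longrightarrow> bij g" for g using perm_groupD(2)[OF affine_perm_group] .
  have bijH: "g \<in> H \<Longrightarrow> bij g" for g using perm_groupD(2)[OF H_group] .
  interpret h: group_hom "sub affine_group" "sub H" ?\<pi>
  proof (intro group_hom.intro group_hom_axioms.intro group_sub affine_perm_group H_group homI)
    fix g assume "g \<in> carrier (sub affine_group)"
    then show "?\<pi> g \<in> carrier (sub H)" using linear_part_in_H by simp
  next
    fix g g' assume "g \<in> carrier (sub affine_group)" "g' \<in> carrier (sub affine_group)"
    then have g: "g \<in> affine_group" "g' \<in> affine_group" by simp_all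
    then have "?\<pi> g \<in> H" "?\<pi> g' \<in> H" using linear_part_in_H g by simp_all
    then show "?\<pi> (g \<otimes>\<^bsub>sub affine_group\<^esub> g') = ?\<pi> g \<otimes>\<^bsub>sub H\<^esub> ?\<pi> g'"
      using linear_part_comp[OF g(1)] bij[OF g(1)] bij[OF g(2)] bijH by simp
  qed
  have "kernel (sub affine_group) (sub H) ?\<pi> = translation_group"
  proof
    show "kernel (sub affine_group) (sub H) ?\<pi> \<subseteq> translation_group"
    proof
      fix g assume "g \<in> kernel (sub affine_group) (sub H) ?\<pi>"
      then have g: "g \<in> affine_group" "?\<pi> g = id" by (auto simp: kernel_def)
      obtain h v where hv: "h \<in> H" "g = (\<lambda>x. h x + v)" using affine_groupE[OF g(1)] .
      then have "g = (\<lambda>x. x + v)" using g(2) linear_part_affine by auto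
      then show "g \<in> translation_group" by (auto simp: translation_group_def)
    qed
    show "translation_group \<subseteq> kernel (sub affine_group) (sub H) ?\<pi>"
      using translation_subset by (auto simp: kernel_def translation_group_def linear_part_def)
  qed
  then show ?thesis using h.FactGroup_iso linear_part_image by simp
qed

theorem non_basic_iff:
  assumes prim: "primitive affine_group"
  shows "non_basic (sub affine_group) \<longleftrightarrow> \<not> two_coverable H \<and> \<not> two_coverable affine_group"
proof -
  let ?G = "sub affine_group" and ?V = "translation_group :: ('a \<Rightarrow> 'a) set"
  have G: "group ?G" by (rule group_sub[OF affine_perm_group])
  have fin: "finite (carrier ?G)" by simp
  have Q: "group (?G Mod ?V)" using normal.factorgroup_is_group[OF translation_normal] .
  have finQ: "finite (carrier (?G Mod ?V))" unfolding carrier_FactGroup using fin by simp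
  have 1: "normal_covering_number (?G Mod ?V) = 2 \<longleftrightarrow> two_coverable H"
    using group.normal_covering_number_eq_2_iff[OF Q finQ] iso_two_coverable[OF Q H_group quotient_iso] by simp
  have 2: "normal_covering_number ?G = 2 \<longleftrightarrow> two_coverable affine_group"
    using group.normal_covering_number_eq_2_iff[OF G fin] has_normal_covering_sub_iff[OF affine_perm_group] by simp
  have comm: "comm_group (?G\<lparr>carrier := ?V\<rparr>)"
  proof -
    have "group (sub ?V)" using group_sub[OF perm_group_translation] .
    moreover have "x \<otimes>\<^bsub>sub ?V\<^esub> y = y \<otimes>\<^bsub>sub ?V\<^esub> x" if "x \<in> carrier (sub ?V)" "y \<in> carrier (sub ?V)" for x y
    proof -
      have "bij x" "bij y" using that perm_groupD(2)[OF perm_group_translation] by auto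
      moreover have "x \<circ> y = y \<circ> x" using that by (auto simp: translation_group_def algebra_simps)
      ultimately show ?thesis by simp
    qed
    ultimately have "comm_group (sub ?V)" by (rule group.group_comm_groupI)
    then show ?thesis by simp
  qed
  show ?thesis unfolding non_basic_def
    using G fin translation_minimal_normal[OF prim] minimal_normal_unique[OF prim] comm 1 2 by metis
qed

end

section \<open>Dihedral stabilizers\<close>

context semilinear_group
begin

lemma A_eq_powers_a: "A = range (\<lambda>i. a ^ i)"
proof
  show "A \<subseteq> range (\<lambda>i. a ^ i)"
  proof
    fix x assume x: "x \<in> A"
    obtain j where j: "x = l ^ j" using l_generates A_nonzero[OF x] by blast
    obtain d where d: "p ^ f - 1 = n * d" using n_dvd by blast
    have "l ^ (j * n) = 1" using power_n[OF x] j by (simp add: power_mult)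
    then have "n * d dvd n * j" using d by (simp add: l_power_eq_1_iff mult.commute)
    then obtain i where "j = d * i" using n_pos by (auto simp: dvd_def)
    then have "x = a ^ i" using j d n_pos by (simp add: a_def power_mult)
    then show "x \<in> range (\<lambda>i. a ^ i)" by blast
  qed
  show "range (\<lambda>i. a ^ i) \<subseteq> A" using power_in_A a_in_A by blast
qed

lemma quadratic_decomposition:
  assumes f: "f = 2" and t: "t \<noteq> 0" "sl t 1 \<in> H"
  shows "H = (\<lambda>u. sl u 0) ` A \<union> (\<lambda>u. sl (u * t) 1) ` A" and "card H = 2 * n"
proof -
  let ?B = "(\<lambda>u. sl u 0) ` A" and ?C = "(\<lambda>u. sl (u * t) 1) ` A"
  have "h \<in> ?B \<union> ?C" if h: "h \<in> H" for h
  proof -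
    obtain u j where u: "u \<noteq> 0" "h = sl u j" using H_semilinearE[OF h] .
    show ?thesis
    proof (cases "even j")
      case True
      then have "h = sl u 0" using u sl_eq_iff[of u j u 0] f by (simp add: cong_0_iff)
      then show ?thesis using h u by (auto simp: A_def)
    next
      case False
      then have "[j = 1] (mod f)" unfolding f cong_def odd_iff_mod_2_eq_one by simp
      then have h1: "h = sl u 1" using u sl_eq_iff[of u j u 1] by simp
      then have "u / t \<in> A" using sl_div[of u 1 t 1] h u t by simp
      moreover have "h = sl (u / t * t) 1" using h1 t by simp
      ultimately show ?thesis by blast
    qed
  qed
  moreover have "?B \<union> ?C \<subseteq> H" using A_sl[OF _ t(2)] by (auto simp: A_def)
  ultimately show H: "H = ?B \<union> ?C" by blast
  have "inj_on (\<lambda>u. sl u 0) A" "inj_on (\<lambda>u. sl (u * t) 1) A"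
    using A_nonzero t by (auto simp: inj_on_def sl_eq_iff)
  then have "card ?B = n" "card ?C = n" by (simp_all add: card_image n_def)
  moreover have "?B \<inter> ?C = {}"
    using A_nonzero f by (auto simp: sl_eq_iff cong_def)
  moreover have "finite ?B" "finite ?C" by simp_all
  ultimately show "card H = 2 * n" using card_Un_disjoint[of ?B ?C] H by simp
qed

end

section \<open>Explicit dihedral groups of semilinear maps\<close>

context semilinear
begin

text \<open>Rotations and reflections generated by \<open>sl d 0\<close> and \<open>sl t 1\<close>.
  For \<open>f = 2\<close>, the condition \<open>t ^ (p + 1) = 1\<close>, norm 1 over the prime
  field, makes \<open>sl t 1\<close> an involution.\<close>

definition dihedral_maps :: "'a \<Rightarrow> 'a \<Rightarrow> ('a \<Rightarrow> 'a) set" where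
  "dihedral_maps d t = (\<lambda>i. sl (d ^ i) 0) ` UNIV \<union> (\<lambda>i. sl (d ^ i * t) 1) ` UNIV"

text \<open>Once \<open>d ^ (p + 1) = 1\<close>, the exponent \<open>p * j\<close> stands for -j,
  and these are the dihedral relations.\<close>

lemma dihedral_maps_comp:
  assumes "f = 2" "d \<noteq> 0" "t ^ (p + 1) = 1"
  shows "sl (d ^ i) 0 \<circ> sl (d ^ j) 0 = sl (d ^ (i + j)) 0"
    "sl (d ^ i) 0 \<circ> sl (d ^ j * t) 1 = sl (d ^ (i + j) * t) 1"
    "sl (d ^ i * t) 1 \<circ> sl (d ^ j) 0 = sl (d ^ (i + p * j) * t) 1"
    "sl (d ^ i * t) 1 \<circ> sl (d ^ j * t) 1 = sl (d ^ (i + p * j)) 0"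
proof -
  show "sl (d ^ i) 0 \<circ> sl (d ^ j) 0 = sl (d ^ (i + j)) 0" by (simp add: sl_comp power_add)
  show "sl (d ^ i) 0 \<circ> sl (d ^ j * t) 1 = sl (d ^ (i + j) * t) 1"
    by (simp add: sl_comp power_add mult.assoc)
  show "sl (d ^ i * t) 1 \<circ> sl (d ^ j) 0 = sl (d ^ (i + p * j) * t) 1"
    by (simp add: sl_comp power_add ac_simps flip: power_mult)
  have "(d ^ i * t) * (d ^ j * t) ^ p ^ 1 = d ^ (i + p * j) * t ^ (p + 1)"
    by (simp add: power_mult_distrib power_add ac_simps flip: power_mult)
  then have "sl (d ^ i * t) 1 \<circ> sl (d ^ j * t) 1 = sl (d ^ (i + p * j)) 2"
    unfolding sl_comp assms(3) by (simp add: numeral_2_eq_2)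
  also have "\<dots> = sl (d ^ (i + p * j)) 0" using assms(1,2) by (simp add: sl_eq_iff cong_def)
  finally show "sl (d ^ i * t) 1 \<circ> sl (d ^ j * t) 1 = sl (d ^ (i + p * j)) 0" .
qed

lemma perm_group_dihedral_maps:
  assumes "f = 2" "d \<noteq> 0" "t ^ (p + 1) = 1"
  shows "perm_group (dihedral_maps d t)"
  unfolding perm_group_def
proof (intro conjI ballI)
  show "id \<in> dihedral_maps d t" unfolding dihedral_maps_def
    by (intro UnI1 image_eqI[of _ _ 0]) (simp_all add: sl_1_0)
next
  have "t \<noteq> 0" using assms(3) by auto
  then show "bij h" if "h \<in> dihedral_maps d t" for h
    using that assms(2) by (auto simp: dihedral_maps_def intro!: sl_bij)
next
  fix h k assume "h \<in> dihedral_maps d t" "k \<in> dihedral_maps d t"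
  then show "h \<circ> k \<in> dihedral_maps d t"
    unfolding dihedral_maps_def
    by (elim UnE imageE; simp only: dihedral_maps_comp[OF assms]) blast+
qed

lemma scal_eq_sl: "scal c = sl c 0"
  by (simp add: scal_def sl_def)

lemma frob_eq_sl: "frob p = sl 1 1"
  by (simp add: frob_def sl_def)

lemma generate_frob_scal:
  assumes f: "f = 2" and d: "d \<noteq> 0"
  shows "generate Sym {frob p, scal d} = dihedral_maps d 1"
proof
  have D: "perm_group (dihedral_maps d 1)" using perm_group_dihedral_maps[OF f d, of 1] by simp
  have "frob p \<in> dihedral_maps d 1" unfolding dihedral_maps_def
    by (intro UnI2 image_eqI[of _ _ 0]) (simp_all add: frob_eq_sl)
  moreover have "scal d \<in> dihedral_maps d 1" unfolding dihedral_maps_def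
    by (intro UnI1 image_eqI[of _ _ 1]) (simp_all add: scal_eq_sl)
  ultimately show "generate Sym {frob p, scal d} \<subseteq> dihedral_maps d 1"
    using D by (intro group.generate_subgroup_incl[OF group_Sym]) (simp_all add: perm_group_iff_subgroup)
  have "{frob p, scal d} \<subseteq> carrier Sym"
    using d sl_bij by (auto simp: frob_eq_sl scal_eq_sl)
  then have "subgroup (generate Sym {frob p, scal d}) Sym"
    by (rule group.generate_is_subgroup[OF group_Sym])
  then have G: "perm_group (generate Sym {frob p, scal d})" by (simp add: perm_group_iff_subgroup)
  have g: "sl 1 1 \<in> generate Sym {frob p, scal d}" "sl d 0 \<in> generate Sym {frob p, scal d}"
    using generate.incl[of _ "{frob p, scal d}" Sym] by (auto simp: frob_eq_sl scal_eq_sl)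
  have "sl (d ^ i) 0 \<in> generate Sym {frob p, scal d}" for i
    using perm_group_funpow[OF G g(2), of i] by (simp add: sl_funpow_scalar)
  moreover from this have "sl (d ^ i) 0 \<circ> sl 1 1 \<in> generate Sym {frob p, scal d}" for i
    using perm_groupD(3)[OF G] g(1) by blast
  then have "sl (d ^ i * 1) 1 \<in> generate Sym {frob p, scal d}" for i
    by (simp add: sl_comp)
  ultimately show "dihedral_maps d 1 \<subseteq> generate Sym {frob p, scal d}"
    unfolding dihedral_maps_def by blast
qed

text \<open>Conjugation by a scalar fixes the rotations and turns \<open>frob p\<close> into
  \<open>sl (c ^ p / c) 1\<close>, so only the parameter \<open>t\<close> changes.\<close>

lemma conjugate_generate_frob_scal:
  assumes f: "f = 2" and d: "d \<noteq> 0" and c: "c \<noteq> 0"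
  shows "conjugate_subgroup Sym (generate Sym {frob p, scal d}) (scal c) = dihedral_maps d (c ^ p / c)"
proof -
  have inv: "finv (sl c 0) = sl (1 / c) 0"
    by (rule inv_equality) (use c in \<open>simp_all add: sl_def\<close>)
  have "conjugate_subgroup Sym K (sl c 0) = (\<lambda>k. sl (1 / c) 0 \<circ> k \<circ> sl c 0) ` K"
    if K: "\<forall>k\<in>K. bij k" for K
    using K c sl_bij[of c 0] sl_bij[of "1 / c" 0] unfolding conjugate_subgroup_def l_coset_def r_coset_def
    by (auto simp: inv bij_comp intro!: image_eqI)
  moreover have "perm_group (dihedral_maps d 1)" using perm_group_dihedral_maps[OF f d, of 1] by simp
  ultimately have "conjugate_subgroup Sym (dihedral_maps d 1) (sl c 0)
      = (\<lambda>k. sl (1 / c) 0 \<circ> k \<circ> sl c 0) ` dihedral_maps d 1"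
    using perm_groupD(2) by blast
  also have "\<dots> = dihedral_maps d (c ^ p / c)"
    using c by (simp add: dihedral_maps_def image_Un image_image sl_comp mult.commute)
  finally show ?thesis unfolding generate_frob_scal[OF f d] by (simp only: scal_eq_sl)
qed

end

section \<open>Subgroups of G that project onto \<open>H\<close>\<close>

context semilinear_group
begin

lemma linear_part_perm_group:
  assumes M: "perm_group M" "M \<subseteq> affine_group"
  shows "perm_group (linear_part ` M)" "linear_part ` M \<subseteq> H"
proof -
  show sub: "linear_part ` M \<subseteq> H" using M linear_part_in_H by blast
  show "perm_group (linear_part ` M)" unfolding perm_group_def
  proof (intro conjI ballI)
    have "linear_part id = id" by (auto simp: linear_part_def)
    then show "id \<in> linear_part ` M" using perm_groupD(1)[OF M(1)] by force
    show "bij h" if "h \<in> linear_part ` M" for h using sub that perm_groupD(2)[OF H_group] by blast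
    fix h k assume "h \<in> linear_part ` M" "k \<in> linear_part ` M"
    then obtain g g' where g: "g \<in> M" "g' \<in> M" "h = linear_part g" "k = linear_part g'" by blast
    then have "h \<circ> k = linear_part (g \<circ> g')" using linear_part_comp M by auto
    then show "h \<circ> k \<in> linear_part ` M" using perm_groupD(3)[OF M(1)] g by blast
  qed
qed

lemma linear_part_conj:
  assumes "x \<in> affine_group" "g \<in> affine_group"
  shows "linear_part (x \<circ> g \<circ> finv x) = linear_part x \<circ> linear_part g \<circ> finv (linear_part x)"
proof (rule conj_eqI[symmetric])
  have bx: "bij x" using perm_groupD(2)[OF affine_perm_group assms(1)] .
  let ?z = "x \<circ> g \<circ> finv x"
  have z: "?z \<in> affine_group"
    using assms affine_perm_group perm_groupD(3) perm_group_inv by meson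
  show "bij (linear_part x)" using perm_groupD(2)[OF H_group] linear_part_in_H[OF assms(1)] by blast
  have "?z \<circ> x = x \<circ> g" using bx by (simp add: comp_assoc bij_is_inj)
  then show "linear_part x \<circ> linear_part g = linear_part ?z \<circ> linear_part x"
    using linear_part_comp[OF z, of x] linear_part_comp[OF assms(1), of g] by simp
qed

text \<open>A complement of the translations fixes the average of the orbit of \<open>0\<close>.\<close>

lemma complement_fixes_point:
  assumes prim: "primitive affine_group" and M: "perm_group M" "M \<subset> affine_group"
    and lin: "linear_part ` M = H" and card: "of_nat (card H) \<noteq> (0::'a)"
  obtains x0 where "\<And>g. g \<in> M \<Longrightarrow> g x0 = x0"
proof -
  \<comment> \<open>The translations in \<open>M\<close> form an \<open>H\<close>-submodule because
    \<open>M\<close> projects onto \<open>H\<close>. It is not everything, as otherwise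
    \<open>M\<close> would be G; so it is 0 and \<open>M\<close> is a complement.\<close>
  let ?T = "{v. (\<lambda>x. x + v) \<in> M}"
  have Xsub: "M \<subseteq> affine_group" using M by auto
  have add: "v + w \<in> ?T" if "v \<in> ?T" "w \<in> ?T" for v w
  proof -
    have "(\<lambda>x. x + w) \<circ> (\<lambda>x. x + v) \<in> M" using that perm_groupD(3)[OF M(1)] by simp
    then show ?thesis by (simp add: comp_def add.assoc)
  qed
  have "?T = {0} \<or> ?T = UNIV"
  proof (rule irreducible_if_primitive[OF prim])
    show "0 \<in> ?T" using perm_groupD(1)[OF M(1)] by (simp add: id_def)
  next
    fix h v assume h: "h \<in> H" and v: "v \<in> ?T"
    obtain g where g: "g \<in> M" "linear_part g = h" using h lin by blast
    obtain h' where h': "h' \<in> H" "\<And>v. g \<circ> (\<lambda>x. x + v) \<circ> finv g = (\<lambda>x. x + h' v)" "g = (\<lambda>x. h' x + g 0)"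
      using translation_conj[of g] g Xsub by blast
    have "linear_part g = h'" by (subst h'(3)) (rule linear_part_affine[OF h'(1)])
    moreover have "g \<circ> (\<lambda>x. x + v) \<circ> finv g \<in> M"
      using g(1) v perm_group_inv[OF M(1) g(1)] perm_groupD(3)[OF M(1)] by simp
    ultimately show "h v \<in> ?T" using h'(2)[of v] g(2) by simp
  qed (rule add)
  moreover have "?T \<noteq> UNIV"
  proof
    assume T: "?T = UNIV"
    have "g \<in> M" if g: "g \<in> affine_group" for g
    proof -
      obtain k where k: "k \<in> M" "linear_part k = linear_part g"
        using lin linear_part_in_H[OF g] by (metis imageE)
      have "g = (\<lambda>x. x + (g 0 - k 0)) \<circ> k"
        using k(2) by (auto simp: linear_part_def fun_eq_iff algebra_simps)
      moreover have "(\<lambda>x. x + (g 0 - k 0)) \<in> M" using T by blast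
      ultimately show ?thesis using k(1) perm_groupD(3)[OF M(1)] by metis
    qed
    then show False using M by blast
  qed
  ultimately have T: "?T = {0}" by blast
  have "inj_on linear_part M"
  proof (rule inj_onI)
    fix g k assume gk: "g \<in> M" "k \<in> M" and e: "linear_part g = linear_part k"
    have gt: "g = (\<lambda>x. x + (g 0 - k 0)) \<circ> k"
      using e by (auto simp: linear_part_def fun_eq_iff algebra_simps)
    have "bij k" using perm_groupD(2)[OF M(1) gk(2)] .
    then have "(\<lambda>x. x + (g 0 - k 0)) = g \<circ> finv k"
      by (subst gt) (simp add: comp_assoc bij_is_surj surj_iff[THEN iffD1])
    then have "(\<lambda>x. x + (g 0 - k 0)) \<in> M"
      using gk perm_group_inv[OF M(1)] perm_groupD(3)[OF M(1)] by simp
    then have "g 0 - k 0 = 0" using T by blast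
    then show "g = k" using gt by (simp add: comp_def)
  qed
  then have "card M = card H" using card_image lin by metis
  then have N0: "of_nat (card M) \<noteq> (0::'a)" using card by simp
  let ?S = "\<Sum>g\<in>M. g 0"
  \<comment> \<open>The division is possible since |M| = |H| is prime to the characteristic.\<close>
  define x0 where "x0 = ?S / of_nat (card M)"
  have x0: "of_nat (card M) * x0 = ?S" using N0 by (simp add: x0_def)
  have "k x0 = x0" if k: "k \<in> M" for k
  proof -
    have kA: "k \<in> affine_group" using k Xsub by blast
    obtain h v where hv: "h \<in> H" "k = (\<lambda>x. h x + v)" using affine_groupE[OF kA] .
    have h_sum: "h (\<Sum>i\<in>I. y i) = (\<Sum>i\<in>I. h (y i))" if "finite I" for I :: "('a \<Rightarrow> 'a) set" and y
      using that by (induction I) (simp_all add: H_0[OF hv(1)] H_add[OF hv(1)])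
    have h_mult: "h (of_nat m * y) = of_nat m * h y" for m y
      by (induction m) (simp_all add: H_0[OF hv(1)] H_add[OF hv(1)] distrib_right)
    have "bij_betw (\<lambda>g. k \<circ> g) M M"
    proof -
      have "inj_on (\<lambda>g. k \<circ> g) M"
        using perm_groupD(2)[OF M(1) k] by (auto intro!: inj_onI simp: fun_eq_iff bij_is_inj inj_eq)
      moreover have "(\<lambda>g. k \<circ> g) ` M \<subseteq> M" using perm_groupD(3)[OF M(1) k] by blast
      ultimately show ?thesis by (simp add: bij_betw_def endo_inj_surj)
    qed
    then have "?S = (\<Sum>g\<in>M. (k \<circ> g) 0)" using sum.reindex_bij_betw[of "\<lambda>g. k \<circ> g" M M "\<lambda>g. g 0"] by simp
    also have "\<dots> = h ?S + of_nat (card M) * v" unfolding hv(2) by (simp add: h_sum sum.distrib)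
    also have "\<dots> = of_nat (card M) * k x0"
      unfolding x0[symmetric] h_mult hv(2) by (simp add: distrib_left)
    finally have "of_nat (card M) * x0 = of_nat (card M) * k x0" using x0 by metis
    then show ?thesis using N0 by (metis mult_cancel_left)
  qed
  then show ?thesis using that by blast
qed

end

text \<open>\<open>v\<close> and \<open>w\<close> are fixed vectors of one reflection with even and
  one with odd exponent of \<open>d\<close>. The parity of this exponent is all that the covering
  arguments keep track of.\<close>

locale dihedral_stabilizer = semilinear_group p f l H
  for p f :: nat and l :: "'a::{field,finite}" and H :: "('a \<Rightarrow> 'a) set" +
  fixes d t v w :: 'a and k :: nat
  assumes f_eq_2: "f = 2" and odd_p: "odd p"
    and d_nonzero: "d \<noteq> 0" and d_power: "d ^ (p + 1) = 1" and t_power: "t ^ (p + 1) = 1"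
    and d_order: "d ^ 2 ^ k = 1" and H_eq: "H = dihedral_maps d t"
    and v: "v \<noteq> 0" "sl t 1 v = v" and w: "w \<noteq> 0" "sl (d * t) 1 w = w"
begin

lemmas comp_rules = dihedral_maps_comp[OF f_eq_2 d_nonzero t_power]

lemma in_H_cases:
  assumes "h \<in> H"
  obtains i where "h = sl (d ^ i) 0" | i where "h = sl (d ^ i * t) 1"
  using assms unfolding H_eq dihedral_maps_def by blast

lemma in_H: "sl (d ^ i) 0 \<in> H" "sl (d ^ i * t) 1 \<in> H"
  unfolding H_eq dihedral_maps_def by blast+

lemma d_power_cong: "i = j + (p + 1) * m \<Longrightarrow> d ^ i = d ^ j"
  using d_power by (simp only: power_add power_mult) simp

text \<open>As \<open>d\<close> has 2-power order, each odd power of it generates all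
  rotations.\<close>

lemma eq_H_if_rotation_reflection:
  assumes M: "perm_group M" "M \<subseteq> H" and i: "odd i" "sl (d ^ i) 0 \<in> M" and j: "sl (d ^ j * t) 1 \<in> M"
  shows "M = H"
proof -
  have pow: "sl (d ^ m) 0 \<in> M" for m
  proof -
    have "coprime i (2 ^ k)" using i by simp
    then obtain i' where "[i * i' = 1] (mod (2 ^ k))" using cong_solve_coprime_nat[of i "2 ^ k"] by auto
    then have "[i * i' * m = 1 * m] (mod (2 ^ k))" by (rule cong_scalar_right)
    then have "d ^ (i * i' * m) = d ^ m"
    proof -
      assume c: "[i * i' * m = 1 * m] (mod (2 ^ k))"
      have *: "d ^ x = d ^ (x mod 2 ^ k)" for x
      proof -
        have "d ^ x = d ^ (2 ^ k * (x div 2 ^ k) + x mod 2 ^ k)" by simp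
        then show ?thesis using d_order by (simp only: power_add power_mult) simp
      qed
      show ?thesis using *[of "i * i' * m"] *[of m] c by (simp add: cong_def)
    qed
    moreover have "sl (d ^ i) 0 ^^ (i' * m) \<in> M" using perm_group_funpow[OF M(1) i(2)] .
    ultimately show ?thesis by (simp add: sl_funpow_scalar mult.assoc flip: power_mult)
  qed
  have "sl (d ^ m * t) 1 \<in> M" for m
  proof -
    \<comment> \<open>The rotation is chosen to cancel \<open>d ^ j\<close>, since
      \<open>p * j + j\<close> is a multiple of \<open>p + 1\<close>.\<close>
    have "sl (d ^ (m + p * j)) 0 \<circ> sl (d ^ j * t) 1 \<in> M" using perm_groupD(3)[OF M(1) pow j] .
    moreover have "d ^ (m + p * j + j) = d ^ m" by (rule d_power_cong[of _ _ j]) simp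
    ultimately show ?thesis by (simp only: comp_rules)
  qed
  then have "H \<subseteq> M" using pow in_H_cases by blast
  then show ?thesis using M by blast
qed

text \<open>The product of two reflections of different parity is a rotation with odd exponent,
  because \<open>p\<close> is odd.\<close>

lemma eq_H_if_reflections:
  assumes M: "perm_group M" "M \<subseteq> H" and i: "even i" "sl (d ^ i * t) 1 \<in> M" and j: "odd j" "sl (d ^ j * t) 1 \<in> M"
  shows "M = H"
proof -
  have "sl (d ^ i * t) 1 \<circ> sl (d ^ j * t) 1 \<in> M" using perm_groupD(3)[OF M(1) i(2) j(2)] .
  then have "sl (d ^ (i + p * j)) 0 \<in> M" by (simp only: comp_rules)
  moreover have "odd (i + p * j)" using i j odd_p by simp
  ultimately show ?thesis using eq_H_if_rotation_reflection[OF M _ _ i(2)] by blast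
qed

text \<open>Conjugation sends \<open>d\<close> to itself or to \<open>d ^ p\<close>, its inverse
  when \<open>d ^ (p + 1) = 1\<close>.\<close>

lemma conj_rotation:
  assumes x: "x \<in> H"
  obtains i where "odd i" "x \<circ> sl d 0 \<circ> finv x = sl (d ^ i) 0"
proof -
  have b: "bij x" using perm_groupD(2)[OF H_group x] .
  have "\<exists>i. odd i \<and> x \<circ> sl (d ^ 1) 0 = sl (d ^ i) 0 \<circ> x"
  proof (rule in_H_cases[OF x])
    fix i assume "x = sl (d ^ i) 0"
    then show ?thesis by (intro exI[of _ 1]) (simp only: comp_rules, simp add: add.commute)
  next
    fix i assume "x = sl (d ^ i * t) 1"
    then show ?thesis using odd_p by (intro exI[of _ p]) (simp only: comp_rules, simp add: add.commute)
  qed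
  then show ?thesis using that conj_eqI[OF b] by auto
qed

text \<open>Conjugation by the rotation \<open>d ^ i\<close> adds \<open>2 * i\<close> to the
  exponent \<open>e\<close>; a reflection first multiplies \<open>e\<close> by the odd number
  \<open>p\<close>. Both keep the parity.\<close>

lemma conj_reflection:
  assumes x: "x \<in> H"
  obtains i where "even i \<longleftrightarrow> even e" "x \<circ> sl (d ^ e * t) 1 \<circ> finv x = sl (d ^ i * t) 1"
proof -
  have b: "bij x" using perm_groupD(2)[OF H_group x] .
  have "\<exists>i. (even i \<longleftrightarrow> even e) \<and> x \<circ> sl (d ^ e * t) 1 = sl (d ^ i * t) 1 \<circ> x"
  proof (rule in_H_cases[OF x])
    fix i assume xi: "x = sl (d ^ i) 0"
    have "d ^ (e + 2 * i + p * i) = d ^ (i + e)" by (rule d_power_cong[of _ _ i]) simp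
    then show ?thesis unfolding xi comp_rules by (intro exI[of _ "e + 2 * i"]) simp
  next
    fix i assume xi: "x = sl (d ^ i * t) 1"
    have "d ^ (2 * i + p * e + p * i) = d ^ (i + p * e)" by (rule d_power_cong[of _ _ i]) simp
    then show ?thesis unfolding xi comp_rules using odd_p by (intro exI[of _ "2 * i + p * e"]) simp
  qed
  then show ?thesis using that conj_eqI[OF b] by blast
qed

lemma not_two_coverable_H: "\<not> two_coverable H"
proof
  assume "two_coverable H"
  then obtain K L where KL: "perm_group K" "K \<subset> H" "perm_group L" "L \<subset> H"
    "\<And>g. g \<in> H \<Longrightarrow> \<exists>x\<in>H. x \<circ> g \<circ> finv x \<in> K \<union> L"
    unfolding two_coverable_def by blast
  \<comment> \<open>Three kinds of elements, each of which must occur in \<open>K\<close> or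
    \<open>L\<close>; a proper subgroup contains at most one kind.\<close>
  define P where "P M \<longleftrightarrow> (\<exists>i. odd i \<and> sl (d ^ i) 0 \<in> M)" for M
  define R where "R M \<longleftrightarrow> (\<exists>i. even i \<and> sl (d ^ i * t) 1 \<in> M)" for M
  define S where "S M \<longleftrightarrow> (\<exists>i. odd i \<and> sl (d ^ i * t) 1 \<in> M)" for M
  have "P K \<or> P L"
  proof -
    obtain x where x: "x \<in> H" "x \<circ> sl d 0 \<circ> finv x \<in> K \<union> L" using KL(5)[OF in_H(1)[of 1]] by auto
    then show ?thesis using conj_rotation[OF x(1)] unfolding P_def by (metis UnE)
  qed
  moreover have refl: "\<exists>i. (even i \<longleftrightarrow> even e) \<and> sl (d ^ i * t) 1 \<in> K \<union> L" for e :: nat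
  proof -
    obtain x where x: "x \<in> H" "x \<circ> sl (d ^ e * t) 1 \<circ> finv x \<in> K \<union> L" using KL(5)[OF in_H(2)] by auto
    then show ?thesis using conj_reflection[OF x(1), of e] by metis
  qed
  have "R K \<or> R L" using refl[of 0] unfolding R_def by auto
  moreover have "S K \<or> S L" using refl[of 1] unfolding S_def by auto
  moreover have "\<not> (P M \<and> (R M \<or> S M)) \<and> \<not> (R M \<and> S M)" if "perm_group M" "M \<subset> H" for M
    using that eq_H_if_rotation_reflection[of M] eq_H_if_reflections[of M] unfolding P_def R_def S_def by blast
  ultimately show False using KL(1-4) by blast
qed

lemma linear_part_covers:
  assumes prim: "primitive affine_group" and card: "of_nat (card H) \<noteq> (0::'a)"
    and K: "perm_group K" "K \<subset> affine_group" "linear_part ` K = H"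
    and L: "perm_group L" "L \<subset> affine_group"
    and cov: "\<And>g. g \<in> affine_group \<Longrightarrow> \<exists>x\<in>affine_group. x \<circ> g \<circ> finv x \<in> K \<union> L"
  shows "linear_part ` L = H"
proof -
  obtain x0 where x0: "\<And>g. g \<in> K \<Longrightarrow> g x0 = x0"
    using complement_fixes_point[OF prim K card] by blast
  have *: "\<exists>y\<in>H. y \<circ> h \<circ> finv y \<in> linear_part ` L" if h: "h \<in> H" and z: "z \<noteq> 0" "h z = z" for h z
  proof -
    \<comment> \<open>As \<open>h\<close> fixes \<open>z \<noteq> 0\<close>, this map is not
      injective and so misses a value \<open>u\<close>; then \<open>x \<mapsto> h x + u\<close> has
      no fixed point and no conjugate in \<open>K\<close>.\<close>
    have "\<not> inj (\<lambda>x. x - h x)"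
    proof
      assume "inj (\<lambda>x. x - h x)"
      then show False using injD[of "\<lambda>x. x - h x" z 0] z H_0[OF h] by simp
    qed
    then have "\<not> surj (\<lambda>x. x - h x)" using finite_UNIV_surj_inj[of "\<lambda>x. x - h x"] by auto
    then obtain u where u: "\<And>x. u \<noteq> x - h x" unfolding surj_def by blast
    let ?g = "\<lambda>x. h x + u"
    have g: "?g \<in> affine_group" using affine_groupI[OF h] .
    have nofix: "?g x \<noteq> x" for x using u[of x] by (metis add_diff_cancel_left')
    obtain x where x: "x \<in> affine_group" "x \<circ> ?g \<circ> finv x \<in> K \<union> L" using cov[OF g] by blast
    have "bij x" using perm_groupD(2)[OF affine_perm_group x(1)] .
    have "x \<circ> ?g \<circ> finv x \<notin> K"
    proof
      assume "x \<circ> ?g \<circ> finv x \<in> K"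
      then have "x (?g (finv x x0)) = x0" using x0 by fastforce
      then have "?g (finv x x0) = finv x x0" using \<open>bij x\<close> by (metis bij_inv_eq_iff)
      then show False using nofix by blast
    qed
    then have "linear_part (x \<circ> ?g \<circ> finv x) \<in> linear_part ` L" using x(2) by blast
    then show ?thesis
      unfolding linear_part_conj[OF x(1) g] linear_part_affine[OF h] using linear_part_in_H[OF x(1)] by blast
  qed
  have M: "perm_group (linear_part ` L)" "linear_part ` L \<subseteq> H"
    using linear_part_perm_group[OF L(1)] L(2) by auto
  have "sl (d ^ 0 * t) 1 v = v" "sl (d ^ 1 * t) 1 w = w" using v w by simp_all
  then obtain y y' where y: "y \<in> H" "y \<circ> sl (d ^ 0 * t) 1 \<circ> finv y \<in> linear_part ` L"
    and y': "y' \<in> H" "y' \<circ> sl (d ^ 1 * t) 1 \<circ> finv y' \<in> linear_part ` L"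
    using *[OF in_H(2)] v(1) w(1) by metis
  obtain i where "even i \<longleftrightarrow> even (0::nat)" "y \<circ> sl (d ^ 0 * t) 1 \<circ> finv y = sl (d ^ i * t) 1"
    using conj_reflection[OF y(1)] .
  moreover obtain j where "even j \<longleftrightarrow> even (1::nat)" "y' \<circ> sl (d ^ 1 * t) 1 \<circ> finv y' = sl (d ^ j * t) 1"
    using conj_reflection[OF y'(1)] .
  ultimately show ?thesis using eq_H_if_reflections[OF M, of i j] y(2) y'(2) by simp
qed

lemma not_two_coverable_affine:
  assumes prim: "primitive affine_group" and card: "of_nat (card H) \<noteq> (0::'a)"
  shows "\<not> two_coverable affine_group"
proof
  assume "two_coverable affine_group"
  then obtain K L where KL: "perm_group K" "K \<subset> affine_group" "perm_group L" "L \<subset> affine_group"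
    and cov: "\<And>g. g \<in> affine_group \<Longrightarrow> \<exists>x\<in>affine_group. x \<circ> g \<circ> finv x \<in> K \<union> L"
    unfolding two_coverable_def by blast
  have cov': "\<And>g. g \<in> affine_group \<Longrightarrow> \<exists>x\<in>affine_group. x \<circ> g \<circ> finv x \<in> L \<union> K"
    using cov by (simp add: Un_commute)
  have K: "perm_group (linear_part ` K)" "linear_part ` K \<subseteq> H"
    using linear_part_perm_group[OF KL(1)] KL(2) by auto
  have L: "perm_group (linear_part ` L)" "linear_part ` L \<subseteq> H"
    using linear_part_perm_group[OF KL(3)] KL(4) by auto
  show False
  proof (cases "linear_part ` K = H \<or> linear_part ` L = H")
    case True
    then have KH: "linear_part ` K = H" and LH: "linear_part ` L = H"
      using linear_part_covers[OF prim card KL(1,2) _ KL(3,4) cov]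
        linear_part_covers[OF prim card KL(3,4) _ KL(1,2) cov'] by blast+
    obtain x1 where x1: "\<And>g. g \<in> K \<Longrightarrow> g x1 = x1"
      using complement_fixes_point[OF prim KL(1,2) KH card] by blast
    obtain x2 where x2: "\<And>g. g \<in> L \<Longrightarrow> g x2 = x2"
      using complement_fixes_point[OF prim KL(3,4) LH card] by blast
    \<comment> \<open>A translation without fixed points, whereas all elements of \<open>K\<close>
      fix \<open>x1\<close> and all elements of \<open>L\<close> fix \<open>x2\<close>.\<close>
    let ?g = "\<lambda>x. x + 1 :: 'a"
    obtain x where x: "x \<in> affine_group" "x \<circ> ?g \<circ> finv x \<in> K \<union> L"
      using cov[OF translation_in_affine] by blast
    obtain y where "(x \<circ> ?g \<circ> finv x) y = y" using x(2) x1 x2 by blast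
    then have "x (finv x y + 1) = y" by simp
    moreover have "bij x" using perm_groupD(2)[OF affine_perm_group x(1)] .
    ultimately have "finv x y + 1 = finv x y" by (metis bij_inv_eq_iff)
    then show False by simp
  next
    case False
    \<comment> \<open>Both images are now proper subgroups, and projecting the covering of G shows
      that their conjugates cover \<open>H\<close>.\<close>
    have "\<exists>y\<in>H. y \<circ> h \<circ> finv y \<in> linear_part ` K \<union> linear_part ` L" if h: "h \<in> H" for h
    proof -
      have hA: "h \<in> affine_group" using h H_subset_affine by blast
      obtain x where x: "x \<in> affine_group" "x \<circ> h \<circ> finv x \<in> K \<union> L" using cov[OF hA] by blast
      then have "linear_part (x \<circ> h \<circ> finv x) \<in> linear_part ` K \<union> linear_part ` L" by blast
      moreover have "linear_part h = h" using linear_part_affine[OF h, of 0] by simp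
      ultimately show ?thesis
        unfolding linear_part_conj[OF x(1) hA] using linear_part_in_H[OF x(1)] by auto
    qed
    then have "two_coverable H" unfolding two_coverable_def using K L False by blast
    then show False using not_two_coverable_H by simp
  qed
qed

end

section \<open>The two directions of the equivalence\<close>

lemma (in semilinear_group) dihedral_if_quadratic:
  assumes f: "f = 2" and t: "t ^ (p + 1) = 1" and H: "H = dihedral_maps d t"
    and d: "d \<in> A" "d ^ (p + 1) = 1" and n: "n \<ge> 2"
  shows "dihedral (sub H)"
proof -
  let ?r = "sl d 0" and ?s = "sl t 1"
  have t0: "t \<noteq> 0" using t by auto
  have d0: "d \<noteq> 0" using A_nonzero d by blast
  have comp: "sl (d ^ i) 0 \<circ> sl (d ^ j) 0 = sl (d ^ (i + j)) 0"
    "sl (d ^ i) 0 \<circ> sl (d ^ j * t) 1 = sl (d ^ (i + j) * t) 1"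
    "sl (d ^ i * t) 1 \<circ> sl (d ^ j) 0 = sl (d ^ (i + p * j) * t) 1"
    "sl (d ^ i * t) 1 \<circ> sl (d ^ j * t) 1 = sl (d ^ (i + p * j)) 0" for i j
    using dihedral_maps_comp[OF f d0 t] by blast+
  have s: "?s \<in> H" unfolding H dihedral_maps_def by (intro UnI2 image_eqI[of _ _ 0]) simp_all
  have r: "?r \<in> H" using d d0 by (simp add: A_def)
  have G: "group (sub H)" using group_sub[OF H_group] .
  have bij: "h \<in> H \<Longrightarrow> bij h" for h using perm_groupD(2)[OF H_group] .
  have card: "order (sub H) = 2 * n"
    using quadratic_decomposition(2)[OF f t0 s] by (simp add: order_def)
  have gen: "generate (sub H) {?r, ?s} = H"
  proof
    show "generate (sub H) {?r, ?s} \<subseteq> H"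
      using group.generate_in_carrier[OF G, of "{?r, ?s}"] r s by auto
    have "subgroup (generate (sub H) {?r, ?s}) (sub H)"
      by (rule group.generate_is_subgroup[OF G]) (use r s in auto)
    then have g: "perm_group (generate (sub H) {?r, ?s})" using subgroup_sub_iff[OF H_group] by blast
    have rs: "?r \<in> generate (sub H) {?r, ?s}" "?s \<in> generate (sub H) {?r, ?s}"
      by (auto intro: generate.incl)
    have ri: "sl (d ^ i) 0 \<in> generate (sub H) {?r, ?s}" for i
      using perm_group_funpow[OF g rs(1), of i] by (simp add: sl_funpow_scalar)
    have "sl (d ^ i) 0 \<circ> ?s \<in> generate (sub H) {?r, ?s}" for i
      using perm_groupD(3)[OF g ri rs(2)] .
    then have "sl (d ^ i * t) 1 \<in> generate (sub H) {?r, ?s}" for i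
      by (simp add: sl_comp)
    then show "H \<subseteq> generate (sub H) {?r, ?s}" using ri by (subst H) (auto simp: dihedral_maps_def)
  qed
  have rn: "?r [^]\<^bsub>sub H\<^esub> n = \<one>\<^bsub>sub H\<^esub>"
    using sub_nat_pow[OF H_group r, of n] power_n[OF d(1)] by (simp add: sl_funpow_scalar sl_1_0)
  have ss: "?s \<circ> ?s = id"
    using comp(4)[of 0 0] by (simp add: sl_1_0)
  then have s2: "?s [^]\<^bsub>sub H\<^esub> (2::nat) = \<one>\<^bsub>sub H\<^esub>"
    using sub_nat_pow[OF H_group s, of 2] by (simp add: numeral_2_eq_2)
  have si: "finv ?s = ?s" using ss by (intro inv_equality) (auto simp: fun_eq_iff)
  have rinv: "finv ?r = sl (d ^ p) 0"
  proof (rule inv_equality)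
    have "d ^ p * d = 1" using d(2) by (simp add: mult.commute)
    then show "sl (d ^ p) 0 (sl d 0 x) = x" "sl d 0 (sl (d ^ p) 0 x) = x" for x
      by (simp_all add: sl_def mult.assoc[symmetric] mult.commute)
  qed
  have "?s \<circ> ?r \<circ> ?s = sl (d ^ p) 0"
    using comp(3)[of 0 1] comp(4)[of p 0] by simp
  then have "?s \<otimes>\<^bsub>sub H\<^esub> ?r \<otimes>\<^bsub>sub H\<^esub> inv\<^bsub>sub H\<^esub> ?s = inv\<^bsub>sub H\<^esub> ?r"
    using sub_inv[OF H_group r] sub_inv[OF H_group s] bij[OF r] bij[OF s] si rinv by (simp add: bij_comp)
  then show ?thesis unfolding dihedral_def using G n card r s gen rn s2
    by (intro conjI exI[of _ n] exI[of _ ?r] exI[of _ ?s]) simp_all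
qed

lemma (in semilinear_group) non_basic_imp:
  assumes prim: "primitive affine_group" and nontriv: "H \<noteq> {id}"
    and nb: "\<not> two_coverable H" "\<not> two_coverable affine_group"
  shows "p mod 4 = 3 \<and> f = 2 \<and> (dihedral (sub H) \<and> (\<exists>m. card H = 2 ^ m) \<and>
     (\<exists>e c. e dvd p + 1 \<and> c \<in> GL1 \<and>
        H = conjugate_subgroup Sym (generate Sym {frob p, scal (l ^ ((p - 1) * e))}) c))"
proof -
  obtain s b w where gen: "semilinear_group_gen p f l H s b w" using ex_generator .
  have "nonbasic_semilinear p f l H s b w"
  proof (rule nonbasic_semilinear.intro[OF gen], rule nonbasic_semilinear_axioms.intro)
    fix W :: "'a set"
    assume "0 \<in> W" "\<And>x y. x \<in> W \<Longrightarrow> y \<in> W \<Longrightarrow> x + y \<in> W" "\<And>h x. h \<in> H \<Longrightarrow> x \<in> W \<Longrightarrow> h x \<in> W"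
    then show "W = {0} \<or> W = UNIV" by (rule irreducible_if_primitive[OF prim])
  next
    fix K assume "perm_group K" "K \<subset> H"
    then show "\<exists>h v. h \<in> H \<and> h \<notin> K \<and> v \<noteq> 0 \<and> h v = v"
      using two_coverable_affineI[of K] nb(2) by blast
  next
    show "\<not> two_coverable H" "H \<noteq> {id}" by (fact nb(1), fact nontriv)
  qed
  then obtain k u v where st: "f = 2" "p mod 4 = 3" "n = 2 ^ k" "k \<ge> 2" "n dvd p + 1"
    "u \<noteq> 0" "sl u 1 \<in> H" "v \<noteq> 0" "sl u 1 v = v"
    by (rule nonbasic_semilinear.stabilizer_structure)
  \<comment> \<open>For \<open>f = 2\<close> the exponent \<open>(p ^ f - 1) div n\<close> of
    \<open>a\<close> equals \<open>(p - 1) * e\<close> with e = (p + 1) / n.\<close>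
  obtain e where e: "p + 1 = n * e" using st(5) by blast
  have "p ^ f - 1 = (p - 1) * (p + 1)"
    using p_gt_1 unfolding st(1) by (simp add: power2_eq_square algebra_simps)
  then have "p ^ f - 1 = n * ((p - 1) * e)" unfolding e by (simp only: ac_simps)
  then have "(p ^ f - 1) div n = (p - 1) * e" using n_pos by simp
  then have a: "a = l ^ ((p - 1) * e)" by (simp add: a_def)
  have a0: "a \<noteq> 0" using A_nonzero a_in_A by blast
  have uv: "u * v ^ p = v" using st(9) by (simp add: sl_def)
  \<comment> \<open>The fixed vector provides the conjugating scalar: \<open>sl u 1\<close> is the
    conjugate of \<open>frob p\<close> by \<open>1 / v\<close>.\<close>
  then have u: "u = (1 / v) ^ p / (1 / v)" using st(8) by (simp add: power_divide field_simps)
  have H: "H = dihedral_maps a u"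
    using quadratic_decomposition(1)[OF st(1,6,7)] unfolding dihedral_maps_def A_eq_powers_a by (simp add: image_image)
  \<comment> \<open>Apply \<open>v = u * v ^ p\<close> twice and use v^(p^2) = v.\<close>
  have up: "u ^ (p + 1) = 1"
  proof -
    have "v = u * v ^ p" using uv by simp
    also have "\<dots> = u * (u * v ^ p) ^ p" using uv by simp
    also have "\<dots> = u ^ (p + 1) * v ^ p ^ f" unfolding st(1)
      by (simp add: power_mult_distrib power2_eq_square mult.assoc flip: power_mult)
    finally show ?thesis using power_q[of v] st(8) by simp
  qed
  have ap: "a ^ (p + 1) = 1" using a_power_eq_1_iff st(5) by blast
  have "2 ^ 2 \<le> (2::nat) ^ k" using st(4) by (intro power_increasing) simp_all
  then have n2: "n \<ge> 2" using st(3) by simp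
  have "dihedral (sub H)" using dihedral_if_quadratic[OF st(1) up H a_in_A ap n2] .
  moreover have "card H = 2 ^ Suc k" using quadratic_decomposition(2)[OF st(1,6,7)] st(3) by simp
  moreover have "e dvd p + 1" using e by simp
  moreover have "scal (1 / v) \<in> GL1" using st(8) by (simp add: GL1_def)
  moreover have "H = conjugate_subgroup Sym (generate Sym {frob p, scal (l ^ ((p - 1) * e))}) (scal (1 / v))"
    using conjugate_generate_frob_scal[OF st(1) a0, of "1 / v"] st(8) H u a by simp
  ultimately show ?thesis using st(1,2) by blast
qed

lemma (in semilinear_group) non_basicI:
  assumes prim: "primitive affine_group"
    and p3: "p mod 4 = 3" and f: "f = 2" and m: "card H = 2 ^ m"
    and c: "c \<in> GL1" and H: "H = conjugate_subgroup Sym (generate Sym {frob p, scal (l ^ ((p - 1) * e))}) c"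
  shows "\<not> two_coverable H" "\<not> two_coverable affine_group"
proof -
  obtain c0 where c0: "c0 \<noteq> 0" "c = scal c0" using c by (auto simp: GL1_def)
  let ?d = "l ^ ((p - 1) * e)" and ?t = "c0 ^ p / c0"
  have d0: "?d \<noteq> 0" using l_nonzero by simp
  have Hd: "H = dihedral_maps ?d ?t"
    using H conjugate_generate_frob_scal[OF f d0 c0(1)] c0(2) by simp
  have q1: "p ^ f - 1 = (p - 1) * (p + 1)"
    using p_gt_1 unfolding f by (simp add: power2_eq_square algebra_simps)
  have "(p - 1) * e * (p + 1) = (p - 1) * (p + 1) * e" by (simp only: ac_simps)
  then have "?d ^ (p + 1) = (l ^ (p ^ f - 1)) ^ e" unfolding q1 by (simp only: flip: power_mult)
  then have dp: "?d ^ (p + 1) = 1" using power_q_minus_1[OF l_nonzero] by simp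
  have t0: "?t \<noteq> 0" using c0 by simp
  have "c0 ^ p = c0 ^ (p - 1) * c0" using p_gt_1 by (simp flip: power_Suc2)
  then have "?t = c0 ^ (p - 1)" using c0 by simp
  then have "?t ^ (p + 1) = c0 ^ (p ^ f - 1)" unfolding q1 by (simp only: power_mult)
  then have tp: "?t ^ (p + 1) = 1" using power_q_minus_1[OF c0(1)] by simp
  have s: "sl ?t 1 \<in> H" unfolding Hd dihedral_maps_def by (intro UnI2 image_eqI[of _ _ 0]) simp_all
  have "sl ?d 0 \<in> H" unfolding Hd dihedral_maps_def by (intro UnI1 image_eqI[of _ _ 1]) simp_all
  then have dA: "?d \<in> A" using d0 by (simp add: A_def)
  have n2: "2 * n = 2 ^ m" using quadratic_decomposition(2)[OF f t0 s] m by simp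
  have "m \<noteq> 0"
  proof
    assume "m = 0"
    then show False using n2 by simp
  qed
  then obtain k where "m = Suc k" by (cases m) auto
  then have n: "n = 2 ^ k" using n2 by simp
  have odd_p: "odd p" using p3 by presburger
  \<comment> \<open>\<open>?t\<close> and \<open>?d * ?t\<close> are the (p - 1)-th powers of
    \<open>c0\<close> and of \<open>c0 * l ^ e\<close>, so the inverses of these two elements are
    fixed by the reflections \<open>sl ?t 1\<close> and \<open>sl (?d * ?t) 1\<close>.\<close>
  interpret dihedral_stabilizer p f l H ?d ?t "1 / c0" "1 / c0 / l ^ e" k
  proof unfold_locales
    show "?d ^ 2 ^ k = 1" using power_n[OF dA] n by simp
    show "sl ?t 1 (1 / c0) = 1 / c0" using c0 by (simp add: sl_def power_divide)
    have "l ^ e * ?d = (l ^ e) ^ p"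
    proof -
      have "e + (p - 1) * e = e * p" using p_gt_1 by (cases p) (simp_all add: algebra_simps)
      then show ?thesis by (metis power_add power_mult)
    qed
    then have "?d / (l ^ e) ^ p = 1 / l ^ e" using l_nonzero by (simp add: field_simps)
    moreover have "sl (?d * ?t) 1 (1 / c0 / l ^ e) = (?d / (l ^ e) ^ p) * (1 / c0)"
      using c0 by (simp add: sl_def power_divide power_mult_distrib)
    ultimately show "sl (?d * ?t) 1 (1 / c0 / l ^ e) = 1 / c0 / l ^ e" by (simp add: mult.commute)
  qed (use f odd_p d0 dp tp Hd c0 l_nonzero in auto)
  show "\<not> two_coverable H" by (rule not_two_coverable_H)
  \<comment> \<open>Here the 2-group hypothesis supplies the coprimality that averaging over an
    orbit needs.\<close>
  have "\<not> p dvd 2 ^ m"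
    using prime_p odd_p by (metis prime_dvd_power primes_dvd_imp_eq two_is_prime_nat dvd_refl)
  then have "of_nat (card H) \<noteq> (0::'a)"
    unfolding m of_nat_eq_0_iff_char_dvd char_field .
  then show "\<not> two_coverable affine_group" by (rule not_two_coverable_affine[OF prim])
qed

section \<open>From the hypotheses of the theorem to the locales\<close>

lemma generate_singleton_subset:
  fixes h :: "'a::finite \<Rightarrow> 'a"
  assumes "bij h"
  shows "generate Sym {h} \<subseteq> range (\<lambda>i. h ^^ i)"
proof (rule group.generate_subgroup_incl[OF group_Sym])
  show "{h} \<subseteq> range (\<lambda>i. h ^^ i)" by (auto intro: range_eqI[of _ _ 1])
  have "perm_group (range (\<lambda>i. h ^^ i))"
    unfolding perm_group_def
  proof (intro conjI ballI)
    show "id \<in> range (\<lambda>i. h ^^ i)" by (intro range_eqI[of _ _ 0]) simp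
    show "bij k" if "k \<in> range (\<lambda>i. h ^^ i)" for k using that bij_fn[OF assms] by auto
    fix k k' assume "k \<in> range (\<lambda>i. h ^^ i)" "k' \<in> range (\<lambda>i. h ^^ i)"
    then show "k \<circ> k' \<in> range (\<lambda>i. h ^^ i)" by (auto simp flip: funpow_add)
  qed
  then show "subgroup (range (\<lambda>i. h ^^ i)) Sym" by (simp add: perm_group_iff_subgroup)
qed

lemma semilinear_if_generator:
  fixes p f :: nat and l :: "'a::{field,finite}"
  assumes "Factorial_Ring.prime p" "f > 0" "CARD('a) = p ^ f" "l \<noteq> 0" "generate Sym {scal l} = GL1"
  shows "semilinear p f l"
proof
  fix x :: 'a assume "x \<noteq> 0"
  then have "scal x \<in> generate Sym {scal l}" unfolding assms(5) by (simp add: GL1_def)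
  moreover have "bij (scal l)" unfolding scal_def
    by (rule bij_betwI[of _ _ _ "\<lambda>x. x / l"]) (use assms(4) in auto)
  ultimately obtain i where i: "scal x = scal l ^^ i" using generate_singleton_subset by blast
  have "(scal l ^^ i) 1 = l ^ i" by (induction i) (simp_all add: scal_def)
  then show "\<exists>i. x = l ^ i" using fun_cong[OF i, of 1] by (auto simp: scal_def)
qed (use assms in auto)

lemma (in semilinear) AGammaL1_E:
  assumes "g \<in> AGammaL1 p"
  obtains u j v where "u \<noteq> 0" "g = (\<lambda>x. sl u j x + v)"
proof -
  have frob: "bij (frob p :: 'a \<Rightarrow> 'a)" unfolding frob_eq_sl by (rule sl_bij) simp
  have gen: "\<exists>j. k = sl 1 j" if k: "k \<in> generate Sym {frob p}" for k :: "'a \<Rightarrow> 'a"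
  proof -
    obtain i where "k = frob p ^^ i" using generate_singleton_subset[OF frob] k by blast
    then show ?thesis unfolding frob_eq_sl sl_funpow by auto
  qed
  obtain t h where th: "t \<in> translation_group" "h \<in> GammaL1 p" "g = t \<otimes>\<^bsub>Sym\<^esub> h"
    using assms unfolding AGammaL1_def set_mult_def by blast
  obtain a k where ak: "a \<in> GL1" "k \<in> generate Sym {frob p}" "h = a \<otimes>\<^bsub>Sym\<^esub> k"
    using th(2) unfolding GammaL1_def set_mult_def by blast
  obtain u where u: "u \<noteq> 0" "a = sl u 0" using ak(1) by (auto simp: GL1_def scal_eq_sl)
  obtain j where j: "k = sl 1 j" using gen[OF ak(2)] by blast
  have h: "h = sl u j" unfolding ak(3) u(2) j using u(1) sl_bij by (simp add: sl_comp)
  obtain v where v: "t = (\<lambda>x. x + v)" using th(1) by (auto simp: translation_group_def)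
  have "bij t" unfolding v by (rule bij_betwI[of _ _ _ "\<lambda>x. x - v"]) auto
  then have "g = (\<lambda>x. sl u j x + v)" unfolding th(3) h using u(1) sl_bij by (simp add: v comp_def)
  then show ?thesis using that u(1) by blast
qed

theorem theorem1p3:
  fixes p f :: nat
    and l :: "'a :: {field, finite}"
    and G H :: "('a \<Rightarrow> 'a) set"
  assumes "Factorial_Ring.prime p" and "f > 0" and "CARD('a) = p ^ f"
    and "l \<noteq> 0" and "generate Sym {scal l} = GL1"
    and "subgroup G (sub (AGammaL1 p))"
    and "H = stabilizer (sub G) (\<lambda>g. g) 0"
    and "G = translation_group <#>\<^bsub>Sym\<^esub> H"
    and "primitive G"
    and "H \<noteq> {\<one>\<^bsub>Sym\<^esub>}"
  shows "non_basic (sub G) \<longleftrightarrow>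
    p mod 4 = 3 \<and>
    f = 2 \<and>
    (dihedral (sub H) \<and> (\<exists>m. card H = 2 ^ m) \<and>
     (\<exists>e c. e dvd p + 1 \<and> c \<in> GL1 \<and>
        H = conjugate_subgroup Sym (generate Sym {frob p, scal (l ^ ((p - 1) * e))}) c))"
proof -
  interpret semilinear p f l using semilinear_if_generator[OF assms(1-5)] .
  have GA: "G \<subseteq> AGammaL1 p" using subgroup.subset[OF assms(6)] by simp
  have bijG: "bij g" if "g \<in> G" for g
  proof -
    obtain u j v where g: "u \<noteq> 0" "g = (\<lambda>x. sl u j x + v)" using AGammaL1_E GA \<open>g \<in> G\<close> by blast
    then have "inj g" using sl_bij[OF g(1), of j] by (simp add: inj_def bij_def)
    then show ?thesis by (simp add: bij_def finite_UNIV_inj_surj)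
  qed
  have Gg: "perm_group G" unfolding perm_group_def
    using subgroup.one_closed[OF assms(6)] subgroup.m_closed[OF assms(6)] bijG by simp
  have Hdef: "H = {g \<in> G. g 0 = 0}" unfolding assms(7) stabilizer_def by simp
  have Hg: "perm_group H" unfolding Hdef perm_group_def using perm_groupD[OF Gg] by auto
  have Hsl: "\<exists>u j. u \<noteq> 0 \<and> h = sl u j" if "h \<in> H" for h
  proof -
    have h: "h \<in> G" "h 0 = 0" using that Hdef by auto
    obtain u j v where uv: "u \<noteq> 0" "h = (\<lambda>x. sl u j x + v)" using AGammaL1_E GA h(1) by blast
    then have "v = 0" using h(2) by simp
    then show ?thesis using uv by auto
  qed
  interpret semilinear_group p f l H by unfold_locales (use Hg Hsl in auto)
  have mult: "(\<lambda>x. x + v) \<otimes>\<^bsub>Sym\<^esub> h = (\<lambda>x. h x + v)" if "h \<in> H" for h v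
    using perm_groupD(2)[OF perm_group_translation, of "\<lambda>x. x + v"] perm_groupD(2)[OF Hg that]
    by (simp add: translation_group_def comp_def)
  have GH: "G = affine_group"
    unfolding assms(8) set_mult_def affine_group_def translation_group_def using mult by auto
  have prim: "primitive affine_group" using assms(9) unfolding GH .
  have nontriv: "H \<noteq> {id}" using assms(10) by simp
  show ?thesis unfolding GH non_basic_iff[OF prim]
    using non_basic_imp[OF prim nontriv] non_basicI[OF prim] by blast
qed

end
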